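(* Let $d\geq 2$ be an integer. Then there exists $q_\star=q_\star(d)\in\left[2\frac{d+1}{d-1},\infty\right)$ with the following property: if constant functions maximize $\Phi_{d,q}$ for some $q\geq q_\star$, then any real-valued, continuously differentiable maximizer of $\Phi_{d,q+2}$ is a constant function.
   Context: Here $q$ is a real exponent (not necessarily an integer). For $d\geq 2$, $\sigma_{d-1}$ denotes the usual surface measure on the unit sphere $\mathbb{S}^{d-1}\subset\mathbb{R}^d$, and $L^2(\mathbb{S}^{d-1})$ is the space of complex-valued functions square-integrable with respect to $\sigma_{d-1}$. The extension operator is $\widehat{f\sigma}_{d-1}(x)=\int_{\mathbb{S}^{d-1}} f(\omega)e^{-ix\cdot\omega}\,d\sigma_{d-1}(\omega)$, $x\in\mathbb{R}^d$. For $q\geq q_d:=2\frac{d+1}{d-1}$ (the range in which the extension operator is bounded from $L^2(\mathbb{S}^{d-1})$ to $L^q(\mathbb{R}^d)$) and $0\neq f\in L^2(\mathbb{S}^{d-1})$, set $$\Phi_{d,q}(f)=\frac{\|\widehat{f\sigma}_{d-1}\|_{L^q(\mathbb{R}^d)}^q}{\|f\|_{L^2(\mathbb{S}^{d-1})}^q}.$$ A maximizer of $\Phi_{d,q}$ is a nonzero $f\in L^2(\mathbb{S}^{d-1})$ with $\Phi_{d,q}(f)=\sup_{0\neq g\in L^2(\mathbb{S}^{d-1})}\Phi_{d,q}(g)$. *)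

theory Defs
  imports "HOL-Analysis.Analysis"
begin

text \<open>
  The surface measure on the unit sphere of \<open>\<real>\<^sup>d\<close>, obtained from polar coordinates: for a Borel
  subset \<open>A\<close> of the sphere, \<open>\<sigma>(A) = d \<sdot> |{x. 0 < |x| \<le> 1 \<and> x/|x| \<in> A}|\<close>, the factor \<open>d\<close> coming
  from the radial integral of \<open>r\<^sup>d\<^sup>-\<^sup>1\<close> over \<open>(0,1]\<close>; see \<open>emeasure_sphere_measure\<close>.  The space of
  this measure is the sphere itself, so measurability and integrals with respect to it depend only
  on the values of a function on the sphere.
\<close>

definition sphere_measure :: "(real ^ 'd) measure" where
  "sphere_measure =
     scale_measure (of_nat CARD('d))
       (distr (restrict_space lborel (cball 0 1 - {0})) (restrict_space borel (sphere 0 1))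
          (\<lambda>x. x /\<^sub>R norm x))"

lemma space_sphere_measure: "space (sphere_measure :: (real ^ 'd) measure) = sphere 0 1"
  by (simp add: sphere_measure_def space_scale_measure space_restrict_space)

lemma sets_sphere_measure:
  "sets (sphere_measure :: (real ^ 'd) measure) = sets (restrict_space borel (sphere 0 1))"
  by (simp add: sphere_measure_def)

lemma radial_projection_measurable:
  "(\<lambda>x :: real ^ 'd. x /\<^sub>R norm x)
     \<in> measurable (restrict_space lborel (cball 0 1 - {0})) (restrict_space borel (sphere 0 1))"
proof (rule measurable_restrict_space2)
  show "(\<lambda>x :: real ^ 'd. x /\<^sub>R norm x)
      \<in> space (restrict_space lborel (cball 0 1 - {0})) \<rightarrow> sphere 0 1"
    by (auto simp: space_restrict_space)
  show "(\<lambda>x :: real ^ 'd. x /\<^sub>R norm x)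
      \<in> borel_measurable (restrict_space lborel (cball 0 1 - {0}))"
    by (intro measurable_restrict_space1) measurable
qed

lemma emeasure_sphere_measure:
  fixes A :: "(real ^ 'd) set"
  assumes "A \<in> sets sphere_measure"
  shows "emeasure sphere_measure A =
    of_nat CARD('d) * emeasure lborel {x. 0 < norm x \<and> norm x \<le> 1 \<and> x /\<^sub>R norm x \<in> A}"
proof -
  have A: "A \<in> sets (restrict_space borel (sphere 0 1))"
    using assms by (simp add: sets_sphere_measure)
  have "(\<lambda>x. x /\<^sub>R norm x) -` A \<inter> space (restrict_space lborel (cball 0 1 - {0}))
      = {x. 0 < norm x \<and> norm x \<le> 1 \<and> x /\<^sub>R norm x \<in> A}"
    by (auto simp: space_restrict_space)
  moreover have "{x. 0 < norm x \<and> norm x \<le> 1 \<and> x /\<^sub>R norm x \<in> A} \<subseteq> cball 0 1 - {0}"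
    by auto
  ultimately show ?thesis
    by (simp add: sphere_measure_def emeasure_distr[OF radial_projection_measurable A]
        emeasure_restrict_space)
qed

definition extension :: "(real ^ 'd \<Rightarrow> complex) \<Rightarrow> real ^ 'd \<Rightarrow> complex" where
  "extension f x = (LINT \<omega>|sphere_measure. f \<omega> * exp (- (\<i> * complex_of_real (x \<bullet> \<omega>))))"

definition L2_sphere :: "(real ^ 'd \<Rightarrow> complex) set" where
  "L2_sphere = {f. f \<in> borel_measurable sphere_measure \<and>
                   integrable sphere_measure (\<lambda>\<omega>. (norm (f \<omega>))\<^sup>2)}"

definition L2_sphere_norm :: "(real ^ 'd \<Rightarrow> complex) \<Rightarrow> real" where
  "L2_sphere_norm f = sqrt (LINT \<omega>|sphere_measure. (norm (f \<omega>))\<^sup>2)"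

text \<open>Elements of \<open>L\<^sup>2\<close> are represented by functions, so being nonzero is meant up to null sets.\<close>

definition L2_sphere_nonzero :: "(real ^ 'd \<Rightarrow> complex) set" where
  "L2_sphere_nonzero = {f \<in> L2_sphere. \<not> (AE \<omega> in sphere_measure. f \<omega> = 0)}"

text \<open>
  The functional takes values in \<^typ>\<open>ennreal\<close>, so that neither the \<open>L\<^sup>q\<close> norm of the extension nor
  the supremum below needs a finiteness assumption.
\<close>

definition Phi :: "real \<Rightarrow> (real ^ 'd \<Rightarrow> complex) \<Rightarrow> ennreal" where
  "Phi q f = (\<integral>\<^sup>+ x. ennreal (norm (extension f x) powr q) \<partial>lborel)
               / ennreal (L2_sphere_norm f powr q)"

definition maximizer :: "real \<Rightarrow> (real ^ 'd \<Rightarrow> complex) \<Rightarrow> bool" where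
  "maximizer q f \<longleftrightarrow> f \<in> L2_sphere_nonzero \<and>
     Phi q f = (SUP g \<in> (L2_sphere_nonzero :: (real ^ 'd \<Rightarrow> complex) set). Phi q g)"

definition C1_on_open :: "(real ^ 'd) set \<Rightarrow> (real ^ 'd \<Rightarrow> complex) \<Rightarrow> bool" where
  "C1_on_open U g \<longleftrightarrow> open U \<and>
     (\<exists>g' :: real ^ 'd \<Rightarrow> ((real ^ 'd) \<Rightarrow>\<^sub>L complex).
        (\<forall>x\<in>U. (g has_derivative blinfun_apply (g' x)) (at x)) \<and> continuous_on U g')"

text \<open>
  Continuous differentiability on the sphere as an embedded submanifold: near each point the
  function is the restriction of a continuously differentiable function on an open subset of
  the ambient space.
\<close>

definition C1_on_sphere :: "(real ^ 'd \<Rightarrow> complex) \<Rightarrow> bool" where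
  "C1_on_sphere f \<longleftrightarrow>
     (\<forall>\<omega> \<in> sphere 0 1. \<exists>U g. \<omega> \<in> U \<and> C1_on_open U g \<and> (\<forall>x \<in> U \<inter> sphere 0 1. g x = f x))"

end

theory Submission
  imports Defs "HOL-Real_Asymp.Real_Asymp"
begin

text \<open>
  Write \<open>E\<close> for the extension operator, \<open>d\<close> for the dimension, \<open>|\<sigma>|\<close> for the total mass of the
  sphere, and let \<open>f\<close> be a real continuous maximizer for the exponent \<open>q + 2\<close>, with \<open>u = E f\<close>.
  The proof is a trace argument for the positive operator \<open>T\<close> with quadratic form
  \<open>\<langle>T g, g\<rangle> = \<integral> |u|\<^sup>q |E g|\<^sup>2\<close>.

  \<^item> \<^emph>\<open>The trace of \<open>T\<close> is \<open>|\<sigma>| \<integral> |u|\<^sup>q\<close>.\<close>  Indeed \<open>E g(x)\<close> is the inner product of \<open>g\<close> with a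
    character of squared norm \<open>|\<sigma>|\<close>, so Bessel's inequality at each \<open>x\<close> bounds the sum of
    \<open>\<langle>T g, g\<rangle> / \<langle>g, g\<rangle>\<close> over an orthogonal system by \<open>|\<sigma>| \<integral> |u|\<^sup>q\<close> (\<open>bessel_energy\<close>).

  \<^item> \<^emph>\<open>Large values of the form.\<close>  The Euler--Lagrange equation (\<open>maximal_imp_critical\<close>) says
    \<open>T f = \<mu> f\<close>, where \<open>\<mu> = \<integral> |u|\<^sup>q\<^sup>+\<^sup>2 / \<langle>f, f\<rangle>\<close>.  The symmetries of the functional, rotations and
    modulations \<open>f \<mapsto> e\<^sup>-\<^sup>i\<^sup>y\<^sup>\<omega> f\<close>, move \<open>f\<close> through further solutions.  Comparing the equations of \<open>f\<close>
    and of a nearby solution gives \<open>\<langle>T g, g\<rangle> \<ge> \<mu> / (q + 1) \<langle>g, g\<rangle>\<close> for the tangent directions \<open>g\<close>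
    (\<open>symmetric_variation\<close>).  Modulations contribute the \<open>d\<close>-dimensional space of the functions
    \<open>(y \<bullet> \<omega>) f\<close> (\<open>modulation_energy\<close>), and if \<open>f\<close> is not constant then rotations contribute at
    least one more dimension.  Parity makes all these directions orthogonal: \<open>T\<close> commutes with
    the antipodal map, so the even and odd parts of \<open>f\<close> are both eigenfunctions for \<open>\<mu>\<close>, and
    unless one of them vanishes the trace is already at least \<open>2 \<mu>\<close> (\<open>parity_dichotomy\<close>).
    Altogether a nonconstant \<open>f\<close> forces
    \<open>|\<sigma>| \<integral> |u|\<^sup>q \<ge> \<mu> (1 + (d + 1) / (q + 1))\<close> (\<open>nonconstant_trace_bound\<close>).

  \<^item> \<^emph>\<open>An upper bound for the trace.\<close>  Constants maximize at \<open>q\<close> and do not beat \<open>f\<close> at \<open>q + 2\<close>.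
    Hence the trace divided by \<open>\<mu>\<close> is at most \<open>I(q) / I(q + 2)\<close>, where \<open>I(q) = \<integral> |m|\<^sup>q\<close> and
    \<open>m = E 1 / |\<sigma>|\<close>.  Near the origin \<open>m(x)\<close> is close to \<open>exp (- |x|\<^sup>2 / 2d)\<close> and elsewhere \<open>|m|\<close>
    stays away from \<open>1\<close>, so \<open>I(q) / I(q + 2)\<close> is \<open>1 + d / q\<close> up to lower order terms.
    For large \<open>q\<close> this is smaller than \<open>1 + (d + 1) / (q + 1)\<close> (\<open>transform_moment_ratio\<close>), because a
    nonconstant \<open>f\<close> has \<open>d + 1\<close> independent symmetry directions against the \<open>d\<close> of a constant.

  The integrals \<open>I(q)\<close> must be finite for large \<open>q\<close>.  Any power decay of \<open>m\<close> is enough for that, and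
  it comes from the Bessel type equation \<open>h'' + (d - 1) / t h' + h = 0\<close> of the radial profile \<open>h\<close>
  of \<open>m\<close> (\<open>profile_bound_decay\<close>).
\<close>

section \<open>Invariance of Lebesgue measure and surface measure\<close>

text \<open>
  The image of Lebesgue measure under an orthogonal \<open>R\<close> is translation invariant and gives the
  unit ball \<open>B\<close> the same mass.  Both facts are used through Tonelli's theorem: the integral of
  \<open>1\<^sub>A(R x) 1\<^sub>B(y - R x)\<close> over all \<open>x\<close> and \<open>y\<close> is evaluated in either order.
\<close>

lemma lborel_distr_orthogonal:
  fixes R :: "'a::euclidean_space \<Rightarrow> 'a"
  assumes R: "orthogonal_transformation R"
  shows "distr lborel borel R = lborel"
proof (rule measure_eqI)
  show "sets (distr lborel borel R) = sets (lborel :: 'a measure)" by simp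
  fix A assume "A \<in> sets (distr lborel borel R)"
  then have A[measurable]: "A \<in> sets borel" by simp
  have linR: "linear R" using R by (rule orthogonal_transformation_linear)
  have [measurable]: "R \<in> borel_measurable borel"
    using linR linear_continuous_on[of R UNIV] by (intro borel_measurable_continuous_onI) (simp add: linear_conv_bounded_linear)
  have surjR: "surj R" using R by (rule orthogonal_transformation_surj)
  define B :: "'a set" where "B = cball 0 1"
  have [measurable]: "B \<in> sets borel" by (simp add: B_def)
  define v where "v = emeasure lborel B"
  have v: "v \<noteq> 0" "v \<noteq> \<infinity>"
    using emeasure_lborel_cball_finite[of "0::'a" 1] content_cball_pos[of 1 "0::'a"]
    by (auto simp: v_def B_def measure_def top.not_eq_extremum)
  have tr: "(\<integral>\<^sup>+y. g (a + y) \<partial>lborel) = (\<integral>\<^sup>+y. g y \<partial>lborel)"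
    if [measurable]: "g \<in> borel_measurable borel" for g :: "'a \<Rightarrow> ennreal" and a
    by (subst (2) lborel_distr_plus[of a, symmetric]) (simp add: nn_integral_distr)
  let ?A = "indicator A :: 'a \<Rightarrow> ennreal" and ?B = "indicator B :: 'a \<Rightarrow> ennreal"
  have "emeasure (distr lborel borel R) A = (\<integral>\<^sup>+x. ?A x \<partial>distr lborel borel R)" by simp
  also have "\<dots> = (\<integral>\<^sup>+x. ?A (R x) \<partial>lborel)" by (rule nn_integral_distr) auto
  finally have "emeasure (distr lborel borel R) A * v = (\<integral>\<^sup>+x. ?A (R x) * v \<partial>lborel)"
    by (simp add: nn_integral_multc)
  also have "\<dots> = (\<integral>\<^sup>+x. \<integral>\<^sup>+y. ?A (R x) * ?B (- R x + y) \<partial>lborel \<partial>lborel)"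
  proof -
    have "(\<integral>\<^sup>+y. ?B (y - a) \<partial>lborel) = v" for a
      using tr[of ?B "- a"] by (simp add: v_def)
    then show ?thesis by (intro nn_integral_cong) (simp add: nn_integral_cmult)
  qed
  also have "\<dots> = (\<integral>\<^sup>+y. \<integral>\<^sup>+x. ?A (R x) * ?B (- R x + y) \<partial>lborel \<partial>lborel)"
    by (rule lborel_pair.Fubini'[symmetric]) measurable
  also have "\<dots> = (\<integral>\<^sup>+y. \<integral>\<^sup>+x. ?A (R x + y) * ?B (- R x) \<partial>lborel \<partial>lborel)"
  proof (rule nn_integral_cong)
    fix y
    obtain z where z: "R z = y" using surjR by (metis surjD)
    have "(\<integral>\<^sup>+x. ?A (R x) * ?B (- R x + y) \<partial>lborel) = (\<integral>\<^sup>+x. ?A (R (z + x)) * ?B (- R (z + x) + y) \<partial>lborel)"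
      by (rule tr[symmetric]) measurable
    also have "\<dots> = (\<integral>\<^sup>+x. ?A (R x + y) * ?B (- R x) \<partial>lborel)"
      by (simp add: linear_add[OF linR] z add.commute)
    finally show "(\<integral>\<^sup>+x. ?A (R x) * ?B (- R x + y) \<partial>lborel) = (\<integral>\<^sup>+x. ?A (R x + y) * ?B (- R x) \<partial>lborel)" .
  qed
  also have "\<dots> = (\<integral>\<^sup>+x. \<integral>\<^sup>+y. ?A (R x + y) * ?B (- R x) \<partial>lborel \<partial>lborel)"
    by (rule lborel_pair.Fubini') measurable
  also have "\<dots> = (\<integral>\<^sup>+x. emeasure lborel A * ?B x \<partial>lborel)"
  proof (rule nn_integral_cong)
    fix x
    have "?B (- R x) = ?B x"
      using orthogonal_transformation_norm[OF R, of x] by (simp add: B_def indicator_def)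
    then show "(\<integral>\<^sup>+y. ?A (R x + y) * ?B (- R x) \<partial>lborel) = emeasure lborel A * ?B x"
      using tr[of ?A "R x"] by (simp add: nn_integral_multc)
  qed
  also have "\<dots> = emeasure lborel A * v"
    by (simp add: nn_integral_cmult v_def)
  finally have "v * emeasure (distr lborel borel R) A = v * emeasure lborel A"
    by (simp only: mult.commute)
  then show "emeasure (distr lborel borel R) A = emeasure lborel A"
    using v unfolding ennreal_mult_cancel_left by (simp add: infinity_ennreal_def)
qed

lemma distr_sphere_measure_orthogonal:
  fixes R :: "real ^ 'd \<Rightarrow> real ^ 'd"
  assumes R: "orthogonal_transformation R"
  shows "distr sphere_measure sphere_measure R = sphere_measure" "R \<in> measurable sphere_measure sphere_measure"
proof -
  have contR: "continuous_on UNIV R"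
    using R by (intro linear_continuous_on) (simp add: linear_conv_bounded_linear[symmetric] orthogonal_transformation_linear)
  then have [measurable]: "R \<in> borel_measurable borel" by (intro borel_measurable_continuous_onI)
  show meas: "R \<in> measurable sphere_measure sphere_measure"
    unfolding measurable_cong_sets[OF sets_sphere_measure sets_sphere_measure]
    using R by (intro measurable_restrict_space3) (auto simp: orthogonal_transformation_norm)
  show "distr sphere_measure sphere_measure R = sphere_measure"
  proof (rule measure_eqI)
    fix A :: "(real^'d) set" assume "A \<in> sets (distr sphere_measure sphere_measure R)"
    then have A: "A \<in> sets sphere_measure" by simp
    then have [measurable]: "A \<in> sets borel" 
      by (auto simp: sets_sphere_measure sets_restrict_space)
    have A': "R -` A \<inter> sphere 0 1 \<in> sets sphere_measure"
      using measurable_sets[OF meas A] by (simp add: space_sphere_measure)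
    let ?C = "\<lambda>A. {x :: real^'d. 0 < norm x \<and> norm x \<le> 1 \<and> x /\<^sub>R norm x \<in> A}"
    have [measurable]: "?C A \<in> sets borel" by measurable
    have "emeasure (distr sphere_measure sphere_measure R) A = emeasure sphere_measure (R -` A \<inter> sphere 0 1)"
      by (simp add: emeasure_distr meas A space_sphere_measure)
    also have "\<dots> = of_nat CARD('d) * emeasure lborel (?C (R -` A \<inter> sphere 0 1))"
      using A' by (rule emeasure_sphere_measure)
    also have "?C (R -` A \<inter> sphere 0 1) = R -` ?C A"
    proof -
      have R0: "R x = 0 \<longleftrightarrow> x = 0" for x
        using orthogonal_transformation_norm[OF R, of x] by (metis norm_eq_zero)
      show ?thesis
        using orthogonal_transformation_norm[OF R] linear_cmul[OF orthogonal_transformation_linear[OF R]]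
        by (auto simp: R0)
    qed
    also have "emeasure lborel (R -` ?C A) = emeasure (distr lborel borel R) (?C A)"
      by (subst emeasure_distr) auto
    also have "\<dots> = emeasure lborel (?C A)" by (simp add: lborel_distr_orthogonal[OF R])
    finally show "emeasure (distr sphere_measure sphere_measure R) A = emeasure sphere_measure A"
      by (simp add: emeasure_sphere_measure[OF A])
  qed simp
qed

lemma finite_measure_sphere_measure: "finite_measure (sphere_measure :: (real^'d) measure)"
proof (rule finite_measureI)
  have S: "sphere 0 1 \<in> sets (sphere_measure :: (real^'d) measure)"
    by (metis space_sphere_measure sets.top)
  have "emeasure lborel {x :: real^'d. 0 < norm x \<and> norm x \<le> 1 \<and> x /\<^sub>R norm x \<in> sphere 0 1} \<le> emeasure lborel (cball (0::real^'d) 1)"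
    by (intro emeasure_mono) auto
  also have "\<dots> < \<infinity>" by (rule emeasure_lborel_cball_finite)
  finally show "emeasure (sphere_measure :: (real^'d) measure) (space sphere_measure) \<noteq> \<infinity>"
    unfolding space_sphere_measure emeasure_sphere_measure[OF S]
    by (auto simp: ennreal_mult_eq_top_iff)
qed

interpretation sphere_measure: finite_measure "sphere_measure :: (real^'d) measure"
  by (rule finite_measure_sphere_measure)

lemma integral_sphere_orthogonal:
  fixes g :: "real ^ 'd \<Rightarrow> 'b::{banach, second_countable_topology}" and R :: "real ^ 'd \<Rightarrow> real ^ 'd"
  assumes R: "orthogonal_transformation R" and g: "g \<in> borel_measurable sphere_measure"
  shows "(LINT \<omega>|sphere_measure. g (R \<omega>)) = (LINT \<omega>|sphere_measure. g \<omega>)"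
proof -
  have "(LINT \<omega>|sphere_measure. g (R \<omega>)) = integral\<^sup>L (distr sphere_measure sphere_measure R) g"
    by (rule integral_distr[symmetric, OF distr_sphere_measure_orthogonal(2)[OF R] g])
  then show ?thesis by (simp add: distr_sphere_measure_orthogonal(1)[OF R])
qed

lemma borel_measurable_continuous_on_sphere:
  fixes g :: "real ^ 'd \<Rightarrow> 'b::topological_space"
  assumes "continuous_on (sphere 0 1) g"
  shows "g \<in> borel_measurable sphere_measure"
  unfolding measurable_cong_sets[OF sets_sphere_measure refl]
  by (rule borel_measurable_continuous_on_restrict[OF assms])

lemma continuous_on_sphere_bounded:
  fixes g :: "real^'d \<Rightarrow> 'b::real_normed_vector"
  assumes "continuous_on (sphere 0 1) g"
  obtains K where "K \<ge> 0" "\<And>\<omega>. norm \<omega> = 1 \<Longrightarrow> norm (g \<omega>) \<le> K"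
proof -
  have "bounded (g ` sphere 0 1)"
    using assms compact_continuous_image compact_imp_bounded compact_sphere by blast
  then obtain K where "K > 0" "\<forall>y\<in>g ` sphere 0 1. norm y \<le> K" unfolding bounded_pos by blast
  then show ?thesis using that[of K] by simp
qed

lemma integrable_continuous_on_sphere:
  fixes g :: "real ^ 'd \<Rightarrow> 'b::{banach, second_countable_topology}"
  assumes "continuous_on (sphere 0 1) g"
  shows "integrable sphere_measure g"
proof -
  obtain B where "\<And>\<omega>. norm \<omega> = 1 \<Longrightarrow> norm (g \<omega>) \<le> B"
    using continuous_on_sphere_bounded[OF assms] by blast
  then show ?thesis
    by (intro sphere_measure.integrable_const_bound[of _ B] AE_I2 borel_measurable_continuous_on_sphere assms)
      (simp add: space_sphere_measure)
qed

text \<open>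
  A relatively open part of the sphere spans a cone that contains a nonempty open subset of the
  ball.  Hence continuous functions that vanish almost everywhere on the sphere vanish on it.
\<close>

lemma emeasure_sphere_measure_open_pos:
  fixes U :: "(real^'d) set"
  assumes "open U" "w \<in> U" "norm w = 1"
  shows "emeasure sphere_measure (U \<inter> sphere 0 1) > 0"
proof -
  have m: "U \<inter> sphere 0 1 \<in> sets sphere_measure"
    unfolding sets_sphere_measure sets_restrict_space
    by (rule image_eqI[of _ _ U]) (use assms(1) in \<open>auto simp: Int_commute\<close>)
  let ?V = "{x \<in> ball 0 1 - {0}. x /\<^sub>R norm x \<in> U}"
  have "continuous_on (ball 0 1 - {0}) (\<lambda>x::real^'d. x /\<^sub>R norm x)"
    by (intro continuous_intros) auto
  moreover have "open (ball (0::real^'d) 1 - {0})" by (intro open_Diff) auto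
  ultimately have "open ((ball 0 1 - {0}) \<inter> (\<lambda>x::real^'d. x /\<^sub>R norm x) -` U)"
    using assms(1) by (rule continuous_open_preimage)
  also have "(ball 0 1 - {0}) \<inter> (\<lambda>x::real^'d. x /\<^sub>R norm x) -` U = ?V" by blast
  finally have "open ?V" .
  moreover have "(1/2) *\<^sub>R w \<in> ?V" using assms(2,3) by auto
  then have "?V \<noteq> {}" by blast
  ultimately have "\<not> negligible ?V" by (rule open_not_negligible)
  then have "?V \<notin> null_sets lborel"
    using null_sets_completionI[of ?V lborel] by (simp only: negligible_iff_null_sets) blast
  then have "emeasure lborel ?V > 0"
    using \<open>open ?V\<close> by (auto simp: null_sets_def zero_less_iff_neq_zero)
  also have "emeasure lborel ?V \<le> emeasure lborel {x. 0 < norm x \<and> norm x \<le> 1 \<and> x /\<^sub>R norm x \<in> U \<inter> sphere 0 1}"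
  proof (rule emeasure_mono)
    have [measurable]: "U \<in> sets borel" using assms(1) by simp
    have "{x :: real^'d. 0 < norm x \<and> norm x \<le> 1 \<and> x /\<^sub>R norm x \<in> U} \<in> sets borel" by measurable
    also have "{x. 0 < norm x \<and> norm x \<le> 1 \<and> x /\<^sub>R norm x \<in> U} = {x. 0 < norm x \<and> norm x \<le> 1 \<and> x /\<^sub>R norm x \<in> U \<inter> sphere 0 1}"
      by auto
    finally show "{x. 0 < norm x \<and> norm x \<le> 1 \<and> x /\<^sub>R norm x \<in> U \<inter> sphere 0 1} \<in> sets lborel" by simp
  qed auto
  finally show ?thesis
    unfolding emeasure_sphere_measure[OF m] by (simp add: ennreal_zero_less_mult_iff)
qed

lemma integral_square_sphere_pos:
  fixes g :: "real ^ 'd \<Rightarrow> real"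
  assumes g: "continuous_on (sphere 0 1) g" and w: "norm w = 1" "g w \<noteq> 0"
  shows "(LINT \<omega>|sphere_measure. (g \<omega>)\<^sup>2) > 0"
proof (rule ccontr)
  assume "\<not> ?thesis"
  moreover have "(LINT \<omega>|sphere_measure. (g \<omega>)\<^sup>2) \<ge> 0" by simp
  ultimately have "(LINT \<omega>|sphere_measure. (g \<omega>)\<^sup>2) = 0" by linarith
  then have "AE \<omega> in sphere_measure. (g \<omega>)\<^sup>2 = 0"
    using g by (subst (asm) integral_nonneg_eq_0_iff_AE)
      (auto intro!: integrable_continuous_on_sphere continuous_intros)
  then have ae: "AE \<omega> in sphere_measure. g \<omega> = 0" by simp
  obtain U where U: "open U" "g -` (- {0}) \<inter> sphere 0 1 = U \<inter> sphere 0 1"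
    using continuous_on_open_invariant[of "sphere 0 1" g] g by (metis open_delete open_UNIV Compl_eq_Diff_UNIV)
  have "w \<in> g -` (- {0}) \<inter> sphere 0 1" using w by simp
  then have "w \<in> U" unfolding U(2) by blast
  from emeasure_sphere_measure_open_pos[OF U(1) this w(1)]
  have "emeasure sphere_measure (U \<inter> sphere 0 1) > 0" .
  moreover have "emeasure sphere_measure (U \<inter> sphere 0 1) = 0"
  proof (rule emeasure_eq_0_AE[THEN trans[rotated]])
    have "U \<inter> sphere 0 1 = {x \<in> space sphere_measure. g x \<noteq> 0}"
      unfolding U(2)[symmetric] by (auto simp: space_sphere_measure)
    then show "emeasure sphere_measure (U \<inter> sphere 0 1) = emeasure sphere_measure {x \<in> space sphere_measure. g x \<noteq> 0}"
      by (rule arg_cong)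
    show "AE x in sphere_measure. \<not> g x \<noteq> 0" using ae by simp
  qed
  ultimately show False by simp
qed

section \<open>The extension operator on continuous functions\<close>

abbreviation sphere_mass :: "('d::finite) itself \<Rightarrow> real" where
  "sphere_mass _ \<equiv> measure (sphere_measure :: (real^'d) measure) (space sphere_measure)"

definition sphere_inner :: "(real^'d \<Rightarrow> real) \<Rightarrow> (real^'d \<Rightarrow> real) \<Rightarrow> real" where
  "sphere_inner a b = (LINT \<omega>|sphere_measure. a \<omega> * b \<omega>)"

abbreviation sphere_sq :: "(real^'d \<Rightarrow> real) \<Rightarrow> real" where
  "sphere_sq a \<equiv> sphere_inner a a"

abbreviation real_extension :: "(real^'d \<Rightarrow> real) \<Rightarrow> real^'d \<Rightarrow> complex" where
  "real_extension F \<equiv> extension (\<lambda>\<omega>. complex_of_real (F \<omega>))"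

lemma extension_cong:
  fixes g h :: "real^'d \<Rightarrow> complex"
  assumes "\<And>\<omega>. norm \<omega> = 1 \<Longrightarrow> g \<omega> = h \<omega>"
  shows "extension g x = extension h x"
  unfolding extension_def
  by (rule Bochner_Integration.integral_cong) (use assms in \<open>auto simp: space_sphere_measure\<close>)

lemma sphere_inner_cong:
  fixes a b a' b' :: "real^'d \<Rightarrow> real"
  assumes "\<And>\<omega>. norm \<omega> = 1 \<Longrightarrow> a \<omega> = a' \<omega>" "\<And>\<omega>. norm \<omega> = 1 \<Longrightarrow> b \<omega> = b' \<omega>"
  shows "sphere_inner a b = sphere_inner a' b'"
  unfolding sphere_inner_def
  by (rule Bochner_Integration.integral_cong) (use assms in \<open>auto simp: space_sphere_measure\<close>)

lemma integrable_extension: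
  fixes g :: "real^'d \<Rightarrow> complex"
  assumes "continuous_on (sphere 0 1) g"
  shows "integrable sphere_measure (\<lambda>\<omega>. g \<omega> * exp (- (\<i> * complex_of_real (x \<bullet> \<omega>))))"
  by (intro integrable_continuous_on_sphere continuous_intros assms)

lemma extension_add:
  fixes g h :: "real^'d \<Rightarrow> complex"
  assumes "continuous_on (sphere 0 1) g" "continuous_on (sphere 0 1) h"
  shows "extension (\<lambda>\<omega>. g \<omega> + h \<omega>) x = extension g x + extension h x"
  using integrable_extension[OF assms(1), of x] integrable_extension[OF assms(2), of x]
  by (simp add: extension_def ring_distribs)

lemma extension_cmult:
  fixes g :: "real^'d \<Rightarrow> complex"
  shows "extension (\<lambda>\<omega>. c * g \<omega>) x = c * extension g x"
  by (simp add: extension_def mult.assoc)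

lemma extension_diff:
  fixes g h :: "real^'d \<Rightarrow> complex"
  assumes "continuous_on (sphere 0 1) g" "continuous_on (sphere 0 1) h"
  shows "extension (\<lambda>\<omega>. g \<omega> - h \<omega>) x = extension g x - extension h x"
  using integrable_extension[OF assms(1), of x] integrable_extension[OF assms(2), of x]
  by (simp add: extension_def ring_distribs)

lemma norm_extension_le:
  fixes g :: "real^'d \<Rightarrow> complex"
  assumes "continuous_on (sphere 0 1) g" "\<And>\<omega>. norm \<omega> = 1 \<Longrightarrow> norm (g \<omega>) \<le> K"
  shows "norm (extension g x) \<le> K * sphere_mass TYPE('d)"
proof -
  have "norm (extension g x) \<le> (LINT \<omega>|(sphere_measure :: (real^'d) measure). K)"
    unfolding extension_def
    by (rule Bochner_Integration.integral_norm_bound_integral[OF integrable_extension[OF assms(1)]])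
      (use assms(2) in \<open>auto simp: norm_mult space_sphere_measure\<close>)
  then show ?thesis by (simp add: mult.commute)
qed

lemma one_minus_cos_le: "1 - cos x \<le> x\<^sup>2 / 2" for x :: real
proof -
  have "1 - cos x = 2 * (sin (x/2))\<^sup>2" using cos_double_sin[of "x/2"] by simp
  also have "(sin (x/2))\<^sup>2 \<le> (x/2)\<^sup>2" using abs_sin_x_le_abs_x[of "x/2"] abs_le_square_iff by blast
  finally show ?thesis by (simp add: power_divide)
qed

lemma norm_cis_diff_squared: "(norm (cis a - cis b))\<^sup>2 = 2 * (1 - cos (a - b))"
proof -
  have "(norm (cis a - cis b))\<^sup>2 = ((cos a)\<^sup>2 + (sin a)\<^sup>2) + ((cos b)\<^sup>2 + (sin b)\<^sup>2) - 2 * (cos a * cos b + sin a * sin b)"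
    by (simp add: cmod_power2 power2_diff algebra_simps)
  then show ?thesis by (simp add: cos_diff)
qed

lemma norm_cis_diff_le: "norm (cis a - cis b) \<le> \<bar>a - b\<bar>"
proof -
  have "(norm (cis a - cis b))\<^sup>2 \<le> \<bar>a - b\<bar>\<^sup>2"
    unfolding norm_cis_diff_squared using one_minus_cos_le[of "a - b"] by simp
  then show ?thesis by (rule power2_le_imp_le) simp
qed

lemma continuous_extension:
  fixes g :: "real^'d \<Rightarrow> complex"
  assumes g: "continuous_on (sphere 0 1) g"
  shows "continuous_on UNIV (extension g)"
proof -
  obtain K where K0: "K \<ge> 0" and K: "\<And>\<omega>. norm \<omega> = 1 \<Longrightarrow> norm (g \<omega>) \<le> K"
    using continuous_on_sphere_bounded[OF g] by blast
  let ?m = "sphere_mass TYPE('d)"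
  have lip: "norm (extension g x - extension g y) \<le> K * ?m * norm (x - y)" for x y
  proof -
    have "norm (extension g x - extension g y) = norm (LINT \<omega>|sphere_measure. g \<omega> * exp (- (\<i> * complex_of_real (x \<bullet> \<omega>))) - g \<omega> * exp (- (\<i> * complex_of_real (y \<bullet> \<omega>))))"
      unfolding extension_def
      using integrable_extension[OF g, of x] integrable_extension[OF g, of y] by simp
    also have "\<dots> \<le> (LINT \<omega>|(sphere_measure :: (real^'d) measure). K * norm (x - y))"
    proof (rule Bochner_Integration.integral_norm_bound_integral)
      fix \<omega> :: "real^'d" assume "\<omega> \<in> space sphere_measure"
      then have w: "norm \<omega> = 1" by (simp add: space_sphere_measure)
      have "norm (g \<omega> * exp (- (\<i> * complex_of_real (x \<bullet> \<omega>))) - g \<omega> * exp (- (\<i> * complex_of_real (y \<bullet> \<omega>))))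
        = norm (g \<omega>) * norm (cis (- (x \<bullet> \<omega>)) - cis (- (y \<bullet> \<omega>)))"
        by (simp add: norm_mult[symmetric] algebra_simps cis_conv_exp)
      also have "\<dots> \<le> K * \<bar>- (x \<bullet> \<omega>) - (- (y \<bullet> \<omega>))\<bar>"
        using K[OF w] K0 by (intro mult_mono norm_cis_diff_le) auto
      also have "\<bar>- (x \<bullet> \<omega>) - (- (y \<bullet> \<omega>))\<bar> = \<bar>(x - y) \<bullet> \<omega>\<bar>" by (simp add: inner_diff_left)
      also have "\<dots> \<le> norm (x - y)" using Cauchy_Schwarz_ineq2[of "x - y" \<omega>] w by simp
      finally show "norm (g \<omega> * exp (- (\<i> * complex_of_real (x \<bullet> \<omega>))) - g \<omega> * exp (- (\<i> * complex_of_real (y \<bullet> \<omega>)))) \<le> K * norm (x - y)"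
        using K0 by (auto intro: mult_left_mono)
    qed (use integrable_extension[OF g] in auto)
    finally show ?thesis by (simp add: mult_ac)
  qed
  have "(K * ?m)-lipschitz_on UNIV (extension g)"
    by (rule lipschitz_onI) (use lip K0 in \<open>auto simp: dist_norm\<close>)
  then show ?thesis by (rule lipschitz_on_continuous_on)
qed

lemma extension_bounded:
  fixes g :: "real^'d \<Rightarrow> complex"
  assumes "continuous_on (sphere 0 1) g"
  obtains K where "K \<ge> 0" "\<And>x. norm (extension g x) \<le> K"
proof -
  obtain K where "K \<ge> 0" "\<And>\<omega>. norm \<omega> = 1 \<Longrightarrow> norm (g \<omega>) \<le> K"
    using continuous_on_sphere_bounded[OF assms] by blast
  then show ?thesis using that[of "K * sphere_mass TYPE('d)"] norm_extension_le[OF assms] by simp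
qed

lemma continuous_norm_extension_powr:
  fixes f :: "real^'d \<Rightarrow> complex"
  assumes "continuous_on (sphere 0 1) f" "q > 0"
  shows "continuous_on UNIV (\<lambda>x. norm (extension f x) powr q)"
  using assms by (intro continuous_on_powr' continuous_intros continuous_extension) auto

lemma integrable_powr_extension_mult:
  fixes f :: "real^'d \<Rightarrow> complex" and h :: "real^'d \<Rightarrow> real"
  assumes f: "continuous_on (sphere 0 1) f" and q: "q \<ge> 1"
    and int: "integrable lborel (\<lambda>x. norm (extension f x) powr q)"
    and h: "continuous_on UNIV h" "\<And>x. \<bar>h x\<bar> \<le> K"
  shows "integrable lborel (\<lambda>x. norm (extension f x) powr q * h x)"
proof (rule Bochner_Integration.integrable_bound)
  show "integrable lborel (\<lambda>x. norm (extension f x) powr q * K)" using int by simp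
  have "continuous_on UNIV (\<lambda>x. norm (extension f x) powr q * h x)"
    using q by (intro continuous_on_mult continuous_norm_extension_powr f h(1)) auto
  then show "(\<lambda>x. norm (extension f x) powr q * h x) \<in> borel_measurable lborel"
    using borel_measurable_continuous_onI by simp
  show "AE x in lborel. norm (norm (extension f x) powr q * h x) \<le> norm (norm (extension f x) powr q * K)"
    using h(2) by (intro AE_I2) (auto simp: abs_mult intro!: mult_left_mono intro: order_trans[OF _ abs_ge_self])
qed

lemma integrable_powr_extension_cross:
  fixes f g h :: "real^'d \<Rightarrow> complex"
  assumes f: "continuous_on (sphere 0 1) f" and q: "q \<ge> 1"
    and int: "integrable lborel (\<lambda>x. norm (extension f x) powr q)"
    and g: "continuous_on (sphere 0 1) g" and h: "continuous_on (sphere 0 1) h"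
  shows "integrable lborel (\<lambda>x. norm (extension f x) powr q * Re (cnj (extension g x) * extension h x))"
proof -
  obtain K where K: "K \<ge> 0" "\<And>x. norm (extension g x) \<le> K" using extension_bounded[OF g] by blast
  obtain L where L: "L \<ge> 0" "\<And>x. norm (extension h x) \<le> L" using extension_bounded[OF h] by blast
  show ?thesis
  proof (rule integrable_powr_extension_mult[OF f q int])
    show "continuous_on UNIV (\<lambda>x. Re (cnj (extension g x) * extension h x))"
      by (intro continuous_intros continuous_extension g h)
    fix x
    have "\<bar>Re (cnj (extension g x) * extension h x)\<bar> \<le> norm (extension g x) * norm (extension h x)"
      using abs_Re_le_cmod[of "cnj (extension g x) * extension h x"] by (simp add: norm_mult)
    also have "\<dots> \<le> K * L" using K L by (intro mult_mono) auto
    finally show "\<bar>Re (cnj (extension g x) * extension h x)\<bar> \<le> K * L" .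
  qed
qed

lemma integrable_powr_extension_square:
  fixes f g :: "real^'d \<Rightarrow> complex"
  assumes "continuous_on (sphere 0 1) f" "q \<ge> 1" "integrable lborel (\<lambda>x. norm (extension f x) powr q)"
    and g: "continuous_on (sphere 0 1) g"
  shows "integrable lborel (\<lambda>x. norm (extension f x) powr q * (norm (extension g x))\<^sup>2)"
proof -
  have "(norm z)\<^sup>2 = Re (cnj z * z)" for z unfolding cmod_power2 by (simp add: power2_eq_square)
  then show ?thesis using integrable_powr_extension_cross[OF assms(1-3) g g] by simp
qed

lemma extension_orthogonal:
  fixes g :: "real^'d \<Rightarrow> complex" and R :: "real^'d \<Rightarrow> real^'d"
  assumes g: "continuous_on (sphere 0 1) g" and R: "orthogonal_transformation R"
  shows "extension (\<lambda>\<omega>. g (R \<omega>)) x = extension g (R x)"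
proof -
  have "extension (\<lambda>\<omega>. g (R \<omega>)) x = (LINT \<omega>|sphere_measure. g (R \<omega>) * exp (- (\<i> * complex_of_real (R x \<bullet> R \<omega>))))"
    using R by (simp add: extension_def orthogonal_transformation_def)
  also have "\<dots> = extension g (R x)"
    unfolding extension_def
    by (rule integral_sphere_orthogonal[OF R]) (rule borel_measurable_integrable[OF integrable_extension[OF g]])
  finally show ?thesis .
qed

lemma extension_modulate:
  fixes g :: "real^'d \<Rightarrow> complex"
  shows "extension (\<lambda>\<omega>. cis (- (y \<bullet> \<omega>)) * g \<omega>) x = extension g (x + y)"
proof -
  have "cis (- (y \<bullet> \<omega>)) * g \<omega> * exp (- (\<i> * complex_of_real (x \<bullet> \<omega>))) = g \<omega> * exp (- (\<i> * complex_of_real ((x + y) \<bullet> \<omega>)))" for \<omega>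
  proof -
    have "exp (- (\<i> * complex_of_real ((x + y) \<bullet> \<omega>))) = exp (- (\<i> * complex_of_real (x \<bullet> \<omega>))) * exp (- (\<i> * complex_of_real (y \<bullet> \<omega>)))"
      by (simp add: inner_add_left ring_distribs exp_add[symmetric])
    then show ?thesis by (simp add: cis_conv_exp)
  qed
  then show ?thesis by (simp only: extension_def)
qed

lemma real_extension_eq:
  fixes F :: "real^'d \<Rightarrow> real"
  assumes "continuous_on (sphere 0 1) F"
  shows "real_extension F x = Complex (sphere_inner (\<lambda>\<omega>. cos (x \<bullet> \<omega>)) F) (- sphere_inner (\<lambda>\<omega>. sin (x \<bullet> \<omega>)) F)"
proof -
  have eq: "complex_of_real (F \<omega>) * exp (- (\<i> * complex_of_real (x \<bullet> \<omega>))) =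
     complex_of_real (cos (x \<bullet> \<omega>) * F \<omega>) - \<i> * complex_of_real (sin (x \<bullet> \<omega>) * F \<omega>)" for \<omega>
  proof -
    have "exp (- (\<i> * complex_of_real (x \<bullet> \<omega>))) = cis (- (x \<bullet> \<omega>))" by (simp add: cis_conv_exp)
    then show ?thesis by (simp add: complex_eq_iff)
  qed
  have "integrable sphere_measure (\<lambda>\<omega>. cos (x \<bullet> \<omega>) * F \<omega>)" "integrable sphere_measure (\<lambda>\<omega>. sin (x \<bullet> \<omega>) * F \<omega>)"
    by (intro integrable_continuous_on_sphere continuous_intros assms)+
  then have "real_extension F x = complex_of_real (sphere_inner (\<lambda>\<omega>. cos (x \<bullet> \<omega>)) F) - \<i> * complex_of_real (sphere_inner (\<lambda>\<omega>. sin (x \<bullet> \<omega>)) F)"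
    unfolding extension_def eq sphere_inner_def
    by (subst Bochner_Integration.integral_diff) (auto simp del: of_real_mult)
  then show ?thesis by (simp add: complex_eq_iff)
qed

lemma sphere_inner_commute: "sphere_inner a b = sphere_inner b a"
  by (simp add: sphere_inner_def mult.commute)

lemma sphere_inner_cmult: "sphere_inner (\<lambda>\<omega>. c * a \<omega>) b = c * sphere_inner a b" 
  "sphere_inner a (\<lambda>\<omega>. c * b \<omega>) = c * sphere_inner a b" 
  by (simp_all add: sphere_inner_def mult_ac)

lemma sphere_inner_diff:
  fixes a b e :: "real^'d \<Rightarrow> real"
  assumes "continuous_on (sphere 0 1) a" "continuous_on (sphere 0 1) b" "continuous_on (sphere 0 1) e"
  shows "sphere_inner (\<lambda>\<omega>. a \<omega> - b \<omega>) e = sphere_inner a e - sphere_inner b e"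
    "sphere_inner e (\<lambda>\<omega>. a \<omega> - b \<omega>) = sphere_inner e a - sphere_inner e b"
proof -
  have "integrable sphere_measure (\<lambda>\<omega>. a \<omega> * e \<omega>)" "integrable sphere_measure (\<lambda>\<omega>. b \<omega> * e \<omega>)"
    by (intro integrable_continuous_on_sphere continuous_intros assms)+
  then show *: "sphere_inner (\<lambda>\<omega>. a \<omega> - b \<omega>) e = sphere_inner a e - sphere_inner b e"
    by (simp add: sphere_inner_def algebra_simps)
  then show "sphere_inner e (\<lambda>\<omega>. a \<omega> - b \<omega>) = sphere_inner e a - sphere_inner e b"
    by (simp only: sphere_inner_commute[of e])
qed

lemma sphere_inner_add:
  fixes a b e :: "real^'d \<Rightarrow> real"
  assumes "continuous_on (sphere 0 1) a" "continuous_on (sphere 0 1) b" "continuous_on (sphere 0 1) e"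
  shows "sphere_inner (\<lambda>\<omega>. a \<omega> + b \<omega>) e = sphere_inner a e + sphere_inner b e"
    "sphere_inner e (\<lambda>\<omega>. a \<omega> + b \<omega>) = sphere_inner e a + sphere_inner e b"
proof -
  have "integrable sphere_measure (\<lambda>\<omega>. a \<omega> * e \<omega>)" "integrable sphere_measure (\<lambda>\<omega>. b \<omega> * e \<omega>)"
    by (intro integrable_continuous_on_sphere continuous_intros assms)+
  then show *: "sphere_inner (\<lambda>\<omega>. a \<omega> + b \<omega>) e = sphere_inner a e + sphere_inner b e"
    by (simp add: sphere_inner_def algebra_simps)
  then show "sphere_inner e (\<lambda>\<omega>. a \<omega> + b \<omega>) = sphere_inner e a + sphere_inner e b"
    by (simp only: sphere_inner_commute[of e])
qed

lemma sphere_sq_nonneg: "sphere_sq a \<ge> 0"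
  by (simp add: sphere_inner_def)

lemma sphere_sq_pos:
  fixes g :: "real ^ 'd \<Rightarrow> real"
  assumes "continuous_on (sphere 0 1) g" "norm w = 1" "g w \<noteq> 0"
  shows "sphere_sq g > 0"
  using integral_square_sphere_pos[OF assms] by (simp add: sphere_inner_def power2_eq_square)

lemma sphere_inner_orthogonal:
  fixes a b :: "real ^ 'd \<Rightarrow> real" and R :: "real^'d \<Rightarrow> real^'d"
  assumes "orthogonal_transformation R" "continuous_on (sphere 0 1) a" "continuous_on (sphere 0 1) b"
  shows "sphere_inner (\<lambda>\<omega>. a (R \<omega>)) (\<lambda>\<omega>. b (R \<omega>)) = sphere_inner a b"
  unfolding sphere_inner_def
  by (rule integral_sphere_orthogonal[OF assms(1)])
    (intro borel_measurable_continuous_on_sphere continuous_intros assms)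

text \<open>
  Induction on the index set: one member of the system is projected away from \<open>e\<close>.  Only
  orthogonality is required of the system, so that nothing has to be normalized later.
\<close>

lemma bessel_sphere:
  fixes \<phi> :: "'i \<Rightarrow> real^'d \<Rightarrow> real" and e :: "real^'d \<Rightarrow> real"
  assumes "finite I" and "\<And>i. i \<in> I \<Longrightarrow> continuous_on (sphere 0 1) (\<phi> i)"
    and "\<And>i j. i \<in> I \<Longrightarrow> j \<in> I \<Longrightarrow> i \<noteq> j \<Longrightarrow> sphere_inner (\<phi> i) (\<phi> j) = 0"
    and "\<And>i. i \<in> I \<Longrightarrow> sphere_sq (\<phi> i) > 0"
    and "continuous_on (sphere 0 1) e"
  shows "(\<Sum>i\<in>I. (sphere_inner e (\<phi> i))\<^sup>2 / sphere_sq (\<phi> i)) \<le> sphere_sq e"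
  using assms
proof (induction I arbitrary: e rule: finite_induct)
  case empty
  then show ?case by (simp add: sphere_sq_nonneg)
next
  case (insert j I)
  define c where "c = sphere_inner e (\<phi> j) / sphere_sq (\<phi> j)"
  define e' where "e' = (\<lambda>\<omega>. e \<omega> - c * \<phi> j \<omega>)"
  have cj: "continuous_on (sphere 0 1) (\<phi> j)" using insert.prems by blast
  have cc: "continuous_on (sphere 0 1) (\<lambda>\<omega>. c * \<phi> j \<omega>)" by (intro continuous_intros cj)
  have ce: "continuous_on (sphere 0 1) e'" unfolding e'_def by (intro continuous_intros insert.prems cj)
  have nz: "sphere_sq (\<phi> j) \<noteq> 0" using insert.prems(3)[of j] by simp
  have eq: "sphere_inner e' (\<phi> i) = sphere_inner e (\<phi> i)" if "i \<in> I" for i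
  proof -
    have "sphere_inner (\<phi> j) (\<phi> i) = 0" using that insert.prems(2)[of j i] insert.hyps by auto
    then show ?thesis unfolding e'_def using that insert.prems
      by (subst sphere_inner_diff(1)[OF _ cc]) (auto simp: sphere_inner_cmult)
  qed
  have c1: "sphere_inner e' (\<phi> j) = 0"
    unfolding e'_def sphere_inner_diff(1)[OF insert.prems(4) cc cj] sphere_inner_cmult
    using nz by (simp add: c_def)
  have "sphere_sq e' = sphere_inner e' e - c * sphere_inner e' (\<phi> j)"
    by (subst (2) e'_def, subst sphere_inner_diff(2)[OF insert.prems(4) cc ce]) (simp add: sphere_inner_cmult)
  also have "\<dots> = sphere_sq e - c * sphere_inner e (\<phi> j)"
    unfolding c1 by (simp, subst e'_def, subst sphere_inner_diff(1)[OF insert.prems(4) cc insert.prems(4)])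
      (simp add: sphere_inner_cmult sphere_inner_commute)
  finally have sq: "sphere_sq e' = sphere_sq e - (sphere_inner e (\<phi> j))\<^sup>2 / sphere_sq (\<phi> j)"
    by (simp add: power2_eq_square c_def)
  have "(\<Sum>i\<in>I. (sphere_inner e' (\<phi> i))\<^sup>2 / sphere_sq (\<phi> i)) \<le> sphere_sq e'"
    by (rule insert.IH) (use insert.prems ce in auto)
  then show ?case using insert.hyps by (simp add: eq sq)
qed

text \<open>
  The extension of a real function at \<open>x\<close> has the inner products with \<open>cos (x \<bullet> \<omega>)\<close> and
  \<open>sin (x \<bullet> \<omega>)\<close> as real and (up to sign) imaginary part, and
  \<open>cos\<^sup>2 + sin\<^sup>2 = 1\<close> makes the two Bessel bounds add up to the mass of the sphere.
\<close>

lemma bessel_extension: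
  fixes \<phi> :: "'i \<Rightarrow> real^'d \<Rightarrow> real"
  assumes "finite I" and cont: "\<And>i. i \<in> I \<Longrightarrow> continuous_on (sphere 0 1) (\<phi> i)"
    and "\<And>i j. i \<in> I \<Longrightarrow> j \<in> I \<Longrightarrow> i \<noteq> j \<Longrightarrow> sphere_inner (\<phi> i) (\<phi> j) = 0"
    and "\<And>i. i \<in> I \<Longrightarrow> sphere_sq (\<phi> i) > 0"
  shows "(\<Sum>i\<in>I. (norm (real_extension (\<phi> i) x))\<^sup>2 / sphere_sq (\<phi> i))
    \<le> sphere_mass TYPE('d)"
proof -
  let ?c = "\<lambda>\<omega>. cos (x \<bullet> \<omega>)" and ?s = "\<lambda>\<omega>. sin (x \<bullet> \<omega>)"
  have cc: "continuous_on (sphere 0 1) ?c" and cs: "continuous_on (sphere 0 1) ?s" by (intro continuous_intros)+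
  have "(\<Sum>i\<in>I. (norm (real_extension (\<phi> i) x))\<^sup>2 / sphere_sq (\<phi> i))
     = (\<Sum>i\<in>I. (sphere_inner ?c (\<phi> i))\<^sup>2 / sphere_sq (\<phi> i)) + (\<Sum>i\<in>I. (sphere_inner ?s (\<phi> i))\<^sup>2 / sphere_sq (\<phi> i))"
    unfolding sum.distrib[symmetric]
    by (intro sum.cong refl) (simp add: real_extension_eq cont cmod_power2 add_divide_distrib)
  also have "\<dots> \<le> sphere_sq ?c + sphere_sq ?s"
    by (intro add_mono bessel_sphere assms cc cs)
  also have "\<dots> = (LINT \<omega>|sphere_measure. ?c \<omega> * ?c \<omega> + ?s \<omega> * ?s \<omega>)"
    unfolding sphere_inner_def
    by (rule Bochner_Integration.integral_add[symmetric])
      (intro integrable_continuous_on_sphere continuous_intros)+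
  also have "\<dots> = sphere_mass TYPE('d)"
    by (simp flip: power2_eq_square)
  finally show ?thesis .
qed

section \<open>Pointwise inequalities\<close>

text \<open>
  Convexity of \<open>x \<mapsto> x\<^sup>P\<close>: the graph lies above its tangent at \<open>a\<close>.
\<close>

lemma powr_tangent:
  fixes a b P :: real
  assumes "P \<ge> 1" "a \<ge> 0" "b \<ge> 0"
  shows "a powr P + P * a powr (P - 1) * (b - a) \<le> b powr P"
proof (cases "a = 0 \<or> b = 0")
  case True
  then show ?thesis
  proof
    assume b: "b = 0"
    have "a powr P = a powr (P - 1) * a"
      using assms(2) by (cases "a = 0") (auto simp: powr_mult_base mult.commute)
    then have "a powr P + P * a powr (P - 1) * (b - a) = (1 - P) * a powr P" using b by (simp add: algebra_simps)
    also have "\<dots> \<le> 0" using assms by (intro mult_nonpos_nonneg) auto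
    finally show ?thesis using b by simp
  qed auto
next
  case False
  then have ab: "a > 0" "b > 0" using assms by auto
  have "(b powr P) powr (1/P) * (a powr P) powr (1 - 1/P) \<le> (1/P) * b powr P + (1 - 1/P) * a powr P"
    using assms ab by (intro Youngs_inequality_0) auto
  also have "(b powr P) powr (1/P) * (a powr P) powr (1 - 1/P) = b * a powr (P - 1)"
  proof -
    have "P * (1 - 1/P) = P - 1" using assms by (simp add: right_diff_distrib)
    then show ?thesis using assms ab by (simp add: powr_powr)
  qed
  finally have "P * (b * a powr (P - 1)) \<le> b powr P + (P - 1) * a powr P"
    using assms by (simp add: field_simps)
  moreover have "a powr P = a powr (P - 1) * a"
    using ab by (simp add: powr_mult_base mult.commute)
  ultimately show ?thesis by (simp add: algebra_simps)
qed

lemma norm_powr_tangent: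
  fixes a b :: complex and P :: real
  assumes "P \<ge> 1"
  shows "norm a powr P + P * (norm a powr (P - 2) * Re (cnj a * b)) \<le> norm (a + b) powr P"
proof -
  have "Re (cnj a * b) = Re (cnj a * (a + b)) - (norm a)\<^sup>2"
    unfolding cmod_power2 by (simp add: power2_eq_square algebra_simps)
  also have "\<dots> \<le> norm a * norm (a + b) - (norm a)\<^sup>2"
    using complex_Re_le_cmod[of "cnj a * (a + b)"] by (simp add: norm_mult)
  finally have "Re (cnj a * b) \<le> norm a * (norm (a + b) - norm a)" by (simp add: power2_eq_square algebra_simps)
  then have "norm a powr (P - 2) * Re (cnj a * b) \<le> norm a powr (P - 2) * (norm a * (norm (a + b) - norm a))"
    by (rule mult_left_mono) simp
  also have "norm a powr (P - 2) * (norm a * (norm (a + b) - norm a)) = norm a powr (P - 1) * (norm (a + b) - norm a)"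
    using powr_mult_base[of "norm a" "P - 2"] by (simp add: mult.assoc[symmetric] mult.commute)
  finally have "P * (norm a powr (P - 2) * Re (cnj a * b)) \<le> P * norm a powr (P - 1) * (norm (a + b) - norm a)"
    using assms by (simp add: mult.assoc)
  then show ?thesis using powr_tangent[OF assms, of "norm a" "norm (a + b)"] by simp
qed

text \<open>
  The trapezoidal rule overestimates the integral of the convex function \<open>(q + 1) x\<^sup>q\<close> over
  \<open>[b, a]\<close>.  The sharp constant \<open>(q + 1) / 2\<close>, rather than \<open>q + 1\<close>, is essential for the trace argument.
\<close>

lemma powr_hermite_hadamard:
  fixes a b q :: real
  assumes q: "q \<ge> 1" and ab: "0 \<le> b" "b \<le> a"
  shows "a powr (q + 1) - b powr (q + 1) \<le> (q + 1) / 2 * (a powr q + b powr q) * (a - b)"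
proof (cases "b = 0")
  case True
  have "a powr (q + 1) = 1 * (a powr q * a)"
    using ab by (simp add: powr_mult_base[symmetric] add.commute)
  also have "\<dots> \<le> (q + 1) / 2 * (a powr q * a)"
    using q ab by (intro mult_right_mono) auto
  finally show ?thesis using True by simp
next
  case False
  then have b: "b > 0" using ab by simp
  let ?h = "\<lambda>x. (q + 1) / 2 * (x powr q + b powr q) * (x - b) - x powr (q + 1)"
  have "?h b \<le> ?h a"
  proof (rule DERIV_nonneg_imp_nondecreasing[OF ab(2)])
    fix x assume x: "b \<le> x" "x \<le> a"
    have x0: "x > 0" using x b by linarith
    have "(?h has_real_derivative (q + 1) / 2 * ((q * x powr (q - 1)) * (x - b) + (x powr q + b powr q)) - (q + 1) * x powr q) (at x)"
    proof -
      have d1: "((\<lambda>x. x powr q) has_real_derivative q * x powr (q - 1)) (at x)"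
        and d2: "((\<lambda>x. x powr (q + 1)) has_real_derivative (q + 1) * x powr q) (at x)"
        using has_real_derivative_powr[OF x0, of q] has_real_derivative_powr[OF x0, of "q + 1"] by simp_all
      have d3: "((\<lambda>x. (x powr q + b powr q) * (x - b)) has_real_derivative
          (q * x powr (q - 1)) * (x - b) + (x powr q + b powr q)) (at x)"
        using x0 by (auto intro!: derivative_eq_intros)
      show ?thesis
        using DERIV_diff[OF DERIV_cmult[OF d3, of "(q + 1) / 2"] d2] by (simp only: mult.assoc)
    qed
    moreover have "(q + 1) / 2 * ((q * x powr (q - 1)) * (x - b) + (x powr q + b powr q)) - (q + 1) * x powr q \<ge> 0"
    proof -
      have "(q + 1) / 2 * ((q * x powr (q - 1)) * (x - b) + (x powr q + b powr q)) - (q + 1) * x powr q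
        = (q + 1) / 2 * (b powr q - (x powr q + q * x powr (q - 1) * (b - x)))" by (simp add: field_simps)
      moreover have "\<dots> \<ge> 0"
        using powr_tangent[OF q, of x b] x0 b q by (intro mult_nonneg_nonneg) auto
      ultimately show ?thesis by simp
    qed
    ultimately show "\<exists>y. DERIV ?h x :> y \<and> 0 \<le> y" by blast
  qed
  then show ?thesis by simp
qed

text \<open>
  An upper Lipschitz type bound for the monotone map \<open>z \<mapsto> |z|\<^sup>q z\<close>.  With \<open>|v|\<close> and \<open>|u|\<close> fixed both
  sides are affine in \<open>s = Re (cnj v u)\<close>, the worst case is \<open>s = |v| |u|\<close>, and there the
  inequality is the real one above.  The weight on the right is the average of
  \<open>|v|\<^sup>q\<close> and \<open>|u|\<^sup>q\<close>: after a measure preserving substitution each of them becomes the same weight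
  \<open>|u|\<^sup>q\<close>, so no limit in the weight has to be taken.
\<close>

lemma norm_powr_monotone_bound:
  fixes v u :: complex
  assumes q: "q \<ge> 1"
  shows "norm v powr q * Re (cnj v * (v - u)) + norm u powr q * Re (cnj u * (u - v))
    \<le> (q + 1) / 2 * (norm v powr q + norm u powr q) * (norm (v - u))\<^sup>2"
proof -
  define \<alpha> \<beta> s where "\<alpha> = norm v" and "\<beta> = norm u" and "s = Re (cnj v * u)"
  have s: "s \<le> \<alpha> * \<beta>" unfolding s_def \<alpha>_def \<beta>_def
    using complex_Re_le_cmod[of "cnj v * u"] by (simp add: norm_mult)
  have e1: "Re (cnj v * (v - u)) = \<alpha>\<^sup>2 - s" "Re (cnj u * (u - v)) = \<beta>\<^sup>2 - s" "(norm (v - u))\<^sup>2 = \<alpha>\<^sup>2 + \<beta>\<^sup>2 - 2 * s"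
    unfolding \<alpha>_def \<beta>_def s_def cmod_power2 by (auto simp: power2_eq_square algebra_simps)
  have p: "x powr (q + 1) = x powr q * x" if "x \<ge> 0" for x :: real
    using that by (simp add: powr_mult_base[symmetric] add.commute)
  have nn: "\<alpha> \<ge> 0" "\<beta> \<ge> 0" by (auto simp: \<alpha>_def \<beta>_def)
  have HH: "(\<alpha> powr q * \<alpha> - \<beta> powr q * \<beta>) * (\<alpha> - \<beta>) \<le> (q + 1) / 2 * (\<alpha> powr q + \<beta> powr q) * (\<alpha> - \<beta>)\<^sup>2"
  proof (cases "\<beta> \<le> \<alpha>")
    case True
    have "\<alpha> powr q * \<alpha> - \<beta> powr q * \<beta> \<le> (q + 1) / 2 * (\<alpha> powr q + \<beta> powr q) * (\<alpha> - \<beta>)"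
      using powr_hermite_hadamard[OF q nn(2) True] by (simp add: p nn)
    from mult_right_mono[OF this, of "\<alpha> - \<beta>"] True show ?thesis by (simp add: power2_eq_square mult.assoc)
  next
    case False
    then have "\<beta> powr q * \<beta> - \<alpha> powr q * \<alpha> \<le> (q + 1) / 2 * (\<beta> powr q + \<alpha> powr q) * (\<beta> - \<alpha>)"
      using powr_hermite_hadamard[OF q nn(1), of \<beta>] by (simp add: p nn)
    from mult_right_mono[OF this, of "\<beta> - \<alpha>"] False show ?thesis
      by (simp add: power2_eq_square algebra_simps)
  qed
  have "q * (\<alpha> powr q + \<beta> powr q) * (\<alpha> * \<beta> - s) \<ge> 0"
    using q s by (intro mult_nonneg_nonneg add_nonneg_nonneg) auto
  with HH have "\<alpha> powr q * (\<alpha>\<^sup>2 - s) + \<beta> powr q * (\<beta>\<^sup>2 - s) \<le> (q + 1) / 2 * (\<alpha> powr q + \<beta> powr q) * (\<alpha>\<^sup>2 + \<beta>\<^sup>2 - 2 * s)"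
    by (simp add: power2_eq_square field_simps)
  then show ?thesis unfolding e1 \<alpha>_def[symmetric] \<beta>_def[symmetric] .
qed

text \<open>
  Taylor bounds for \<open>sin\<close>, \<open>cos\<close> and \<open>cis\<close>; the constants are not optimal, only the orders matter.
\<close>

lemma one_minus_cos_le_abs: "1 - cos x \<le> \<bar>x\<bar>" for x :: real
proof -
  have "1 - cos x = 2 * (\<bar>sin (x/2)\<bar> * \<bar>sin (x/2)\<bar>)"
    using cos_double_sin[of "x/2"] by (simp add: power2_eq_square)
  also have "\<bar>sin (x/2)\<bar> * \<bar>sin (x/2)\<bar> \<le> \<bar>x/2\<bar> * 1"
    by (intro mult_mono abs_sin_x_le_abs_x) auto
  finally show ?thesis by simp
qed

lemma sin_ge_quadratic:
  fixes x :: real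
  assumes "x \<ge> 0"
  shows "x - x\<^sup>2 / 2 \<le> sin x"
proof -
  let ?h = "\<lambda>x::real. sin x - x + x\<^sup>2 / 2"
  have "?h 0 \<le> ?h x"
  proof (rule DERIV_nonneg_imp_nondecreasing[OF assms])
    fix y assume y: "0 \<le> y" "y \<le> x"
    have "(?h has_real_derivative cos y - 1 + y) (at y)" by (auto intro!: derivative_eq_intros)
    moreover have "cos y - 1 + y \<ge> 0" using one_minus_cos_le_abs[of y] y by simp
    ultimately show "\<exists>z. DERIV ?h y :> z \<and> 0 \<le> z" by blast
  qed
  then show ?thesis by simp
qed

lemma abs_sin_minus_self_le: "\<bar>sin x - x\<bar> \<le> x\<^sup>2 / 2" for x :: real
proof (cases "x \<ge> 0")
  case True
  then show ?thesis using sin_ge_quadratic[of x] sin_x_le_x[of x] by simp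
next
  case False
  then show ?thesis using sin_ge_quadratic[of "-x"] sin_x_le_x[of "-x"] by simp
qed

lemma one_minus_cos_ge: "x\<^sup>2 / 2 - \<bar>x\<bar> ^ 3 / 4 \<le> 1 - cos x" for x :: real
proof -
  define y where "y = \<bar>x\<bar> / 2"
  have y: "y \<ge> 0" by (simp add: y_def)
  have *: "1 - cos x = 2 * (sin y)\<^sup>2"
    using cos_double_sin[of y] by (simp add: y_def)
  have "y\<^sup>2 - y ^ 3 \<le> (sin y)\<^sup>2"
  proof (cases "y \<le> 2")
    case True
    have "y * y \<le> 2 * y" using True y by (intro mult_right_mono) auto
    then have "0 \<le> y - y\<^sup>2/2" by (simp add: power2_eq_square)
    then have "(y - y\<^sup>2/2)\<^sup>2 \<le> (sin y)\<^sup>2" using sin_ge_quadratic[OF y] by (intro power_mono)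
    moreover have "(y - y\<^sup>2/2)\<^sup>2 = y\<^sup>2 - y ^ 3 + (y\<^sup>2/2)\<^sup>2" by (simp add: power2_eq_square power3_eq_cube algebra_simps)
    then have "y\<^sup>2 - y ^ 3 \<le> (y - y\<^sup>2/2)\<^sup>2" by simp
    ultimately show ?thesis by linarith
  next
    case False
    then have "y\<^sup>2 * 1 \<le> y\<^sup>2 * y" by (intro mult_left_mono) auto
    then have "y\<^sup>2 - y ^ 3 \<le> 0" by (simp add: power2_eq_square power3_eq_cube)
    then show ?thesis by (meson order_trans zero_le_power2)
  qed
  moreover have "x\<^sup>2 / 2 - \<bar>x\<bar> ^ 3 / 4 = 2 * (y\<^sup>2 - y ^ 3)"
    by (simp add: y_def power_divide)
  ultimately show ?thesis unfolding * by (simp only: mult_left_mono)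
qed

lemma norm_cis_second_order: "norm (cis x - 1 - \<i> * x) \<le> x\<^sup>2"
proof -
  have "norm (cis x - 1 - \<i> * x) \<le> \<bar>cos x - 1\<bar> + \<bar>sin x - x\<bar>"
    using cmod_le[of "cis x - 1 - \<i> * x"] by simp
  also have "\<dots> \<le> x\<^sup>2/2 + x\<^sup>2/2"
    using abs_sin_minus_self_le[of x] one_minus_cos_le[of x] cos_le_one[of x] by (intro add_mono) auto
  finally show ?thesis by simp
qed

section \<open>Critical points and their variations\<close>

text \<open>
  A real solution \<open>F\<close> of the Euler--Lagrange equation with exponent \<open>q + 2\<close> and multiplier \<open>\<mu>\<close>,
  in weak form against continuous complex test functions.  Complex test functions are needed
  because modulations of \<open>F\<close> are complex valued.
\<close>

locale critical_point =
  fixes F :: "real^'d \<Rightarrow> real" and q \<mu> :: real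
  assumes contF: "continuous_on (sphere 0 1) F"
    and q_ge_1: "q \<ge> 1"
    and mu_pos: "\<mu> > 0"
    and F_nonzero: "\<exists>\<omega>. norm \<omega> = 1 \<and> F \<omega> \<noteq> 0"
    and integrable_powr: "integrable lborel (\<lambda>x. norm (real_extension F x) powr q)"
    and euler_lagrange: "\<And>g :: real^'d \<Rightarrow> complex. continuous_on (sphere 0 1) g \<Longrightarrow>
      (LINT x|lborel. norm (real_extension F x) powr q * Re (cnj (real_extension F x) * extension g x))
      = \<mu> * (LINT \<omega>|sphere_measure. F \<omega> * Re (g \<omega>))"
begin

abbreviation u where "u \<equiv> real_extension F"

definition weighted_energy :: "(real^'d \<Rightarrow> complex) \<Rightarrow> real" where
  "weighted_energy g = (LINT x|lborel. norm (u x) powr q * (norm (extension g x))\<^sup>2)"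

lemma cont_cF: "continuous_on (sphere 0 1) (\<lambda>\<omega>. complex_of_real (F \<omega>))"
  by (intro continuous_intros contF)

lemma cont_u: "continuous_on UNIV u"
  by (rule continuous_extension[OF cont_cF])

lemma integrable_energy:
  "continuous_on (sphere 0 1) g \<Longrightarrow> integrable lborel (\<lambda>x. norm (u x) powr q * (norm (extension g x))\<^sup>2)"
  by (rule integrable_powr_extension_square[OF cont_cF q_ge_1 integrable_powr])

lemma integrable_cross:
  "continuous_on (sphere 0 1) g \<Longrightarrow> continuous_on (sphere 0 1) h \<Longrightarrow>
    integrable lborel (\<lambda>x. norm (u x) powr q * Re (cnj (extension g x) * extension h x))"
  by (rule integrable_powr_extension_cross[OF cont_cF q_ge_1 integrable_powr])

lemma weighted_energy_F: "weighted_energy (\<lambda>\<omega>. complex_of_real (F \<omega>)) = \<mu> * sphere_sq F"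
proof -
  have "Re (cnj z * z) = (norm z)\<^sup>2" for z unfolding cmod_power2 by (simp add: power2_eq_square)
  then show ?thesis using euler_lagrange[OF cont_cF]
    by (simp add: weighted_energy_def sphere_inner_def)
qed

text \<open>
  Let \<open>g\<close> and \<open>h\<close> be the images of \<open>F\<close> under a symmetry and its inverse, acting on extensions by
  the measure preserving maps \<open>\<tau>\<close> and \<open>\<tau>'\<close>.  The pointwise bound for \<open>v = E g\<close> and \<open>u\<close> is integrated;
  the terms weighted by \<open>|v|\<^sup>q\<close> are moved by \<open>\<tau>'\<close> to the weight \<open>|u|\<^sup>q\<close>, where they involve \<open>h\<close>.
  The Euler--Lagrange equation of \<open>F\<close> alone then evaluates the left-hand side.
\<close>

lemma symmetric_variation:
  fixes g h :: "real^'d \<Rightarrow> complex" and \<tau> \<tau>' :: "real^'d \<Rightarrow> real^'d"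
  assumes g: "continuous_on (sphere 0 1) g" and h: "continuous_on (sphere 0 1) h"
    and eg: "\<And>x. extension g x = u (\<tau> x)" and eh: "\<And>x. extension h x = u (\<tau>' x)"
    and inv: "\<And>x. \<tau> (\<tau>' x) = x" and meas: "\<tau>' \<in> borel_measurable borel" and dist: "distr lborel borel \<tau>' = lborel"
  shows "\<mu> * ((LINT \<omega>|sphere_measure. F \<omega> * (F \<omega> - Re (g \<omega>))) + (LINT \<omega>|sphere_measure. F \<omega> * (F \<omega> - Re (h \<omega>))))
    \<le> (q + 1) / 2 * (weighted_energy (\<lambda>\<omega>. g \<omega> - F \<omega>) + weighted_energy (\<lambda>\<omega>. h \<omega> - F \<omega>))"
proof -
  let ?v = "extension g" and ?w = "extension h"
  have cuv[measurable]: "?v \<in> borel_measurable borel" "u \<in> borel_measurable borel"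
    by (intro borel_measurable_continuous_onI continuous_extension g cont_cF)+
  have ext: "extension (\<lambda>\<omega>. F \<omega> - g \<omega>) x = u x - ?v x" "extension (\<lambda>\<omega>. F \<omega> - h \<omega>) x = u x - ?w x"
    "extension (\<lambda>\<omega>. g \<omega> - F \<omega>) x = ?v x - u x" "extension (\<lambda>\<omega>. h \<omega> - F \<omega>) x = ?w x - u x" for x
    by (rule extension_diff; intro cont_cF g h)+
  have cd: "continuous_on (sphere 0 1) (\<lambda>\<omega>. F \<omega> - g \<omega>)" "continuous_on (sphere 0 1) (\<lambda>\<omega>. F \<omega> - h \<omega>)"
     "continuous_on (sphere 0 1) (\<lambda>\<omega>. g \<omega> - F \<omega>)" "continuous_on (sphere 0 1) (\<lambda>\<omega>. h \<omega> - F \<omega>)"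
    by (intro continuous_intros cont_cF g h)+
  let ?A = "\<lambda>x. norm (u x) powr q * Re (cnj (u x) * (u x - ?w x))"
  let ?A' = "\<lambda>x. norm (?v x) powr q * Re (cnj (?v x) * (?v x - u x))"
  let ?B = "\<lambda>x. norm (u x) powr q * (norm (u x - ?w x))\<^sup>2"
  let ?B' = "\<lambda>x. norm (?v x) powr q * (norm (?v x - u x))\<^sup>2"
  let ?C = "\<lambda>x. norm (u x) powr q * Re (cnj (u x) * (u x - ?v x))"
  let ?D = "\<lambda>x. norm (u x) powr q * (norm (?v x - u x))\<^sup>2"
  have tr: "?A' (\<tau>' x) = ?A x" "?B' (\<tau>' x) = ?B x" for x
    by (simp_all add: eg eh inv)
  have change: "integrable lborel \<Gamma> = integrable lborel (\<lambda>x. \<Gamma> (\<tau>' x))" "(LINT x|lborel. \<Gamma> x) = (LINT x|lborel. \<Gamma> (\<tau>' x))"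
    if "\<Gamma> \<in> borel_measurable borel" for \<Gamma> :: "real^'d \<Rightarrow> real"
    using integrable_distr_eq[of \<tau>' lborel borel \<Gamma>] integral_distr[of \<tau>' lborel borel \<Gamma>] that meas dist by auto
  have mA: "?A' \<in> borel_measurable borel" and mB: "?B' \<in> borel_measurable borel"
    by (intro borel_measurable_continuous_onI continuous_intros continuous_on_powr' continuous_extension g cont_cF;
        use q_ge_1 in auto)+
  have iA: "integrable lborel ?A" and iC: "integrable lborel ?C"
    using integrable_cross[OF cont_cF cd(2)] integrable_cross[OF cont_cF cd(1)] unfolding ext by blast+
  have iB: "integrable lborel ?B" and iD: "integrable lborel ?D"
    using integrable_energy[OF cd(2)] integrable_energy[OF cd(3)] unfolding ext by blast+
  have "integrable lborel ?A'" "integrable lborel ?B'"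
    unfolding change(1)[OF mA] change(1)[OF mB] unfolding tr by (rule iA, rule iB)
  note int = this iA iB iC iD
  have "(LINT x|lborel. ?A' x + ?C x) \<le> (LINT x|lborel. (q + 1) / 2 * (?B' x + ?D x))"
  proof (rule integral_mono)
    fix x
    show "?A' x + ?C x \<le> (q + 1) / 2 * (?B' x + ?D x)"
      using norm_powr_monotone_bound[OF q_ge_1, of "?v x" "u x"] by (simp add: distrib_right mult.assoc)
  qed (use int in auto)
  then have main: "(LINT x|lborel. ?A x) + (LINT x|lborel. ?C x) \<le> (q + 1) / 2 * ((LINT x|lborel. ?B x) + (LINT x|lborel. ?D x))"
    using int change(2)[OF mA] change(2)[OF mB] unfolding tr by simp
  have "(LINT x|lborel. ?A x) = \<mu> * (LINT \<omega>|sphere_measure. F \<omega> * (F \<omega> - Re (h \<omega>)))"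
    "(LINT x|lborel. ?C x) = \<mu> * (LINT \<omega>|sphere_measure. F \<omega> * (F \<omega> - Re (g \<omega>)))"
    using euler_lagrange[OF cd(2)] euler_lagrange[OF cd(1)] unfolding ext by simp_all
  moreover have "(LINT x|lborel. ?B x) = weighted_energy (\<lambda>\<omega>. h \<omega> - F \<omega>)"
    "(LINT x|lborel. ?D x) = weighted_energy (\<lambda>\<omega>. g \<omega> - F \<omega>)"
    unfolding weighted_energy_def ext by (simp_all add: norm_minus_commute)
  ultimately show ?thesis using main by (simp add: distrib_left add.commute)
qed

text \<open>
  The trace bound: the right-hand side is the trace of the operator with quadratic form
  \<open>weighted_energy\<close>.
\<close>

lemma bessel_energy:
  fixes \<phi> :: "'i \<Rightarrow> real^'d \<Rightarrow> real"
  assumes "finite I" and cont: "\<And>i. i \<in> I \<Longrightarrow> continuous_on (sphere 0 1) (\<phi> i)"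
    and "\<And>i j. i \<in> I \<Longrightarrow> j \<in> I \<Longrightarrow> i \<noteq> j \<Longrightarrow> sphere_inner (\<phi> i) (\<phi> j) = 0"
    and "\<And>i. i \<in> I \<Longrightarrow> sphere_sq (\<phi> i) > 0"
  shows "(\<Sum>i\<in>I. weighted_energy (\<lambda>\<omega>. \<phi> i \<omega>) / sphere_sq (\<phi> i))
    \<le> sphere_mass TYPE('d) * (LINT x|lborel. norm (u x) powr q)"
proof -
  let ?m = "sphere_mass TYPE('d)"
  let ?e = "\<lambda>i x. norm (u x) powr q * (norm (real_extension (\<phi> i) x))\<^sup>2 / sphere_sq (\<phi> i)"
  have int: "integrable lborel (?e i)" if "i \<in> I" for i
    using integrable_energy[of "\<lambda>\<omega>. \<phi> i \<omega>"] cont[OF that] by (auto intro!: continuous_intros)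
  have "(\<Sum>i\<in>I. weighted_energy (\<lambda>\<omega>. \<phi> i \<omega>) / sphere_sq (\<phi> i)) = (LINT x|lborel. (\<Sum>i\<in>I. ?e i x))"
    using int by (simp add: weighted_energy_def)
  also have "\<dots> \<le> (LINT x|lborel. ?m * norm (u x) powr q)"
  proof (rule integral_mono)
    fix x
    have "(\<Sum>i\<in>I. ?e i x) = norm (u x) powr q * (\<Sum>i\<in>I. (norm (real_extension (\<phi> i) x))\<^sup>2 / sphere_sq (\<phi> i))"
      by (simp add: sum_distrib_left)
    also have "\<dots> \<le> norm (u x) powr q * ?m"
      by (intro mult_left_mono bessel_extension assms) auto
    finally show "(\<Sum>i\<in>I. ?e i x) \<le> ?m * norm (u x) powr q" by (simp add: mult.commute)
  qed (use int integrable_powr in auto)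
  finally show ?thesis by simp
qed

text \<open>
  The symmetric variation for \<open>G t = e\<^sup>-\<^sup>i\<^sup>t\<^sup>y\<^sup>\<omega> F\<close> and \<open>G (- t)\<close>, whose extensions are translates of
  \<open>u\<close>.  Both sides are \<open>t\<^sup>2\<close> times the claimed ones up to an error of order \<open>|t|\<^sup>3\<close>, by explicit Taylor
  bounds, and \<open>t\<close> tends to \<open>0\<close>.
\<close>

lemma modulation_energy:
  fixes y :: "real^'d"
  shows "\<mu> * sphere_sq (\<lambda>\<omega>. (y \<bullet> \<omega>) * F \<omega>) \<le> (q + 1) * weighted_energy (\<lambda>\<omega>. complex_of_real ((y \<bullet> \<omega>) * F \<omega>))"
proof -
  let ?k = "\<lambda>\<omega>. (y \<bullet> \<omega>) * F \<omega>"
  let ?E = "extension (\<lambda>\<omega>. complex_of_real (?k \<omega>))"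
  let ?I = "LINT x|lborel. norm (u x) powr q"
  let ?m = "sphere_mass TYPE('d)"
  have ck: "continuous_on (sphere 0 1) (\<lambda>\<omega>. complex_of_real (?k \<omega>))" by (intro continuous_intros contF)
  obtain K where K: "K \<ge> 0" "\<And>x. norm (?E x) \<le> K" using extension_bounded[OF ck] by blast
  obtain M where M0: "M \<ge> 0" and M: "\<And>\<omega>. norm \<omega> = 1 \<Longrightarrow> \<bar>F \<omega>\<bar> \<le> M"
    using continuous_on_sphere_bounded[OF contF] by (metis real_norm_def)
  have m0: "?m \<ge> 0" by simp
  have I0: "?I \<ge> 0" by simp
  define L where "L = (norm y)\<^sup>2 * M * ?m"
  have L0: "L \<ge> 0" using M0 by (simp add: L_def)
  define G where "G = (\<lambda>t \<omega>. cis (- ((t *\<^sub>R y) \<bullet> \<omega>)) * complex_of_real (F \<omega>))"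
  have cG: "continuous_on (sphere 0 1) (G t)" for t
    unfolding G_def cis_conv_exp by (intro continuous_intros contF)
  have eG: "extension (G t) x = u (x + t *\<^sub>R y)" for t x
    unfolding G_def by (rule extension_modulate)
  have wy: "\<bar>y \<bullet> \<omega>\<bar> \<le> norm y" if "norm \<omega> = 1" for \<omega>
    using Cauchy_Schwarz_ineq2[of y \<omega>] that by simp
  have near: "norm (extension (\<lambda>\<omega>. G t \<omega> - F \<omega>) x) \<le> \<bar>t\<bar> * norm (?E x) + t\<^sup>2 * L" for t x
  proof -
    let ?r = "\<lambda>\<omega>. (G t \<omega> - F \<omega>) - (- \<i> * t) * complex_of_real (?k \<omega>)"
    have cr: "continuous_on (sphere 0 1) ?r" by (intro continuous_intros cG cont_cF contF)
    have "norm (extension ?r x) \<le> (t\<^sup>2 * (norm y)\<^sup>2 * M) * ?m"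
    proof (rule norm_extension_le[OF cr])
      fix \<omega> :: "real^'d" assume w: "norm \<omega> = 1"
      have "?r \<omega> = (cis (- (t * (y \<bullet> \<omega>))) - 1 - \<i> * complex_of_real (- (t * (y \<bullet> \<omega>)))) * F \<omega>"
        by (simp add: G_def algebra_simps)
      then have "norm (?r \<omega>) = norm (cis (- (t * (y \<bullet> \<omega>))) - 1 - \<i> * complex_of_real (- (t * (y \<bullet> \<omega>)))) * \<bar>F \<omega>\<bar>"
        by (simp only: norm_mult norm_of_real)
      also have "\<dots> \<le> (- (t * (y \<bullet> \<omega>)))\<^sup>2 * M"
        by (intro mult_mono norm_cis_second_order M w) auto
      also have "(- (t * (y \<bullet> \<omega>)))\<^sup>2 \<le> t\<^sup>2 * (norm y)\<^sup>2"
        using wy[OF w] by (auto simp: power_mult_distrib intro!: mult_left_mono abs_le_square_iff[THEN iffD1])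
      finally show "norm (?r \<omega>) \<le> t\<^sup>2 * (norm y)\<^sup>2 * M" using M0 by (simp add: mult_right_mono)
    qed
    moreover have "extension ?r x = extension (\<lambda>\<omega>. G t \<omega> - F \<omega>) x - (- \<i> * t) * ?E x"
    proof -
      have "continuous_on (sphere 0 1) (\<lambda>\<omega>. G t \<omega> - F \<omega>)" "continuous_on (sphere 0 1) (\<lambda>\<omega>. (- \<i> * t) * complex_of_real (?k \<omega>))"
        by (intro continuous_intros cG cont_cF contF)+
      from extension_diff[OF this] show ?thesis by (simp only: extension_cmult)
    qed
    ultimately have "norm (extension (\<lambda>\<omega>. G t \<omega> - F \<omega>) x - (- \<i> * t) * ?E x) \<le> t\<^sup>2 * L"
      by (simp add: L_def mult.assoc)
    moreover have "norm ((- \<i> * t) * ?E x) = \<bar>t\<bar> * norm (?E x)" by (simp add: norm_mult)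
    ultimately show ?thesis
      using norm_triangle_sub[of "extension (\<lambda>\<omega>. G t \<omega> - F \<omega>) x" "(- \<i> * t) * ?E x"] by linarith
  qed
  define C where "C = (2 * K * L + L\<^sup>2) * ?I"
  have upper: "weighted_energy (\<lambda>\<omega>. G t \<omega> - F \<omega>) \<le> t\<^sup>2 * weighted_energy (\<lambda>\<omega>. complex_of_real (?k \<omega>)) + \<bar>t\<bar>^3 * C"
    if t: "\<bar>t\<bar> \<le> 1" for t
  proof -
    have "weighted_energy (\<lambda>\<omega>. G t \<omega> - F \<omega>) \<le>
       (LINT x|lborel. t\<^sup>2 * (norm (u x) powr q * (norm (?E x))\<^sup>2) + (\<bar>t\<bar>^3 * (2 * K * L + L\<^sup>2)) * norm (u x) powr q)"
      unfolding weighted_energy_def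
    proof (rule integral_mono)
      fix x
      have "(norm (extension (\<lambda>\<omega>. G t \<omega> - F \<omega>) x))\<^sup>2 \<le> (\<bar>t\<bar> * norm (?E x) + t\<^sup>2 * L)\<^sup>2"
        by (intro power_mono near) auto
      also have "\<dots> = t\<^sup>2 * (norm (?E x))\<^sup>2 + \<bar>t\<bar>^3 * (2 * norm (?E x) * L + \<bar>t\<bar> * L\<^sup>2)"
        by (simp add: power2_eq_square power3_eq_cube algebra_simps)
      also have "\<bar>t\<bar>^3 * (2 * norm (?E x) * L + \<bar>t\<bar> * L\<^sup>2) \<le> \<bar>t\<bar>^3 * (2 * K * L + 1 * L\<^sup>2)"
        using K(2) L0 t by (intro mult_left_mono add_mono mult_right_mono) auto
      finally have "(norm (extension (\<lambda>\<omega>. G t \<omega> - F \<omega>) x))\<^sup>2 \<le> t\<^sup>2 * (norm (?E x))\<^sup>2 + \<bar>t\<bar>^3 * (2 * K * L + L\<^sup>2)"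
        by simp
      from mult_left_mono[OF this, of "norm (u x) powr q"]
      show "norm (u x) powr q * (norm (extension (\<lambda>\<omega>. G t \<omega> - F \<omega>) x))\<^sup>2 \<le>
          t\<^sup>2 * (norm (u x) powr q * (norm (?E x))\<^sup>2) + (\<bar>t\<bar>^3 * (2 * K * L + L\<^sup>2)) * norm (u x) powr q"
        by (simp add: algebra_simps)
    qed (use integrable_energy[OF ck] integrable_powr in
        \<open>auto intro!: integrable_energy continuous_intros cG cont_cF contF\<close>)
    also have "\<dots> = t\<^sup>2 * weighted_energy (\<lambda>\<omega>. complex_of_real (?k \<omega>)) + \<bar>t\<bar>^3 * C"
      using integrable_energy[OF ck] integrable_powr by (simp add: weighted_energy_def C_def)
    finally show ?thesis .
  qed
  define A where "A = (LINT \<omega>|(sphere_measure :: (real^'d) measure). \<bar>y \<bullet> \<omega>\<bar>^3 * (F \<omega>)\<^sup>2)"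
  have lower: "t\<^sup>2 / 2 * sphere_sq ?k - \<bar>t\<bar>^3 / 4 * A \<le> (LINT \<omega>|sphere_measure. F \<omega> * (F \<omega> - Re (G t \<omega>)))" for t
  proof -
    have i: "integrable sphere_measure (\<lambda>\<omega>. ?k \<omega> * ?k \<omega>)" "integrable sphere_measure (\<lambda>\<omega>. \<bar>y \<bullet> \<omega>\<bar>^3 * (F \<omega>)\<^sup>2)"
      by (intro integrable_continuous_on_sphere continuous_intros contF)+
    have "t\<^sup>2 / 2 * sphere_sq ?k - \<bar>t\<bar>^3 / 4 * A = (LINT \<omega>|sphere_measure. t\<^sup>2 / 2 * (?k \<omega> * ?k \<omega>) - \<bar>t\<bar>^3 / 4 * (\<bar>y \<bullet> \<omega>\<bar>^3 * (F \<omega>)\<^sup>2))"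
      unfolding sphere_inner_def A_def using i by simp
    also have "\<dots> \<le> (LINT \<omega>|sphere_measure. F \<omega> * (F \<omega> - Re (G t \<omega>)))"
    proof (rule integral_mono)
      fix \<omega>
      let ?z = "t * (y \<bullet> \<omega>)"
      have "F \<omega> * (F \<omega> - Re (G t \<omega>)) = (F \<omega>)\<^sup>2 * (1 - cos ?z)"
        by (simp add: G_def power2_eq_square algebra_simps)
      moreover have "(F \<omega>)\<^sup>2 * (?z\<^sup>2 / 2 - \<bar>?z\<bar> ^ 3 / 4) \<le> (F \<omega>)\<^sup>2 * (1 - cos ?z)"
        by (intro mult_left_mono one_minus_cos_ge) auto
      moreover have "t\<^sup>2 / 2 * (?k \<omega> * ?k \<omega>) - \<bar>t\<bar>^3 / 4 * (\<bar>y \<bullet> \<omega>\<bar>^3 * (F \<omega>)\<^sup>2) = (F \<omega>)\<^sup>2 * (?z\<^sup>2 / 2 - \<bar>?z\<bar> ^ 3 / 4)"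
        by (simp add: power2_eq_square power3_eq_cube abs_mult algebra_simps)
      ultimately show "t\<^sup>2 / 2 * (?k \<omega> * ?k \<omega>) - \<bar>t\<bar>^3 / 4 * (\<bar>y \<bullet> \<omega>\<bar>^3 * (F \<omega>)\<^sup>2) \<le> F \<omega> * (F \<omega> - Re (G t \<omega>))"
        by linarith
    next
      show "integrable sphere_measure (\<lambda>\<omega>. F \<omega> * (F \<omega> - Re (G t \<omega>)))"
        by (intro integrable_continuous_on_sphere continuous_intros contF cG)
    qed (use i in auto)
    finally show ?thesis .
  qed
  let ?W = "weighted_energy (\<lambda>\<omega>. complex_of_real (?k \<omega>))"
  have var: "\<mu> * sphere_sq ?k \<le> (q + 1) * ?W + t * ((q + 1) * C + \<mu> * A / 2)" if t: "0 < t" "t \<le> 1" for t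
  proof -
    have "(\<lambda>x. x - t *\<^sub>R y) = (+) (- t *\<^sub>R y)" by (simp add: fun_eq_iff)
    then have shift: "distr lborel borel (\<lambda>x. x - t *\<^sub>R y) = lborel"
      by (simp only: lborel_distr_plus)
    have "\<mu> * ((t\<^sup>2 / 2 * sphere_sq ?k - \<bar>t\<bar>^3 / 4 * A) + (t\<^sup>2 / 2 * sphere_sq ?k - \<bar>t\<bar>^3 / 4 * A))
      \<le> \<mu> * ((LINT \<omega>|sphere_measure. F \<omega> * (F \<omega> - Re (G t \<omega>))) + (LINT \<omega>|sphere_measure. F \<omega> * (F \<omega> - Re (G (-t) \<omega>))))"
      using mu_pos lower[of t] lower[of "-t"] by (intro mult_left_mono add_mono) auto
    also have "\<mu> * ((LINT \<omega>|sphere_measure. F \<omega> * (F \<omega> - Re (G t \<omega>))) + (LINT \<omega>|sphere_measure. F \<omega> * (F \<omega> - Re (G (-t) \<omega>))))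
      \<le> (q + 1) / 2 * (weighted_energy (\<lambda>\<omega>. G t \<omega> - F \<omega>) + weighted_energy (\<lambda>\<omega>. G (-t) \<omega> - F \<omega>))"
      by (rule symmetric_variation[where \<tau> = "\<lambda>x. x + t *\<^sub>R y" and \<tau>' = "\<lambda>x. x + (- t) *\<^sub>R y"])
        (use shift in \<open>auto simp: eG cG\<close>)
    also have "\<dots> \<le> (q + 1) / 2 * ((t\<^sup>2 * ?W + \<bar>t\<bar>^3 * C) + (t\<^sup>2 * ?W + \<bar>t\<bar>^3 * C))"
      using upper[of t] upper[of "-t"] t q_ge_1 by (intro mult_left_mono add_mono) auto
    finally have "\<mu> * ((t\<^sup>2 / 2 * sphere_sq ?k - \<bar>t\<bar>^3 / 4 * A) + (t\<^sup>2 / 2 * sphere_sq ?k - \<bar>t\<bar>^3 / 4 * A))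
      \<le> (q + 1) / 2 * ((t\<^sup>2 * ?W + \<bar>t\<bar>^3 * C) + (t\<^sup>2 * ?W + \<bar>t\<bar>^3 * C))" .
    then have "t\<^sup>2 * (\<mu> * sphere_sq ?k) \<le> t\<^sup>2 * ((q + 1) * ?W + t * ((q + 1) * C + \<mu> * A / 2))"
      using t by (simp add: power3_eq_cube power2_eq_square algebra_simps add_divide_distrib)
    then show ?thesis using t by simp
  qed
  show ?thesis
  proof (rule tendsto_lowerbound)
    show "((\<lambda>t. (q + 1) * ?W + t * ((q + 1) * C + \<mu> * A / 2)) \<longlongrightarrow> (q + 1) * ?W) (at_right 0)"
      by (auto intro!: tendsto_eq_intros)
    show "\<forall>\<^sub>F t in at_right 0. \<mu> * sphere_sq ?k \<le> (q + 1) * ?W + t * ((q + 1) * C + \<mu> * A / 2)"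
      unfolding eventually_at_right_field using var by (intro exI[of _ 1]) auto
  qed simp
qed

end

section \<open>Small rotations that move a nonconstant function\<close>

definition reflection :: "'a::euclidean_space \<Rightarrow> 'a \<Rightarrow> 'a" where
  "reflection v x = x - (2 * (v \<bullet> x)) *\<^sub>R v"

lemma orthogonal_transformation_reflection:
  assumes "norm v = 1"
  shows "orthogonal_transformation (reflection v)"
  unfolding orthogonal_transformation_def
proof
  show "linear (reflection v)"
    by (rule linearI) (auto simp: reflection_def inner_add_right algebra_simps)
  have v: "v \<bullet> v = 1" using assms by (simp add: norm_eq_1)
  show "\<forall>x y. reflection v x \<bullet> reflection v y = x \<bullet> y"
  proof (intro allI)
    fix x y
    show "reflection v x \<bullet> reflection v y = x \<bullet> y"
      by (simp add: reflection_def inner_diff_left inner_diff_right v inner_commute[of x v])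
  qed
qed

lemma reflection_reflection:
  assumes "norm v = 1"
  shows "reflection v (reflection v x) = x"
proof -
  have "v \<bullet> v = 1" using assms by (simp add: norm_eq_1)
  then show ?thesis by (simp add: reflection_def inner_diff_right algebra_simps)
qed

lemma norm_reflection: "norm v = 1 \<Longrightarrow> norm (reflection v x) = norm x"
  by (rule orthogonal_transformation_norm[OF orthogonal_transformation_reflection])

lemma norm_reflection_diff_le:
  assumes "norm v = 1" "norm w = 1"
  shows "norm (reflection v x - reflection w x) \<le> 4 * norm (v - w) * norm x"
proof -
  have "reflection v x - reflection w x = 2 *\<^sub>R ((w \<bullet> x) *\<^sub>R (w - v) + ((w - v) \<bullet> x) *\<^sub>R v)"
    by (simp add: reflection_def inner_diff_left algebra_simps)
  also have "norm \<dots> \<le> 2 * (\<bar>w \<bullet> x\<bar> * norm (w - v) + \<bar>(w - v) \<bullet> x\<bar> * norm v)"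
    by (simp only: norm_scaleR) (intro mult_mono order_trans[OF norm_triangle_ineq] add_mono; simp)
  also have "\<dots> \<le> 2 * ((norm w * norm x) * norm (w - v) + (norm (w - v) * norm x) * norm v)"
    by (intro mult_left_mono add_mono mult_right_mono Cauchy_Schwarz_ineq2) auto
  finally show ?thesis using assms by (simp add: norm_minus_commute mult_ac)
qed

lemma reflection_swap:
  assumes "norm x = norm y" "x \<noteq> y"
  shows "reflection ((x - y) /\<^sub>R norm (x - y)) x = y"
proof -
  have n: "norm (x - y) \<noteq> 0" using assms by simp
  have "x \<bullet> x = y \<bullet> y" using assms(1) by (simp add: norm_eq)
  then have "2 * ((x - y) \<bullet> x) = (x - y) \<bullet> (x - y)"
    by (simp add: inner_diff_left inner_diff_right inner_commute)
  then have e: "2 * ((x - y) \<bullet> x) = norm (x - y) * norm (x - y)"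
    by (simp add: dot_square_norm power2_eq_square)
  have "reflection ((x - y) /\<^sub>R norm (x - y)) x = x - ((2 * ((x - y) \<bullet> x)) / (norm (x - y) * norm (x - y))) *\<^sub>R (x - y)"
    by (simp add: reflection_def divide_inverse mult_ac)
  also have "\<dots> = y" unfolding e using n by simp
  finally show ?thesis .
qed

text \<open>
  Otherwise \<open>v \<mapsto> F (reflection v x)\<close> is locally constant, hence constant, on the connected sphere.
  But \<open>reflection v x\<close> takes every value of the same norm as \<open>x\<close>, so \<open>F\<close> would be constant.
\<close>

lemma nonconstant_reflection_pair:
  fixes F :: "'a::euclidean_space \<Rightarrow> real"
  assumes dim: "DIM('a) \<ge> 2" and nc: "\<not> F constant_on sphere 0 1" and d: "\<delta> > 0"
  obtains v w x where "norm v = 1" "norm w = 1" "norm (v - w) < \<delta>" "norm x = 1"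
    "F (reflection v (reflection w x)) \<noteq> F x"
proof (rule ccontr)
  note goal = that
  assume neg: "\<not> thesis"
  have inv: "F (reflection v (reflection w x)) = F x"
    if "norm v = 1" "norm w = 1" "norm (v - w) < \<delta>" "norm x = 1" for v w x
    using that neg goal by blast
  have "F y = F x" if x: "norm x = 1" and y: "norm y = 1" for x y
  proof (cases "x = y")
    case False
    have "(\<lambda>v. F (reflection v x)) constant_on sphere 0 1"
    proof (rule locally_constant_imp_constant)
      show "connected (sphere (0::'a) 1)" using dim by (rule connected_sphere)
      fix w :: 'a assume w: "w \<in> sphere 0 1"
      show "\<exists>T. openin (top_of_set (sphere 0 1)) T \<and> w \<in> T \<and> (\<forall>v\<in>T. F (reflection v x) = F (reflection w x))"
      proof (intro exI conjI ballI)
        show "openin (top_of_set (sphere 0 1)) (sphere 0 1 \<inter> ball w \<delta>)"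
          by (rule openin_open_Int) simp
        show "w \<in> sphere 0 1 \<inter> ball w \<delta>" using w d by simp
        fix v assume "v \<in> sphere 0 1 \<inter> ball w \<delta>"
        then have v: "norm v = 1" "norm (v - w) < \<delta>" by (auto simp: dist_norm norm_minus_commute)
        have w1: "norm w = 1" using w by simp
        show "F (reflection v x) = F (reflection w x)"
          using inv[OF v(1) w1 v(2), of "reflection w x"] x
          by (simp add: reflection_reflection[OF w1] norm_reflection[OF w1])
      qed
    qed
    then obtain c where c: "\<And>v. norm v = 1 \<Longrightarrow> F (reflection v x) = c" by (auto simp: constant_on_def)
    obtain z where z: "z \<noteq> 0" "orthogonal x z" using orthogonal_to_vector_exists[OF dim] by blast
    have "reflection (z /\<^sub>R norm z) x = x"
      using z by (simp add: reflection_def orthogonal_def inner_commute)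
    then have "F x = c" using c[of "z /\<^sub>R norm z"] z by simp
    moreover have "F y = c"
      using c[of "(x - y) /\<^sub>R norm (x - y)"] reflection_swap[of x y] x y False by simp
    ultimately show ?thesis by simp
  qed simp
  then have "F constant_on sphere 0 1" unfolding constant_on_def by (metis mem_sphere_0)
  with nc show False by blast
qed

text \<open>
  A product of two reflections in nearby hyperplanes is close to the identity, and \<open>F\<close> is
  uniformly continuous.
\<close>

lemma nonconstant_small_rotation:
  fixes F :: "'a::euclidean_space \<Rightarrow> real"
  assumes dim: "DIM('a) \<ge> 2" and cont: "continuous_on (sphere 0 1) F"
    and nc: "\<not> F constant_on sphere 0 1" and e: "\<epsilon> > 0"
  obtains R R' where "orthogonal_transformation R" "orthogonal_transformation R'"
    "\<And>x. R (R' x) = x" "\<And>x. R' (R x) = x"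
    "\<And>x. norm x = 1 \<Longrightarrow> \<bar>F (R x) - F x\<bar> < \<epsilon>" "\<exists>x. norm x = 1 \<and> F (R x) \<noteq> F x"
proof -
  have "uniformly_continuous_on (sphere 0 1) F"
    by (rule compact_uniformly_continuous[OF cont compact_sphere])
  then obtain \<eta> where \<eta>: "\<eta> > 0" "\<And>x y. norm x = 1 \<Longrightarrow> norm y = 1 \<Longrightarrow> norm (x - y) < \<eta> \<Longrightarrow> \<bar>F x - F y\<bar> < \<epsilon>"
    using e unfolding uniformly_continuous_on_def dist_norm by (metis mem_sphere_0 real_norm_def)
  have "\<eta> / 4 > 0" using \<eta> by simp
  from nonconstant_reflection_pair[OF dim nc this] obtain v w x where
    vw: "norm v = 1" "norm w = 1" "norm (v - w) < \<eta> / 4" and x: "norm x = 1" "F (reflection v (reflection w x)) \<noteq> F x"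
    by blast
  show ?thesis
  proof (rule that[of "reflection v \<circ> reflection w" "reflection w \<circ> reflection v"])
    show "orthogonal_transformation (reflection v \<circ> reflection w)" "orthogonal_transformation (reflection w \<circ> reflection v)"
      using vw by (auto intro: orthogonal_transformation_compose orthogonal_transformation_reflection)
    show "\<exists>x. norm x = 1 \<and> F ((reflection v \<circ> reflection w) x) \<noteq> F x" using x by auto
    fix z :: 'a assume z: "norm z = 1"
    have "norm (reflection v (reflection w z) - z) = norm (reflection v (reflection w z) - reflection w (reflection w z))"
      using vw by (simp add: reflection_reflection)
    also have "\<dots> \<le> 4 * norm (v - w) * norm (reflection w z)" by (rule norm_reflection_diff_le) (use vw in auto)
    also have "\<dots> < \<eta>" using vw z by (simp add: norm_reflection)
    finally show "\<bar>F ((reflection v \<circ> reflection w) z) - F z\<bar> < \<epsilon>"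
      using \<eta>(2) vw z by (simp add: norm_reflection)
  qed (use vw in \<open>auto simp: reflection_reflection\<close>)
qed

section \<open>The trace bound for nonconstant critical points\<close>

lemma sphere_inner_odd:
  fixes a b :: "real^'d \<Rightarrow> real"
  assumes "continuous_on (sphere 0 1) a" "continuous_on (sphere 0 1) b"
    and "\<And>\<omega>. norm \<omega> = 1 \<Longrightarrow> a (- \<omega>) * b (- \<omega>) = - (a \<omega> * b \<omega>)"
  shows "sphere_inner a b = 0"
proof -
  have R: "orthogonal_transformation (uminus :: real^'d \<Rightarrow> _)" by (simp add: orthogonal_transformation_def linear_uminus)
  have "sphere_inner a b = (LINT \<omega>|sphere_measure. a (- \<omega>) * b (- \<omega>))"
    using sphere_inner_orthogonal[OF R assms(1,2)] by (simp add: sphere_inner_def)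
  also have "\<dots> = (LINT \<omega>|sphere_measure. - (a \<omega> * b \<omega>))"
    by (rule Bochner_Integration.integral_cong) (use assms(3) in \<open>auto simp: space_sphere_measure\<close>)
  finally show ?thesis by (simp add: sphere_inner_def)
qed

lemma real_extension_uminus:
  fixes G :: "real^'d \<Rightarrow> real"
  assumes "continuous_on (sphere 0 1) G"
  shows "real_extension G (- x) = cnj (real_extension G x)"
  unfolding real_extension_eq[OF assms] by (simp add: sphere_inner_def complex_eq_iff)

lemma real_extension_antipodal:
  fixes G :: "real^'d \<Rightarrow> real"
  assumes G: "continuous_on (sphere 0 1) G" and e: "\<And>\<omega>. norm \<omega> = 1 \<Longrightarrow> G (- \<omega>) = c * G \<omega>"
  shows "cnj (real_extension G x) = c * real_extension G x"
proof -
  have R: "orthogonal_transformation (uminus :: real^'d \<Rightarrow> _)" by (simp add: orthogonal_transformation_def linear_uminus)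
  have "cnj (real_extension G x) = real_extension G (- x)" by (rule real_extension_uminus[OF G, symmetric])
  also have "\<dots> = extension (\<lambda>\<omega>. complex_of_real (G (- \<omega>))) x"
    by (rule extension_orthogonal[OF _ R, symmetric]) (intro continuous_intros G)
  also have "\<dots> = extension (\<lambda>\<omega>. c * complex_of_real (G \<omega>)) x"
    by (rule extension_cong) (use e in simp)
  finally show ?thesis by (simp add: extension_cmult)
qed

context critical_point
begin

abbreviation trace_bound :: real where
  "trace_bound \<equiv> sphere_mass TYPE('d) * (LINT x|lborel. norm (u x) powr q)"

lemma sq_F_pos: "sphere_sq F > 0"
  using F_nonzero sphere_sq_pos[OF contF] by blast

lemma continuous_on_sphere_neg:
  fixes G :: "real^'d \<Rightarrow> real"
  assumes "continuous_on (sphere 0 1) G" shows "continuous_on (sphere 0 1) (\<lambda>\<omega>. G (- \<omega>))"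
  by (rule continuous_on_compose2[OF assms]) (auto intro!: continuous_intros)

text \<open>
  For real \<open>G\<close>, the extension is real if \<open>G\<close> is even and purely imaginary if \<open>G\<close> is odd.  Testing the
  Euler--Lagrange equation with the even or odd part \<open>G c\<close> of \<open>F\<close>, for \<open>c = 1\<close> or \<open>c = -1\<close>, therefore
  leaves only the square of \<open>E (G c)\<close>, so each part that does not vanish contributes \<open>\<mu>\<close> to the trace.
\<close>

lemma parity_dichotomy:
  assumes "trace_bound < 2 * \<mu>"
  obtains c :: real where "c\<^sup>2 = 1" "\<And>\<omega>. norm \<omega> = 1 \<Longrightarrow> F (- \<omega>) = c * F \<omega>"
proof -
  define G where "G = (\<lambda>c \<omega>. (F \<omega> + c * F (- \<omega>)) / 2)"
  have cG: "continuous_on (sphere 0 1) (G c)" for c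
    unfolding G_def by (intro continuous_intros contF continuous_on_sphere_neg) auto
  have cG': "continuous_on (sphere 0 1) (\<lambda>\<omega>. complex_of_real (G c \<omega>))" for c
    by (intro continuous_intros cG)
  have par: "G c (- \<omega>) = c * G c \<omega>" if "c\<^sup>2 = 1" for c \<omega>
    using that by (simp add: G_def power2_eq_square algebra_simps)
  have dec: "F \<omega> = G 1 \<omega> + G (-1) \<omega>" for \<omega> by (simp add: G_def field_simps)
  have orth: "sphere_inner (G 1) (G (-1)) = 0"
    by (rule sphere_inner_odd[OF cG cG]) (simp add: par)
  have ext: "u x = real_extension (G 1) x + real_extension (G (-1)) x" for x
    using extension_add[OF cG' cG', of 1 "-1" x] by (simp add: dec)
  have energy: "weighted_energy (\<lambda>\<omega>. G c \<omega>) = \<mu> * sphere_sq (G c)" if c: "c = 1 \<or> c = -1" for c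
  proof -
    have "Re (cnj (u x) * real_extension (G c) x) = (norm (real_extension (G c) x))\<^sup>2" for x
    proof -
      have "cnj (real_extension (G 1) x) = real_extension (G 1) x"
        "cnj (real_extension (G (-1)) x) = - real_extension (G (-1)) x"
        using real_extension_antipodal[OF cG, of 1 1 x] real_extension_antipodal[OF cG, of "-1" "-1" x]
        by (simp_all add: par)
      then have "Im (real_extension (G 1) x) = 0" "Re (real_extension (G (-1)) x) = 0"
        by (simp_all add: complex_eq_iff)
      then show ?thesis using c unfolding ext cmod_power2 by (auto simp: power2_eq_square)
    qed
    then have "weighted_energy (\<lambda>\<omega>. G c \<omega>) = \<mu> * sphere_inner F (G c)"
      using euler_lagrange[OF cG', of c] by (simp add: weighted_energy_def sphere_inner_def)
    also have "sphere_inner F (G c) = sphere_inner (G 1) (G c) + sphere_inner (G (-1)) (G c)"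
      using sphere_inner_add(1)[OF cG cG cG] dec by (metis (no_types, lifting) sphere_inner_cong)
    also have "\<dots> = sphere_sq (G c)"
      using c orth sphere_inner_commute[of "G 1" "G (-1)"] by auto
    finally show ?thesis .
  qed
  have "\<exists>c\<in>{1,-1}. \<forall>\<omega>. norm \<omega> = 1 \<longrightarrow> G c \<omega> = 0"
  proof (rule ccontr)
    assume "\<not> ?thesis"
    then have pos: "sphere_sq (G c) > 0" if "c \<in> {1,-1}" for c
      using that sphere_sq_pos[OF cG] by blast
    have "(\<Sum>c\<in>{1,-1}. weighted_energy (\<lambda>\<omega>. G c \<omega>) / sphere_sq (G c)) \<le> trace_bound"
      by (rule bessel_energy) (use cG pos orth sphere_inner_commute[of "G 1" "G (-1)"] in auto)
    moreover have "weighted_energy (\<lambda>\<omega>. G c \<omega>) / sphere_sq (G c) = \<mu>" if "c \<in> {1,-1}" for c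
      using energy[of c] pos[OF that] that by simp
    ultimately show False using assms by simp
  qed
  then consider "\<And>\<omega>. norm \<omega> = 1 \<Longrightarrow> G 1 \<omega> = 0" | "\<And>\<omega>. norm \<omega> = 1 \<Longrightarrow> G (-1) \<omega> = 0" by auto
  then show ?thesis
  proof cases
    case 1
    have "F (- \<omega>) = (- 1) * F \<omega>" if "norm \<omega> = 1" for \<omega> using minus_unique[of "F \<omega>" "F (- \<omega>)"] 1[OF that] by (simp add: G_def)
    then show ?thesis by (intro that[of "-1"]) auto
  next
    case 2
    have "F (- \<omega>) = 1 * F \<omega>" if "norm \<omega> = 1" for \<omega> using 2[OF that] by (simp add: G_def)
    then show ?thesis using that[OF power_one] by blast
  qed
qed

lemma cont_linear_F: "continuous_on (sphere 0 1) (\<lambda>\<omega>. (y \<bullet> \<omega>) * F \<omega>)"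
  by (intro continuous_intros contF)

text \<open>
  If \<open>F w \<noteq> 0\<close> and \<open>y \<bullet> w = 0\<close>, then moving \<open>w\<close> slightly along the sphere in the direction \<open>y\<close>
  leaves the hyperplane orthogonal to \<open>y\<close> while \<open>F\<close> stays nonzero.
\<close>

lemma linear_F_sq_pos:
  assumes y: "y \<noteq> 0"
  shows "sphere_sq (\<lambda>\<omega>. (y \<bullet> \<omega>) * F \<omega>) > 0"
proof -
  obtain w where w: "norm w = 1" "F w \<noteq> 0" using F_nonzero by blast
  have "\<exists>\<omega>. norm \<omega> = 1 \<and> (y \<bullet> \<omega>) * F \<omega> \<noteq> 0"
  proof (cases "y \<bullet> w = 0")
    case False
    then show ?thesis using w by auto
  next
    case True
    have nz: "w + s *\<^sub>R y \<noteq> 0" for s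
    proof
      assume "w + s *\<^sub>R y = 0"
      then have "w \<bullet> (w + s *\<^sub>R y) = 0" by simp
      then have "w \<bullet> w = 0" using True by (simp add: inner_add_right inner_commute)
      then show False using w by simp
    qed
    let ?g = "\<lambda>s. (w + s *\<^sub>R y) /\<^sub>R norm (w + s *\<^sub>R y)"
    have "isCont ?g 0" using nz[of 0] by (intro continuous_intros) auto
    then have "(?g \<longlongrightarrow> w) (at_right 0)" using w by (simp add: isCont_def filterlim_at_split)
    then have "((\<lambda>s. F (?g s)) \<longlongrightarrow> F w) (at_right 0)"
      by (rule continuous_on_tendsto_compose[OF contF]) (use w nz in \<open>auto\<close>)
    then have "\<forall>\<^sub>F s in at_right 0. F (?g s) \<noteq> 0"
      by (rule tendsto_imp_eventually_ne) (use w in auto)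
    then have ev: "\<forall>\<^sub>F s in at_right 0. F (?g s) \<noteq> 0 \<and> s > (0::real)"
      using eventually_at_right_less[of "0::real"] by eventually_elim auto
    obtain s where s: "F (?g s) \<noteq> 0" "s > 0"
      using eventually_happens'[OF _ ev] trivial_limit_at_right_real by blast
    have "y \<bullet> ?g s = s * (y \<bullet> y) / norm (w + s *\<^sub>R y)"
      using True by (simp add: inner_add_right divide_inverse mult_ac)
    then have "y \<bullet> ?g s \<noteq> 0" using s y nz by simp
    moreover have "norm (?g s) = 1" using nz by simp
    ultimately show ?thesis using s by (intro exI[of _ "?g s"]) simp
  qed
  then show ?thesis using sphere_sq_pos[OF cont_linear_F] by blast
qed

text \<open>
  Gram--Schmidt for the positive definite form \<open>(y, z) \<mapsto> \<integral> (y \<bullet> \<omega>) (z \<bullet> \<omega>) F\<^sup>2\<close>.  It is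
  represented as \<open>z \<bullet> A y\<close>, and the next vector is taken orthogonal, in the Euclidean sense, to the
  span of the vectors \<open>A (b i)\<close> found so far.
\<close>

lemma orthogonal_linear_F:
  "k \<le> CARD('d) \<Longrightarrow> \<exists>b :: nat \<Rightarrow> real^'d. (\<forall>i<k. b i \<noteq> 0) \<and>
     (\<forall>i<k. \<forall>j<k. i \<noteq> j \<longrightarrow> sphere_inner (\<lambda>\<omega>. (b i \<bullet> \<omega>) * F \<omega>) (\<lambda>\<omega>. (b j \<bullet> \<omega>) * F \<omega>) = 0)"
proof (induction k)
  case (Suc k)
  then obtain b where b: "\<forall>i<k. b i \<noteq> 0"
    "\<forall>i<k. \<forall>j<k. i \<noteq> j \<longrightarrow> sphere_inner (\<lambda>\<omega>. (b i \<bullet> \<omega>) * F \<omega>) (\<lambda>\<omega>. (b j \<bullet> \<omega>) * F \<omega>) = 0"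
    by auto
  define A where "A = (\<lambda>y. LINT \<omega>|sphere_measure. ((y \<bullet> \<omega>) * (F \<omega>)\<^sup>2) *\<^sub>R \<omega>)"
  have form: "sphere_inner (\<lambda>\<omega>. (y \<bullet> \<omega>) * F \<omega>) (\<lambda>\<omega>. (z \<bullet> \<omega>) * F \<omega>) = z \<bullet> A y" for y z :: "real^'d"
  proof -
    have "integrable sphere_measure (\<lambda>\<omega>. ((y \<bullet> \<omega>) * (F \<omega>)\<^sup>2) *\<^sub>R \<omega>)"
      by (intro integrable_continuous_on_sphere continuous_intros contF)
    then have "z \<bullet> A y = (LINT \<omega>|sphere_measure. z \<bullet> (((y \<bullet> \<omega>) * (F \<omega>)\<^sup>2) *\<^sub>R \<omega>))"
      unfolding A_def by (simp only: integral_inner_right)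
    then show ?thesis by (simp add: sphere_inner_def power2_eq_square mult_ac)
  qed
  have "dim ((\<lambda>i. A (b i)) ` {..<k}) \<le> card ((\<lambda>i. A (b i)) ` {..<k})" by (rule dim_le_card') simp
  also have "\<dots> \<le> k" using card_image_le[of "{..<k}" "\<lambda>i. A (b i)"] by simp
  also have "k < DIM(real^'d)" using Suc.prems by simp
  finally obtain z where z: "z \<noteq> 0" "\<And>y. y \<in> span ((\<lambda>i. A (b i)) ` {..<k}) \<Longrightarrow> orthogonal z y"
    using orthogonal_to_subspace_exists by blast
  have zo: "sphere_inner (\<lambda>\<omega>. (b i \<bullet> \<omega>) * F \<omega>) (\<lambda>\<omega>. (z \<bullet> \<omega>) * F \<omega>) = 0" if "i < k" for i
    unfolding form using z(2)[of "A (b i)"] that by (auto simp: orthogonal_def intro: span_base)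
  show ?case
  proof (intro exI[of _ "b(k := z)"] conjI allI impI)
    fix i assume "i < Suc k" then show "(b(k := z)) i \<noteq> 0" using z b by (auto simp: less_Suc_eq)
  next
    fix i j assume ij: "i < Suc k" "j < Suc k" "i \<noteq> j"
    then consider "i < k" "j < k" | "i = k" "j < k" | "i < k" "j = k" by linarith
    then show "sphere_inner (\<lambda>\<omega>. ((b(k := z)) i \<bullet> \<omega>) * F \<omega>) (\<lambda>\<omega>. ((b(k := z)) j \<bullet> \<omega>) * F \<omega>) = 0"
    proof cases
      case 1 then show ?thesis using b ij by simp
    next
      case 2 then show ?thesis using zo[of j] ij by (subst sphere_inner_commute) simp
    next
      case 3 then show ?thesis using zo[of i] by simp
    qed
  qed
qed simp

text \<open>
  The orthogonal system consists of \<open>F\<close>, of one direction \<open>k\<close> with the parity of \<open>F\<close>, and of the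
  functions \<open>(b i \<bullet> \<omega>) F \<omega>\<close>, which have the opposite parity.
\<close>

lemma bessel_three_blocks:
  assumes par: "\<And>\<omega>. norm \<omega> = 1 \<Longrightarrow> F (- \<omega>) = c * F \<omega>" and c: "c\<^sup>2 = 1"
    and k: "continuous_on (sphere 0 1) k" and kpar: "\<And>\<omega>. norm \<omega> = 1 \<Longrightarrow> k (- \<omega>) = c * k \<omega>"
    and kF: "sphere_inner F k = 0" and kpos: "sphere_sq k > 0"
  shows "\<mu> + weighted_energy (\<lambda>\<omega>. k \<omega>) / sphere_sq k + real CARD('d) * (\<mu> / (q + 1)) \<le> trace_bound"
proof -
  from orthogonal_linear_F[of "CARD('d)"] obtain b :: "nat \<Rightarrow> real^'d" where b: "\<And>i. i < CARD('d) \<Longrightarrow> b i \<noteq> 0"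
    "\<And>i j. i < CARD('d) \<Longrightarrow> j < CARD('d) \<Longrightarrow> i \<noteq> j \<Longrightarrow> sphere_inner (\<lambda>\<omega>. (b i \<bullet> \<omega>) * F \<omega>) (\<lambda>\<omega>. (b j \<bullet> \<omega>) * F \<omega>) = 0"
    by auto
  let ?l = "\<lambda>i \<omega>. (b i \<bullet> \<omega>) * F \<omega>"
  define \<phi> where "\<phi> = (\<lambda>i. if i = 0 then F else if i = 1 then k else ?l (i - 2))"
  have cc: "c * c = 1" using c by (simp add: power2_eq_square)
  have o1: "sphere_inner F (?l i) = 0" for i
    by (rule sphere_inner_odd[OF contF cont_linear_F]) (simp add: par, use cc in algebra)
  have o2: "sphere_inner k (?l i) = 0" for i
    by (rule sphere_inner_odd[OF k cont_linear_F]) (simp add: par kpar, use cc in algebra)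
  have o1': "sphere_inner (?l i) F = 0" and o2': "sphere_inner (?l i) k = 0" and kF': "sphere_inner k F = 0" for i
    by (subst sphere_inner_commute, rule o1, subst sphere_inner_commute, rule o2, subst sphere_inner_commute, rule kF)
  have "(\<Sum>i<Suc (Suc CARD('d)). weighted_energy (\<lambda>\<omega>. \<phi> i \<omega>) / sphere_sq (\<phi> i)) \<le> trace_bound"
  proof (rule bessel_energy)
    fix i assume i: "i \<in> {..<Suc (Suc CARD('d))}"
    show "continuous_on (sphere 0 1) (\<phi> i)" using contF k cont_linear_F by (simp add: \<phi>_def)
    have "sphere_sq (?l (i - 2)) > 0" if "i \<ge> 2"
    proof -
      have "i - 2 < CARD('d)" using that i by auto
      then show ?thesis by (intro linear_F_sq_pos b)
    qed
    then show "sphere_sq (\<phi> i) > 0" using sq_F_pos kpos by (simp add: \<phi>_def)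
    fix j assume j: "j \<in> {..<Suc (Suc CARD('d))}" "i \<noteq> j"
    have "sphere_inner (?l (i - 2)) (?l (j - 2)) = 0" if "i \<ge> 2" "j \<ge> 2"
      using that i j by (intro b) auto
    then show "sphere_inner (\<phi> i) (\<phi> j) = 0"
      using o1 o2 kF o1' o2' kF' j by (simp add: \<phi>_def)
  qed simp
  moreover have "(\<Sum>i<Suc (Suc CARD('d)). weighted_energy (\<lambda>\<omega>. \<phi> i \<omega>) / sphere_sq (\<phi> i))
    = weighted_energy (\<lambda>\<omega>. F \<omega>) / sphere_sq F + (weighted_energy (\<lambda>\<omega>. k \<omega>) / sphere_sq k
       + (\<Sum>i<CARD('d). weighted_energy (\<lambda>\<omega>. ?l i \<omega>) / sphere_sq (?l i)))"
    by (simp add: sum.lessThan_Suc_shift \<phi>_def del: sum.lessThan_Suc of_real_mult)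
  moreover have "weighted_energy (\<lambda>\<omega>. F \<omega>) / sphere_sq F = \<mu>"
    using weighted_energy_F sq_F_pos by simp
  moreover have "(\<Sum>i<CARD('d). \<mu> / (q + 1)) \<le> (\<Sum>i<CARD('d). weighted_energy (\<lambda>\<omega>. ?l i \<omega>) / sphere_sq (?l i))"
  proof (rule sum_mono)
    fix i assume "i \<in> {..<CARD('d)}"
    then have "sphere_sq (?l i) > 0" by (intro linear_F_sq_pos b) simp
    then show "\<mu> / (q + 1) \<le> weighted_energy (\<lambda>\<omega>. ?l i \<omega>) / sphere_sq (?l i)"
      using modulation_energy[of "b i"] q_ge_1 by (simp add: field_simps del: of_real_mult)
  qed
  ultimately show ?thesis by simp
qed

text \<open>
  The cross term vanishes by the Euler--Lagrange equation, since \<open>F\<close> is an eigenfunction and \<open>k\<close> is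
  orthogonal to it.
\<close>

lemma weighted_energy_shift:
  fixes k :: "real^'d \<Rightarrow> real" and c :: real
  assumes k: "continuous_on (sphere 0 1) k" and kF: "sphere_inner F k = 0"
  shows "weighted_energy (\<lambda>\<omega>. complex_of_real (k \<omega> + c * F \<omega>)) = weighted_energy (\<lambda>\<omega>. k \<omega>) + c\<^sup>2 * (\<mu> * sphere_sq F)"
proof -
  have ck: "continuous_on (sphere 0 1) (\<lambda>\<omega>. complex_of_real (k \<omega>))" by (intro continuous_intros k)
  have cF: "continuous_on (sphere 0 1) (\<lambda>\<omega>. c * complex_of_real (F \<omega>))" by (intro continuous_intros contF)
  let ?k = "real_extension k"
  have ext: "extension (\<lambda>\<omega>. complex_of_real (k \<omega> + c * F \<omega>)) x = ?k x + c * u x" for x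
    using extension_add[OF ck cF] by (simp add: extension_cmult)
  have "(norm (?k x + c * u x))\<^sup>2 = (norm (?k x))\<^sup>2 + 2 * c * Re (cnj (u x) * ?k x) + c\<^sup>2 * (norm (u x))\<^sup>2" for x
    unfolding cmod_power2 by (simp add: power2_eq_square algebra_simps)
  then have eq: "norm (u x) powr q * (norm (extension (\<lambda>\<omega>. complex_of_real (k \<omega> + c * F \<omega>)) x))\<^sup>2 =
     norm (u x) powr q * (norm (?k x))\<^sup>2 + (2 * c) * (norm (u x) powr q * Re (cnj (u x) * ?k x)) + c\<^sup>2 * (norm (u x) powr q * (norm (u x))\<^sup>2)" for x
    unfolding ext by (simp add: algebra_simps)
  have "weighted_energy (\<lambda>\<omega>. complex_of_real (k \<omega> + c * F \<omega>)) =
     weighted_energy (\<lambda>\<omega>. k \<omega>) + (2 * c) * (\<mu> * sphere_inner F k) + c\<^sup>2 * weighted_energy (\<lambda>\<omega>. F \<omega>)"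
    unfolding weighted_energy_def eq
    using integrable_energy[OF ck] integrable_energy[OF cont_cF] integrable_cross[OF cont_cF ck] euler_lagrange[OF ck]
    by (simp add: sphere_inner_def)
  then show ?thesis using kF weighted_energy_F by simp
qed

text \<open>
  Let \<open>D = F \<circ> R - F\<close> for a small rotation \<open>R\<close> and \<open>\<epsilon> = \<langle>D, D\<rangle>\<close>.  Since \<open>F \<circ> R\<close> and \<open>F\<close> have equal
  norms, \<open>\<langle>F, D\<rangle> = - \<epsilon> / 2\<close>, so \<open>D\<close> is orthogonal to \<open>F\<close> up to the component \<open>c F\<close> with
  \<open>c = - \<epsilon> / (2 N)\<close>, whose squared norm is of order \<open>\<epsilon>\<^sup>2\<close>.  Bessel's inequality bounds the energy of
  the remaining part \<open>D - c F\<close> from above, the symmetric variation bounds the sum of the energies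
  for \<open>R\<close> and its inverse from below, and \<open>\<epsilon>\<close> tends to \<open>0\<close> after division by \<open>\<epsilon>\<close>.
\<close>

theorem nonconstant_trace_bound:
  assumes dim: "CARD('d) \<ge> 2" and nc: "\<not> F constant_on sphere 0 1" and two: "trace_bound < 2 * \<mu>"
  shows "\<mu> * (1 + (real CARD('d) + 1) / (q + 1)) \<le> trace_bound"
proof -
  obtain p :: real where p: "p\<^sup>2 = 1" and par: "\<And>\<omega>. norm \<omega> = 1 \<Longrightarrow> F (- \<omega>) = p * F \<omega>"
    using parity_dichotomy[OF two] by blast
  define N where "N = sphere_sq F"
  have N: "N > 0" using sq_F_pos by (simp add: N_def)
  define X where "X = trace_bound - \<mu> - real CARD('d) * (\<mu> / (q + 1))"
  let ?m = "sphere_mass TYPE('d)"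
  have key: "\<exists>\<epsilon>. 0 < \<epsilon> \<and> \<epsilon> < \<eta> \<and> \<mu> \<le> (q + 1) * (X * (1 - \<epsilon> / (4 * N)) + \<mu> * (\<epsilon> / (4 * N)))"
    if eta: "\<eta> > 0" "\<eta> \<le> 2 * N" for \<eta>
  proof -
    \<comment> \<open>A pointwise bound \<open>\<delta>\<close> on \<open>F \<circ> R - F\<close> gives a squared norm of at most \<open>|\<sigma>| \<delta>\<^sup>2 < \<eta>\<close>.\<close>
    define \<delta> where "\<delta> = sqrt (\<eta> / (?m + 1))"
    have m0: "?m \<ge> 0" by simp
    have "\<delta> > 0" using eta(1) m0 by (simp add: \<delta>_def add_nonneg_pos)
    with dim contF nc obtain R R' where R: "orthogonal_transformation R" and R': "orthogonal_transformation R'"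
      and inv: "\<And>x. R (R' x) = x" "\<And>x. R' (R x) = x"
      and small: "\<And>x. norm x = 1 \<Longrightarrow> \<bar>F (R x) - F x\<bar> < \<delta>" and ne: "\<exists>x. norm x = 1 \<and> F (R x) \<noteq> F x"
      using nonconstant_small_rotation[of F \<delta>] by auto
    have cR: "continuous_on (sphere 0 1) (\<lambda>\<omega>. F (R \<omega>))" if "orthogonal_transformation R" for R :: "real^'d \<Rightarrow> real^'d"
    proof (rule continuous_on_compose2[OF contF])
      show "continuous_on (sphere 0 1) R"
        using that by (intro linear_continuous_on) (simp add: linear_conv_bounded_linear[symmetric] orthogonal_transformation_linear)
      show "R ` sphere 0 1 \<subseteq> sphere 0 1" using that by (auto simp: orthogonal_transformation_norm)
    qed
    define D where "D = (\<lambda>R \<omega>. F (R \<omega>) - F \<omega>)"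
    have cD: "continuous_on (sphere 0 1) (D R)" if "orthogonal_transformation R" for R :: "real^'d \<Rightarrow> real^'d"
      unfolding D_def by (intro continuous_intros cR that contF)
    have sqR: "sphere_sq (\<lambda>\<omega>. F (R \<omega>)) = N" if "orthogonal_transformation R" for R :: "real^'d \<Rightarrow> real^'d"
      unfolding N_def by (rule sphere_inner_orthogonal[OF that contF contF])
    have swap: "sphere_inner (\<lambda>\<omega>. F (R \<omega>)) F = sphere_inner (\<lambda>\<omega>. F (R' \<omega>)) F"
      using sphere_inner_orthogonal[OF R contF cR[OF R']] by (simp add: inv sphere_inner_commute)
    define \<epsilon> where "\<epsilon> = 2 * N - 2 * sphere_inner (\<lambda>\<omega>. F (R \<omega>)) F"
    have inner: "sphere_inner F (D Q) = - \<epsilon> / 2" and sqD: "sphere_sq (D Q) = \<epsilon>" if "Q = R \<or> Q = R'" for Q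
    proof -
      have Q: "orthogonal_transformation Q" using that R R' by auto
      have e: "2 * N - 2 * sphere_inner (\<lambda>\<omega>. F (Q \<omega>)) F = \<epsilon>" using that swap by (auto simp: \<epsilon>_def)
      have d: "sphere_inner F (D Q) = sphere_inner F (\<lambda>\<omega>. F (Q \<omega>)) - N"
        unfolding D_def N_def by (rule sphere_inner_diff(2)[OF cR[OF Q] contF contF])
      then show "sphere_inner F (D Q) = - \<epsilon> / 2" using e sphere_inner_commute[of F] by simp
      have "sphere_sq (D Q) = sphere_inner (\<lambda>\<omega>. F (Q \<omega>)) (D Q) - sphere_inner F (D Q)"
        by (subst D_def) (rule sphere_inner_diff(1)[OF cR[OF Q] contF cD[OF Q]])
      also have "sphere_inner (\<lambda>\<omega>. F (Q \<omega>)) (D Q) = N - sphere_inner (\<lambda>\<omega>. F (Q \<omega>)) F"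
        using sphere_inner_diff(2)[OF cR[OF Q] contF cR[OF Q]] sqR[OF Q] by (simp add: D_def)
      finally show "sphere_sq (D Q) = \<epsilon>" using d e sphere_inner_commute[of F] by simp
    qed
    have "\<epsilon> > 0"
    proof -
      obtain x where "norm x = 1" "D R x \<noteq> 0" using ne by (auto simp: D_def)
      then show ?thesis using sphere_sq_pos[OF cD[OF R]] sqD[of R] by simp
    qed
    have "\<epsilon> < \<eta>"
    proof -
      have "sphere_sq (D R) \<le> (LINT \<omega>|(sphere_measure :: (real^'d) measure). \<delta>\<^sup>2)"
        unfolding sphere_inner_def
      proof (rule integral_mono)
        show "integrable sphere_measure (\<lambda>\<omega>. D R \<omega> * D R \<omega>)"
          by (intro integrable_continuous_on_sphere continuous_intros cD R)
        fix \<omega> :: "real^'d" assume "\<omega> \<in> space sphere_measure"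
        then have "\<bar>D R \<omega>\<bar> \<le> \<delta>" using small[of \<omega>] by (simp add: D_def space_sphere_measure less_imp_le)
        then have "\<bar>D R \<omega>\<bar>\<^sup>2 \<le> \<delta>\<^sup>2" by (rule power_mono) simp
        then show "D R \<omega> * D R \<omega> \<le> \<delta>\<^sup>2" by (simp add: power2_eq_square)
      qed simp
      also have "\<dots> = ?m * (\<eta> / (?m + 1))" using eta m0 by (simp add: \<delta>_def)
      also have "\<dots> = \<eta> * (?m / (?m + 1))" by simp
      also have "\<dots> < \<eta> * 1"
      proof (rule mult_strict_left_mono)
        have "?m + 1 > 0" using m0 by linarith
        then show "?m / (?m + 1) < 1" by (simp add: pos_divide_less_eq)
      qed (use eta in simp)
      finally show ?thesis using sqD[of R] by simp
    qed
    define c where "c = - \<epsilon> / (2 * N)"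
    have c2: "c\<^sup>2 * N = \<epsilon> * (\<epsilon> / (4 * N))" using N by (simp add: c_def power2_eq_square)
    have lt: "c\<^sup>2 * N < \<epsilon>"
      unfolding c2 using \<open>\<epsilon> > 0\<close> \<open>\<epsilon> < \<eta>\<close> eta N by (simp add: field_simps)
    have bound: "weighted_energy (\<lambda>\<omega>. D Q \<omega>) \<le> X * (\<epsilon> - c\<^sup>2 * N) + c\<^sup>2 * (\<mu> * N)" if Q: "Q = R \<or> Q = R'" for Q
    proof -
      have oQ: "orthogonal_transformation Q" using that R R' by auto
      let ?k = "\<lambda>\<omega>. D Q \<omega> - c * F \<omega>"
      have cF: "continuous_on (sphere 0 1) (\<lambda>\<omega>. c * F \<omega>)" by (intro continuous_intros contF)
      have ck: "continuous_on (sphere 0 1) ?k" by (intro continuous_intros cD oQ contF)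
      have Fk: "sphere_inner F ?k = 0"
        unfolding sphere_inner_diff(2)[OF cD[OF oQ] cF contF] sphere_inner_cmult inner[OF Q]
        using N by (simp add: c_def flip: N_def)
      have "sphere_sq ?k = sphere_inner (D Q) ?k - c * sphere_inner F ?k"
        by (subst sphere_inner_diff(1)[OF cD[OF oQ] cF ck]) (simp add: sphere_inner_cmult)
      also have "\<dots> = \<epsilon> - c * (- \<epsilon> / 2)"
        unfolding Fk using inner[OF Q] sqD[OF Q] sphere_inner_commute[of F "D Q"]
        by (simp add: sphere_inner_diff(2)[OF cD[OF oQ] cF cD[OF oQ]] sphere_inner_cmult)
      also have "\<dots> = \<epsilon> - c\<^sup>2 * N" using N by (simp add: c_def power2_eq_square field_simps)
      finally have sqk: "sphere_sq ?k = \<epsilon> - c\<^sup>2 * N" .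
      have kpar: "?k (- \<omega>) = p * ?k \<omega>" if w: "norm \<omega> = 1" for \<omega>
      proof -
        have "F (Q (- \<omega>)) = p * F (Q \<omega>)"
          using par[of "Q \<omega>"] w oQ by (simp add: orthogonal_transformation_norm linear_neg orthogonal_transformation_linear)
        then show ?thesis using par[OF w] by (simp add: D_def algebra_simps)
      qed
      have "\<mu> + weighted_energy (\<lambda>\<omega>. ?k \<omega>) / sphere_sq ?k + real CARD('d) * (\<mu> / (q + 1)) \<le> trace_bound"
        by (rule bessel_three_blocks[OF par p ck kpar Fk]) (use sqk lt in auto)
      then have "weighted_energy (\<lambda>\<omega>. ?k \<omega>) / (\<epsilon> - c\<^sup>2 * N) \<le> X"
        unfolding sqk X_def by linarith
      then have "weighted_energy (\<lambda>\<omega>. ?k \<omega>) \<le> X * (\<epsilon> - c\<^sup>2 * N)"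
        using lt by (simp add: pos_divide_le_eq)
      moreover have "weighted_energy (\<lambda>\<omega>. D Q \<omega>) = weighted_energy (\<lambda>\<omega>. ?k \<omega>) + c\<^sup>2 * (\<mu> * N)"
        using weighted_energy_shift[OF ck Fk, of c] by (simp add: N_def)
      ultimately show ?thesis by simp
    qed
    have var: "\<mu> * ((LINT \<omega>|sphere_measure. F \<omega> * (F \<omega> - Re (complex_of_real (F (R \<omega>))))) + (LINT \<omega>|sphere_measure. F \<omega> * (F \<omega> - Re (complex_of_real (F (R' \<omega>))))))
      \<le> (q + 1) / 2 * (weighted_energy (\<lambda>\<omega>. complex_of_real (F (R \<omega>)) - F \<omega>) + weighted_energy (\<lambda>\<omega>. complex_of_real (F (R' \<omega>)) - F \<omega>))"
    proof (rule symmetric_variation[where \<tau> = R and \<tau>' = R'])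
      show "extension (\<lambda>\<omega>. complex_of_real (F (R \<omega>))) x = u (R x)" "extension (\<lambda>\<omega>. complex_of_real (F (R' \<omega>))) x = u (R' x)" for x
        by (rule extension_orthogonal[OF cont_cF R], rule extension_orthogonal[OF cont_cF R'])
      show "R' \<in> borel_measurable borel"
        using R' by (intro borel_measurable_continuous_onI linear_continuous_on)
          (simp add: linear_conv_bounded_linear[symmetric] orthogonal_transformation_linear)
    qed (auto intro!: continuous_intros cR R R' simp: inv lborel_distr_orthogonal[OF R'])
    have half: "(LINT \<omega>|sphere_measure. F \<omega> * (F \<omega> - Re (complex_of_real (F (Q \<omega>))))) = \<epsilon> / 2" if "Q = R \<or> Q = R'" for Q
    proof -
      have "(LINT \<omega>|sphere_measure. F \<omega> * (F \<omega> - Re (complex_of_real (F (Q \<omega>))))) = (LINT \<omega>|sphere_measure. - (F \<omega> * D Q \<omega>))"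
        by (rule Bochner_Integration.integral_cong) (auto simp: D_def algebra_simps)
      also have "\<dots> = - sphere_inner F (D Q)" by (simp add: sphere_inner_def)
      finally show ?thesis using inner[OF that] by simp
    qed
    have "\<mu> * (\<epsilon> / 2 + \<epsilon> / 2) \<le> (q + 1) / 2 * (weighted_energy (\<lambda>\<omega>. D R \<omega>) + weighted_energy (\<lambda>\<omega>. D R' \<omega>))"
      using var unfolding half[OF disjI1, OF refl] half[OF disjI2, OF refl] D_def of_real_diff .
    also have "\<dots> \<le> (q + 1) / 2 * ((X * (\<epsilon> - c\<^sup>2 * N) + c\<^sup>2 * (\<mu> * N)) + (X * (\<epsilon> - c\<^sup>2 * N) + c\<^sup>2 * (\<mu> * N)))"
      using q_ge_1 by (intro mult_left_mono add_mono bound) auto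
    also have "\<dots> = \<epsilon> * ((q + 1) * (X * (1 - \<epsilon> / (4 * N)) + \<mu> * (\<epsilon> / (4 * N))))"
    proof -
      have "c\<^sup>2 * (\<mu> * N) = \<mu> * (c\<^sup>2 * N)" by simp
      then show ?thesis unfolding c2 by (simp add: algebra_simps)
    qed
    finally have "\<epsilon> * \<mu> \<le> \<epsilon> * ((q + 1) * (X * (1 - \<epsilon> / (4 * N)) + \<mu> * (\<epsilon> / (4 * N))))" by (simp add: mult.commute)
    then show ?thesis using \<open>\<epsilon> > 0\<close> \<open>\<epsilon> < \<eta>\<close> by (intro exI[of _ \<epsilon>]) simp
  qed
  have "\<mu> \<le> (q + 1) * X"
  proof (rule ccontr)
    assume neg: "\<not> ?thesis"
    define K where "K = \<bar>(q + 1) * (\<mu> - X) / (4 * N)\<bar> + 1"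
    have K: "K > 0" unfolding K_def by (rule add_nonneg_pos) auto
    define \<eta> where "\<eta> = min (2 * N) ((\<mu> - (q + 1) * X) / K)"
    have "\<eta> > 0" using N neg K by (simp add: \<eta>_def)
    then obtain \<epsilon> where e: "0 < \<epsilon>" "\<epsilon> < \<eta>" "\<mu> \<le> (q + 1) * (X * (1 - \<epsilon> / (4 * N)) + \<mu> * (\<epsilon> / (4 * N)))"
      using key[of \<eta>] by (auto simp: \<eta>_def)
    have "(q + 1) * (X * (1 - \<epsilon> / (4 * N)) + \<mu> * (\<epsilon> / (4 * N))) = (q + 1) * X + \<epsilon> * ((q + 1) * (\<mu> - X) / (4 * N))"
      using N by (simp add: field_simps)
    then have "\<mu> - (q + 1) * X \<le> \<epsilon> * ((q + 1) * (\<mu> - X) / (4 * N))" using e by simp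
    also have "\<dots> \<le> \<epsilon> * K" using e abs_ge_self[of "(q + 1) * (\<mu> - X) / (4 * N)"]
      unfolding K_def by (intro mult_left_mono) linarith+
    also have "\<dots> < \<eta> * K" using e K by simp
    also have "\<dots> \<le> \<mu> - (q + 1) * X" using K by (simp add: \<eta>_def min_def field_simps)
    finally show False by simp
  qed
  then have "\<mu> / (q + 1) \<le> X" using q_ge_1 by (simp add: field_simps)
  then show ?thesis by (simp add: X_def field_simps add_divide_distrib)
qed

end

section \<open>The transform of the surface measure and its radial profile\<close>

definition sphere_average :: "(real^'d \<Rightarrow> real) \<Rightarrow> real" where
  "sphere_average f = (LINT \<omega>|sphere_measure. f \<omega>) / sphere_mass TYPE('d)"

lemma sphere_mass_pos: "sphere_mass TYPE('d::finite) > 0"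
proof -
  obtain w :: "real^'d" where "norm w = 1" using norm_axis_1 by blast
  from sphere_sq_pos[OF _ this, of "\<lambda>_. 1"] show ?thesis by (simp add: sphere_inner_def)
qed

lemma sphere_average_const: "sphere_average (\<lambda>_ :: real^'d. c) = c"
  using sphere_mass_pos[where 'd='d] by (simp add: sphere_average_def)

lemma sphere_average_cmult: "sphere_average (\<lambda>\<omega>. c * f \<omega>) = c * sphere_average f"
  by (simp add: sphere_average_def)

lemma sphere_average_add:
  fixes f g :: "real^'d \<Rightarrow> real"
  assumes "continuous_on (sphere 0 1) f" "continuous_on (sphere 0 1) g"
  shows "sphere_average (\<lambda>\<omega>. f \<omega> + g \<omega>) = sphere_average f + sphere_average g"
  using assms[THEN integrable_continuous_on_sphere] by (simp add: sphere_average_def add_divide_distrib)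

lemma sphere_average_diff:
  fixes f g :: "real^'d \<Rightarrow> real"
  assumes "continuous_on (sphere 0 1) f" "continuous_on (sphere 0 1) g"
  shows "sphere_average (\<lambda>\<omega>. f \<omega> - g \<omega>) = sphere_average f - sphere_average g"
  using assms[THEN integrable_continuous_on_sphere] by (simp add: sphere_average_def diff_divide_distrib)

lemma sphere_average_sum:
  fixes f :: "'i \<Rightarrow> real^'d \<Rightarrow> real"
  assumes "\<And>i. i \<in> I \<Longrightarrow> continuous_on (sphere 0 1) (f i)"
  shows "sphere_average (\<lambda>\<omega>. \<Sum>i\<in>I. f i \<omega>) = (\<Sum>i\<in>I. sphere_average (f i))"
  using assms[THEN integrable_continuous_on_sphere] by (simp add: sphere_average_def sum_divide_distrib)

lemma sphere_average_mono:
  fixes f g :: "real^'d \<Rightarrow> real"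
  assumes "continuous_on (sphere 0 1) f" "continuous_on (sphere 0 1) g" "\<And>\<omega>. norm \<omega> = 1 \<Longrightarrow> f \<omega> \<le> g \<omega>"
  shows "sphere_average f \<le> sphere_average g"
  unfolding sphere_average_def using assms(3)
  by (intro divide_right_mono integral_mono assms(1,2)[THEN integrable_continuous_on_sphere])
    (auto simp: space_sphere_measure)

lemma sphere_average_cong:
  fixes f g :: "real^'d \<Rightarrow> real"
  assumes "\<And>\<omega>. norm \<omega> = 1 \<Longrightarrow> f \<omega> = g \<omega>"
  shows "sphere_average f = sphere_average g"
  unfolding sphere_average_def
  by (intro arg_cong2[where f = "(/)"] Bochner_Integration.integral_cong refl)
    (use assms in \<open>auto simp: space_sphere_measure\<close>)

lemma sphere_average_orthogonal:
  fixes f :: "real^'d \<Rightarrow> real" and R :: "real^'d \<Rightarrow> real^'d"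
  assumes "orthogonal_transformation R" "continuous_on (sphere 0 1) f"
  shows "sphere_average (\<lambda>\<omega>. f (R \<omega>)) = sphere_average f"
  unfolding sphere_average_def
  using integral_sphere_orthogonal[OF assms(1) borel_measurable_continuous_on_sphere[OF assms(2)]] by simp

lemma cos_first_order: "\<bar>cos (a + z) - cos a + z * sin a\<bar> \<le> z\<^sup>2" for a z :: real
proof -
  have "cos (a + z) - cos a + z * sin a = cos a * (cos z - 1) - sin a * (sin z - z)"
    by (simp add: cos_add algebra_simps)
  also have "\<bar>\<dots>\<bar> \<le> \<bar>cos a\<bar> * \<bar>cos z - 1\<bar> + \<bar>sin a\<bar> * \<bar>sin z - z\<bar>"
    by (metis abs_mult abs_triangle_ineq4)
  also have "\<dots> \<le> 1 * (z\<^sup>2 / 2) + 1 * (z\<^sup>2 / 2)"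
    using one_minus_cos_le[of z] abs_sin_minus_self_le[of z]
    by (intro add_mono mult_mono) auto
  finally show ?thesis by simp
qed

text \<open>
  Differentiation under the integral, from the pointwise bound \<open>cos_first_order\<close> on the remainder.
\<close>

lemma sphere_average_cos_deriv:
  fixes \<phi> \<alpha> \<beta> :: "real^'d \<Rightarrow> real"
  assumes c: "continuous_on (sphere 0 1) \<phi>" "continuous_on (sphere 0 1) \<alpha>" "continuous_on (sphere 0 1) \<beta>"
  shows "((\<lambda>s. sphere_average (\<lambda>\<omega>. \<phi> \<omega> * cos (\<alpha> \<omega> + s * \<beta> \<omega>))) has_real_derivative
    - sphere_average (\<lambda>\<omega>. \<phi> \<omega> * \<beta> \<omega> * sin (\<alpha> \<omega> + s * \<beta> \<omega>))) (at s)"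
proof -
  let ?D = "\<lambda>s. sphere_average (\<lambda>\<omega>. \<phi> \<omega> * cos (\<alpha> \<omega> + s * \<beta> \<omega>))"
  let ?D' = "- sphere_average (\<lambda>\<omega>. \<phi> \<omega> * \<beta> \<omega> * sin (\<alpha> \<omega> + s * \<beta> \<omega>))"
  define C where "C = sphere_average (\<lambda>\<omega>. \<bar>\<phi> \<omega>\<bar> * (\<beta> \<omega>)\<^sup>2)"
  have bound: "\<bar>(?D (s + t) - ?D s) / t - ?D'\<bar> \<le> C * \<bar>t\<bar>" if t: "t \<noteq> 0" for t
  proof -
    let ?r = "\<lambda>\<omega>. \<phi> \<omega> * (cos (\<alpha> \<omega> + (s + t) * \<beta> \<omega>) - cos (\<alpha> \<omega> + s * \<beta> \<omega>) + t * \<beta> \<omega> * sin (\<alpha> \<omega> + s * \<beta> \<omega>))"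
    have cr: "continuous_on (sphere 0 1) ?r" by (intro continuous_intros c)
    have eq: "?D (s + t) - ?D s - t * ?D' = sphere_average ?r"
    proof -
      have "sphere_average ?r = sphere_average (\<lambda>\<omega>. (\<phi> \<omega> * cos (\<alpha> \<omega> + (s + t) * \<beta> \<omega>) - \<phi> \<omega> * cos (\<alpha> \<omega> + s * \<beta> \<omega>))
          + t * (\<phi> \<omega> * \<beta> \<omega> * sin (\<alpha> \<omega> + s * \<beta> \<omega>)))"
        by (rule sphere_average_cong) (simp add: algebra_simps)
      also have "\<dots> = ?D (s + t) - ?D s + t * sphere_average (\<lambda>\<omega>. \<phi> \<omega> * \<beta> \<omega> * sin (\<alpha> \<omega> + s * \<beta> \<omega>))"
        by (subst sphere_average_add, (intro continuous_intros c)+, subst sphere_average_diff, (intro continuous_intros c)+)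
          (simp add: sphere_average_cmult)
      finally show ?thesis by simp
    qed
    have pt: "\<bar>?r \<omega>\<bar> \<le> t\<^sup>2 * (\<bar>\<phi> \<omega>\<bar> * (\<beta> \<omega>)\<^sup>2)" for \<omega>
    proof -
      have "\<bar>?r \<omega>\<bar> = \<bar>\<phi> \<omega>\<bar> * \<bar>cos ((\<alpha> \<omega> + s * \<beta> \<omega>) + t * \<beta> \<omega>) - cos (\<alpha> \<omega> + s * \<beta> \<omega>) + (t * \<beta> \<omega>) * sin (\<alpha> \<omega> + s * \<beta> \<omega>)\<bar>"
        unfolding abs_mult[symmetric] by (simp add: algebra_simps)
      also have "\<dots> \<le> \<bar>\<phi> \<omega>\<bar> * (t * \<beta> \<omega>)\<^sup>2"
        by (intro mult_left_mono cos_first_order) simp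
      finally show ?thesis by (simp add: power_mult_distrib mult_ac)
    qed
    have "sphere_average ?r \<le> sphere_average (\<lambda>\<omega>. t\<^sup>2 * (\<bar>\<phi> \<omega>\<bar> * (\<beta> \<omega>)\<^sup>2))"
    proof (rule sphere_average_mono[OF cr])
      show "continuous_on (sphere 0 1) (\<lambda>\<omega>. t\<^sup>2 * (\<bar>\<phi> \<omega>\<bar> * (\<beta> \<omega>)\<^sup>2))" by (intro continuous_intros c)
      fix \<omega> show "?r \<omega> \<le> t\<^sup>2 * (\<bar>\<phi> \<omega>\<bar> * (\<beta> \<omega>)\<^sup>2)" using pt[of \<omega>] by linarith
    qed
    moreover have "sphere_average (\<lambda>\<omega>. - (t\<^sup>2 * (\<bar>\<phi> \<omega>\<bar> * (\<beta> \<omega>)\<^sup>2))) \<le> sphere_average ?r"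
    proof (rule sphere_average_mono[OF _ cr])
      show "continuous_on (sphere 0 1) (\<lambda>\<omega>. - (t\<^sup>2 * (\<bar>\<phi> \<omega>\<bar> * (\<beta> \<omega>)\<^sup>2)))" by (intro continuous_intros c)
      fix \<omega> show "- (t\<^sup>2 * (\<bar>\<phi> \<omega>\<bar> * (\<beta> \<omega>)\<^sup>2)) \<le> ?r \<omega>" using pt[of \<omega>] by linarith
    qed
    ultimately have "\<bar>sphere_average ?r\<bar> \<le> t\<^sup>2 * C"
      using sphere_average_cmult[of "-1" "\<lambda>\<omega>. t\<^sup>2 * (\<bar>\<phi> \<omega>\<bar> * (\<beta> \<omega>)\<^sup>2)"] by (simp add: sphere_average_cmult C_def abs_le_iff)
    then have "\<bar>?D (s + t) - ?D s - t * ?D'\<bar> \<le> t\<^sup>2 * C" unfolding eq .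
    moreover have "(?D (s + t) - ?D s) / t - ?D' = (?D (s + t) - ?D s - t * ?D') / t"
      using t by (simp add: diff_divide_distrib add_divide_distrib)
    ultimately show ?thesis
      using t by (simp add: abs_divide divide_le_eq power2_eq_square mult_ac)
  qed
  show ?thesis
    unfolding DERIV_def
  proof (rule Lim_null[THEN iffD2], rule Lim_null_comparison)
    show "\<forall>\<^sub>F t in at 0. norm ((?D (s + t) - ?D s) / t - ?D') \<le> C * \<bar>t\<bar>"
      using bound by (auto simp: eventually_at_filter)
    show "((\<lambda>t. C * \<bar>t\<bar>) \<longlongrightarrow> 0) (at (0::real))" by (auto intro!: tendsto_eq_intros)
  qed
qed

lemma sin_as_cos: "sin y = cos (- (pi/2) + y)" for y :: real
  by (simp add: cos_diff)

lemma sphere_average_sin_deriv: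
  fixes \<phi> \<alpha> \<beta> :: "real^'d \<Rightarrow> real"
  assumes c: "continuous_on (sphere 0 1) \<phi>" "continuous_on (sphere 0 1) \<alpha>" "continuous_on (sphere 0 1) \<beta>"
  shows "((\<lambda>s. sphere_average (\<lambda>\<omega>. \<phi> \<omega> * sin (\<alpha> \<omega> + s * \<beta> \<omega>))) has_real_derivative
    sphere_average (\<lambda>\<omega>. \<phi> \<omega> * \<beta> \<omega> * cos (\<alpha> \<omega> + s * \<beta> \<omega>))) (at s)"
proof -
  have "continuous_on (sphere 0 1) (\<lambda>\<omega>. - (pi/2) + \<alpha> \<omega>)" by (intro continuous_intros c)
  from sphere_average_cos_deriv[OF c(1) this c(3), of s]
  have "((\<lambda>s. sphere_average (\<lambda>\<omega>. \<phi> \<omega> * cos (- (pi/2) + (\<alpha> \<omega> + s * \<beta> \<omega>)))) has_real_derivative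
    - sphere_average (\<lambda>\<omega>. \<phi> \<omega> * \<beta> \<omega> * sin (- (pi/2) + (\<alpha> \<omega> + s * \<beta> \<omega>)))) (at s)"
    by (simp only: add.assoc)
  moreover have "sin (- (pi/2) + y) = - cos y" for y :: real by (simp add: sin_diff)
  moreover have "- sphere_average (\<lambda>\<omega>. \<phi> \<omega> * \<beta> \<omega> * (- cos (\<alpha> \<omega> + s * \<beta> \<omega>))) = sphere_average (\<lambda>\<omega>. \<phi> \<omega> * \<beta> \<omega> * cos (\<alpha> \<omega> + s * \<beta> \<omega>))"
    using sphere_average_cmult[of "-1" "\<lambda>\<omega>. \<phi> \<omega> * \<beta> \<omega> * cos (\<alpha> \<omega> + s * \<beta> \<omega>)"] by simp
  ultimately show ?thesis by (simp only: sin_as_cos[symmetric])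
qed

definition sphere_transform :: "real^'d \<Rightarrow> real" where
  "sphere_transform x = sphere_average (\<lambda>\<omega>. cos (x \<bullet> \<omega>))"

text \<open>
  A reflection interchanges \<open>x\<close> and \<open>y\<close>.
\<close>

lemma sphere_transform_radial:
  fixes x y :: "real^'d"
  assumes "norm x = norm y"
  shows "sphere_transform x = sphere_transform y"
proof (cases "x = y")
  case False
  let ?v = "(x - y) /\<^sub>R norm (x - y)"
  have R: "orthogonal_transformation (reflection ?v)"
    using False by (intro orthogonal_transformation_reflection) simp
  have "sphere_transform x = sphere_average (\<lambda>\<omega>. cos (reflection ?v x \<bullet> reflection ?v \<omega>))"
    using R by (simp add: sphere_transform_def orthogonal_transformation_def)
  also have "\<dots> = sphere_average (\<lambda>\<omega>. cos (y \<bullet> reflection ?v \<omega>))"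
    by (simp only: reflection_swap[OF assms False])
  also have "\<dots> = sphere_transform y"
    unfolding sphere_transform_def
    by (rule sphere_average_orthogonal[OF R]) (intro continuous_intros)
  finally show ?thesis .
qed simp

text \<open>
  The profile is taken along a coordinate vector \<open>e\<close>; the number \<open>n\<close> is the dimension of the sphere.
\<close>

context
  fixes e :: "real^'d" and n :: real
  assumes e: "e \<in> Basis" and dim: "CARD('d) \<ge> 2" and n: "n = real CARD('d) - 1"
begin

definition profile :: "real \<Rightarrow> real" where
  "profile t = sphere_average (\<lambda>\<omega>. cos (t * (e \<bullet> \<omega>)))"

definition profile_deriv :: "real \<Rightarrow> real" where
  "profile_deriv t = - sphere_average (\<lambda>\<omega>. (e \<bullet> \<omega>) * sin (t * (e \<bullet> \<omega>)))"

lemma sphere_transform_profile: "sphere_transform (x :: real^'d) = profile (norm x)"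
proof -
  have "sphere_transform x = sphere_transform (norm x *\<^sub>R e)"
    using e by (intro sphere_transform_radial) simp
  then show ?thesis by (simp add: sphere_transform_def profile_def)
qed

lemma DERIV_profile: "(profile has_real_derivative profile_deriv t) (at t)"
  using sphere_average_cos_deriv[of "\<lambda>_. 1" "\<lambda>_. 0" "\<lambda>\<omega>. e \<bullet> \<omega>" t]
  by (simp add: profile_def[abs_def] profile_deriv_def continuous_intros)

lemma DERIV_profile_deriv:
  "(profile_deriv has_real_derivative - sphere_average (\<lambda>\<omega>. (e \<bullet> \<omega>)\<^sup>2 * cos (t * (e \<bullet> \<omega>)))) (at t)"
  using DERIV_minus[OF sphere_average_sin_deriv[of "\<lambda>\<omega>. e \<bullet> \<omega>" "\<lambda>_. 0" "\<lambda>\<omega>. e \<bullet> \<omega>" t]]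
  by (simp add: profile_deriv_def[abs_def] power2_eq_square continuous_intros)

text \<open>
  Since the transform is radial, its value at \<open>t e + s j\<close> is \<open>profile (sqrt (t\<^sup>2 + s\<^sup>2))\<close>.
  Both sides of this identity are differentiated twice in \<open>s\<close> at \<open>s = 0\<close>.
\<close>

lemma transverse_average:
  assumes j: "j \<in> Basis" "j \<noteq> e" and t: "t > 0"
  shows "sphere_average (\<lambda>\<omega>. (j \<bullet> \<omega>)\<^sup>2 * cos (t * (e \<bullet> \<omega>))) = - profile_deriv t / t"
proof -
  have ej: "e \<bullet> j = 0" "e \<bullet> e = 1" "j \<bullet> j = 1" using e j by (auto simp: inner_Basis)
  define r where "r = (\<lambda>s. sqrt (t\<^sup>2 + s\<^sup>2))"
  have r0: "t\<^sup>2 + s\<^sup>2 > 0" for s using t by (simp add: add_pos_nonneg)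
  have rpos: "r s > 0" for s using r0[of s] by (simp add: r_def)
  have dr: "(r has_real_derivative s / r s) (at s)" for s
    unfolding r_def using r0[of s] by (auto intro!: derivative_eq_intros simp: field_simps)
  have nr: "norm (t *\<^sub>R e + s *\<^sub>R j) = r s" for s
    unfolding norm_eq_sqrt_inner r_def by (simp add: inner_add_left inner_add_right ej inner_commute[of j e] power2_eq_square)
  have eq1: "sphere_average (\<lambda>\<omega>. 1 * cos (t * (e \<bullet> \<omega>) + s * (j \<bullet> \<omega>))) = profile (r s)" for s
    using sphere_transform_profile[of "t *\<^sub>R e + s *\<^sub>R j"] unfolding nr
    by (simp add: sphere_transform_def inner_add_left)
  have "((\<lambda>s. sphere_average (\<lambda>\<omega>. 1 * cos (t * (e \<bullet> \<omega>) + s * (j \<bullet> \<omega>)))) has_real_derivative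
     - sphere_average (\<lambda>\<omega>. 1 * (j \<bullet> \<omega>) * sin (t * (e \<bullet> \<omega>) + s * (j \<bullet> \<omega>)))) (at s)" for s
    by (rule sphere_average_cos_deriv) (intro continuous_intros)+
  moreover have "((\<lambda>s. profile (r s)) has_real_derivative profile_deriv (r s) * (s / r s)) (at s)" for s
    by (rule DERIV_chain2[OF DERIV_profile dr])
  ultimately have neq: "- sphere_average (\<lambda>\<omega>. 1 * (j \<bullet> \<omega>) * sin (t * (e \<bullet> \<omega>) + s * (j \<bullet> \<omega>))) = profile_deriv (r s) * (s / r s)" for s
    unfolding eq1 by (rule DERIV_unique)
  have eq2: "sphere_average (\<lambda>\<omega>. (j \<bullet> \<omega>) * sin (t * (e \<bullet> \<omega>) + s * (j \<bullet> \<omega>))) = - (profile_deriv (r s) * (s / r s))" for s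
    using arg_cong[of _ _ uminus, OF neq[of s]] by simp
  have "((\<lambda>s. sphere_average (\<lambda>\<omega>. (j \<bullet> \<omega>) * sin (t * (e \<bullet> \<omega>) + s * (j \<bullet> \<omega>)))) has_real_derivative
     sphere_average (\<lambda>\<omega>. (j \<bullet> \<omega>) * (j \<bullet> \<omega>) * cos (t * (e \<bullet> \<omega>) + 0 * (j \<bullet> \<omega>)))) (at 0)"
    by (rule sphere_average_sin_deriv) (intro continuous_intros)+
  moreover have "((\<lambda>s. - (profile_deriv (r s) * (s / r s))) has_real_derivative - profile_deriv t / t) (at 0)"
  proof -
    \<comment> \<open>In the product rule at \<open>0\<close> the derivative \<open>k\<close> of the first factor is multiplied by \<open>0 / t\<close>.\<close>
    obtain k where k: "((\<lambda>s. profile_deriv (r s)) has_real_derivative k) (at 0)"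
      using DERIV_chain2[OF DERIV_profile_deriv dr] by blast
    have rr: "r 0 = t" using t by (simp add: r_def)
    show ?thesis
      using t by (auto intro!: derivative_eq_intros k dr simp: rr)
  qed
  ultimately have "sphere_average (\<lambda>\<omega>. (j \<bullet> \<omega>) * (j \<bullet> \<omega>) * cos (t * (e \<bullet> \<omega>) + 0 * (j \<bullet> \<omega>))) = - profile_deriv t / t"
    unfolding eq2 using DERIV_unique by blast
  then show ?thesis by (simp add: power2_eq_square)
qed

lemma sum_squares_sphere:
  assumes "norm \<omega> = 1" shows "(e \<bullet> \<omega>)\<^sup>2 + (\<Sum>j\<in>Basis - {e}. (j \<bullet> \<omega>)\<^sup>2) = 1"
proof -
  have "(e \<bullet> \<omega>)\<^sup>2 + (\<Sum>j\<in>Basis - {e}. (j \<bullet> \<omega>)\<^sup>2) = (\<Sum>j\<in>Basis. (j \<bullet> \<omega>)\<^sup>2)"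
    using e by (simp add: sum.remove)
  also have "\<dots> = \<omega> \<bullet> \<omega>" by (subst euclidean_inner) (simp add: power2_eq_square inner_commute)
  finally show ?thesis using assms by (simp add: norm_eq_1)
qed

text \<open>
  Splitting \<open>1 = (e \<bullet> \<omega>)\<^sup>2 + \<Sum> (j \<bullet> \<omega>)\<^sup>2\<close> in the average that defines \<open>profile t\<close>; the first term is
  minus the second derivative and each of the other \<open>n\<close> terms is a transverse average.
\<close>

lemma DERIV_profile_deriv_ode:
  assumes t: "t > 0"
  shows "(profile_deriv has_real_derivative - profile t - n / t * profile_deriv t) (at t)"
proof -
  have "profile t = sphere_average (\<lambda>\<omega>. (e \<bullet> \<omega>)\<^sup>2 * cos (t * (e \<bullet> \<omega>)) + (\<Sum>j\<in>Basis - {e}. (j \<bullet> \<omega>)\<^sup>2 * cos (t * (e \<bullet> \<omega>))))"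
    unfolding profile_def
    by (rule sphere_average_cong) (use sum_squares_sphere in \<open>simp add: sum_distrib_right[symmetric] distrib_right[symmetric]\<close>)
  also have "\<dots> = sphere_average (\<lambda>\<omega>. (e \<bullet> \<omega>)\<^sup>2 * cos (t * (e \<bullet> \<omega>))) + (\<Sum>j\<in>Basis - {e}. sphere_average (\<lambda>\<omega>. (j \<bullet> \<omega>)\<^sup>2 * cos (t * (e \<bullet> \<omega>))))"
    by (subst sphere_average_add, (intro continuous_intros)+, subst sphere_average_sum) (auto intro!: continuous_intros)
  also have "(\<Sum>j\<in>Basis - {e}. sphere_average (\<lambda>\<omega>. (j \<bullet> \<omega>)\<^sup>2 * cos (t * (e \<bullet> \<omega>)))) = n * (- profile_deriv t / t)"
    using e dim t n by (simp add: transverse_average card_Diff_singleton of_nat_diff)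
  finally have "- sphere_average (\<lambda>\<omega>. (e \<bullet> \<omega>)\<^sup>2 * cos (t * (e \<bullet> \<omega>))) = - profile t - n / t * profile_deriv t"
    by simp
  then show ?thesis using DERIV_profile_deriv[of t] by simp
qed

definition energy :: "real \<Rightarrow> real" where
  "energy t = (profile t)\<^sup>2 + (profile_deriv t)\<^sup>2"

lemma energy_decreasing:
  assumes "0 < s" "s \<le> t"
  shows "energy t \<le> energy s"
proof (rule DERIV_nonpos_imp_nonincreasing[OF assms(2)])
  fix x assume "s \<le> x" "x \<le> t"
  then have x: "x > 0" using assms by linarith
  have "(energy has_real_derivative 2 * profile x * profile_deriv x + 2 * profile_deriv x * (- profile x - n / x * profile_deriv x)) (at x)"
    unfolding energy_def[abs_def]
    by (auto intro!: derivative_eq_intros DERIV_profile DERIV_profile_deriv_ode x)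
  moreover have "2 * profile x * profile_deriv x + 2 * profile_deriv x * (- profile x - n / x * profile_deriv x) = - (2 * n / x * (profile_deriv x)\<^sup>2)"
    by (simp add: algebra_simps power2_eq_square)
  moreover have "2 * n / x * (profile_deriv x)\<^sup>2 \<ge> 0"
    using x dim n by (intro mult_nonneg_nonneg divide_nonneg_pos) auto
  ultimately show "\<exists>y. (energy has_real_derivative y) (at x) \<and> y \<le> 0"
    by (intro exI conjI) (assumption, simp only: neg_le_0_iff_le)
qed

text \<open>
  The energy alone decreases, but at a rate that vanishes where \<open>h' = 0\<close>.  The correction
  \<open>n / t h h'\<close> distributes the dissipation evenly: with it the energy decays, to leading order, at
  the logarithmic rate \<open>n / t\<close>, and since \<open>n \<ge> 1\<close> the factor \<open>sqrt t\<close> can be absorbed for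
  large \<open>t\<close>.
\<close>

lemma profile_bound_decay:
  obtains C T where "C \<ge> 0" "T > 0" "\<And>t. t \<ge> T \<Longrightarrow> (profile t)\<^sup>2 \<le> C / sqrt t"
proof -
  define w where "w = (\<lambda>t. sqrt t * (energy t + n / t * (profile t * profile_deriv t)))"
  \<comment> \<open>Beyond \<open>T\<close> the coefficient \<open>(n\<^sup>2 + n/2) / t\<close> of the error term in the derivative of \<open>w\<close> is at most \<open>1\<close>.\<close>
  define T where "T = n\<^sup>2 + n"
  have n1: "n \<ge> 1" using dim n by simp
  have T1: "T \<ge> n" "T > 0" using n1 by (auto simp: T_def add_nonneg_pos)
  have hg: "\<bar>profile t * profile_deriv t\<bar> \<le> energy t / 2" for t
  proof -
    have "0 \<le> (\<bar>profile t\<bar> - \<bar>profile_deriv t\<bar>)\<^sup>2" by simp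
    then show ?thesis by (simp add: energy_def power2_diff abs_mult)
  qed
  have e0: "energy t \<ge> 0" for t by (simp add: energy_def)
  have dec: "w t \<le> w T" if "t \<ge> T" for t
  proof (rule DERIV_nonpos_imp_nonincreasing[OF that])
    fix x assume x: "T \<le> x" "x \<le> t"
    then have x0: "x > 0" using T1 by linarith
    let ?h = "profile x" and ?g = "profile_deriv x"
    let ?E' = "2 * ?h * ?g + 2 * ?g * (- ?h - n / x * ?g)"
    let ?P' = "?g * ?g + ?h * (- ?h - n / x * ?g)"
    have dE: "(energy has_real_derivative ?E') (at x)"
      unfolding energy_def[abs_def]
      by (auto intro!: derivative_eq_intros DERIV_profile DERIV_profile_deriv_ode x0)
    have dP: "((\<lambda>t. profile t * profile_deriv t) has_real_derivative ?P') (at x)"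
      by (auto intro!: derivative_eq_intros DERIV_profile DERIV_profile_deriv_ode x0)
    have dq: "((\<lambda>t. n / t) has_real_derivative - (n / x\<^sup>2)) (at x)"
      using x0 by (auto intro!: derivative_eq_intros simp: power2_eq_square)
    have ds: "(sqrt has_real_derivative sqrt x / (2 * x)) (at x)"
    proof -
      have "sqrt x * sqrt x = x" using x0 by simp
      then have "inverse (sqrt x) / 2 = sqrt x / (2 * x)" using x0 by (simp add: field_simps)
      then show ?thesis using DERIV_real_sqrt[OF x0] by (simp only:)
    qed
    have "(w has_real_derivative sqrt x / (2 * x) * (energy x + n / x * (?h * ?g)) + (?E' + (- (n / x\<^sup>2) * (?h * ?g) + ?P' * (n / x))) * sqrt x) (at x)"
      unfolding w_def by (intro DERIV_mult DERIV_add ds dE dP dq)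
    moreover have "sqrt x / (2 * x) * (energy x + n / x * (?h * ?g)) + (?E' + (- (n / x\<^sup>2) * (?h * ?g) + ?P' * (n / x))) * sqrt x
      = sqrt x / x * ((1/2 - n) * energy x - (n\<^sup>2 + n / 2) / x * (?h * ?g))"
      using x0 by (simp add: energy_def power2_eq_square field_simps)
    moreover have "sqrt x / x * ((1/2 - n) * energy x - (n\<^sup>2 + n / 2) / x * (?h * ?g)) \<le> 0"
    proof (rule mult_nonneg_nonpos)
      have "(n\<^sup>2 + n / 2) / x \<le> 1" using x n1 x0 by (simp add: T_def pos_divide_le_eq)
      moreover have "(n\<^sup>2 + n / 2) / x \<ge> 0" using n1 x0 by simp
      ultimately have "(n\<^sup>2 + n / 2) / x * \<bar>?h * ?g\<bar> \<le> 1 * (energy x / 2)"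
        using hg[of x] by (intro mult_mono) auto
      moreover have "- ((n\<^sup>2 + n / 2) / x * (?h * ?g)) \<le> (n\<^sup>2 + n / 2) / x * \<bar>?h * ?g\<bar>"
        using mult_left_mono[OF _ \<open>(n\<^sup>2 + n / 2) / x \<ge> 0\<close>, of "- (?h * ?g)" "\<bar>?h * ?g\<bar>"] by simp
      moreover have "(1/2 - n) * energy x \<le> (- 1/2) * energy x"
        using n1 e0 by (intro mult_right_mono) auto
      ultimately show "(1/2 - n) * energy x - (n\<^sup>2 + n / 2) / x * (?h * ?g) \<le> 0" by linarith
    qed (use x0 in simp)
    ultimately show "\<exists>y. (w has_real_derivative y) (at x) \<and> y \<le> 0" by (intro exI conjI) (assumption, simp only:)
  qed
  have main: "sqrt t * (profile t)\<^sup>2 \<le> 2 * w T" if t: "t \<ge> T" for t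
  proof -
    have t0: "t > 0" using t T1 by linarith
    have "n / t \<le> 1" using t T1 t0 by simp
    then have hi: "n / t * \<bar>profile t * profile_deriv t\<bar> \<le> 1 * (energy t / 2)"
      using hg[of t] by (intro mult_mono) auto
    have lo: "- (n / t * \<bar>profile t * profile_deriv t\<bar>) \<le> n / t * (profile t * profile_deriv t)"
    proof -
      have "n / t \<ge> 0" using t0 n1 by simp
      from mult_left_mono[OF _ this, of "- \<bar>profile t * profile_deriv t\<bar>" "profile t * profile_deriv t"]
      show ?thesis by simp
    qed
    have "energy t / 2 \<le> energy t + n / t * (profile t * profile_deriv t)"
    proof -
      have "E / 2 \<le> E + Y" if "X \<le> 1 * (E / 2)" "- X \<le> Y" for E X Y :: real using that by linarith
      then show ?thesis using hi lo by blast
    qed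
    then have "sqrt t * (energy t / 2) \<le> w t"
      unfolding w_def using t0 by (intro mult_left_mono) auto
    with dec[OF t] have "sqrt t * energy t \<le> 2 * w T" by simp
    moreover have "sqrt t * (profile t)\<^sup>2 \<le> sqrt t * energy t"
      using t0 by (intro mult_left_mono) (auto simp: energy_def)
    ultimately show ?thesis by linarith
  qed
  show ?thesis
  proof (rule that[of "2 * w T" T])
    show "2 * w T \<ge> 0" using main[of T] T1 by (meson mult_nonneg_nonneg order_refl order_trans real_sqrt_ge_zero less_imp_le zero_le_power2)
    fix t assume "t \<ge> T"
    then show "(profile t)\<^sup>2 \<le> 2 * w T / sqrt t"
      using main[of t] T1 by (simp add: pos_le_divide_eq mult.commute)
  qed (rule T1)
qed

text \<open>
  With averages over the sphere, \<open>h = \<langle>cos\<rangle>\<close> and \<open>h' = - \<langle>\<tau> sin\<rangle>\<close> for \<open>\<tau> = e \<bullet> \<omega>\<close>.  By Cauchy--Schwarz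
  the energy is at most \<open>\<langle>cos\<^sup>2\<rangle> + \<langle>\<tau>\<^sup>2\<rangle> \<langle>sin\<^sup>2\<rangle>\<close>, which is less than \<open>1\<close> because \<open>\<langle>\<tau>\<^sup>2\<rangle> < 1\<close>.
\<close>

lemma energy_less_1:
  assumes t: "0 < t" "t < pi"
  shows "energy t < 1"
proof -
  let ?m = "sphere_mass TYPE('d)"
  let ?c = "\<lambda>\<omega>. cos (t * (e \<bullet> \<omega>))" and ?s = "\<lambda>\<omega>. sin (t * (e \<bullet> \<omega>))" and ?l = "\<lambda>\<omega>. e \<bullet> \<omega>"
  have m: "?m > 0" by (rule sphere_mass_pos)
  have cc: "continuous_on (sphere 0 1) ?c" "continuous_on (sphere 0 1) ?s" "continuous_on (sphere 0 1) ?l"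
    by (intro continuous_intros)+
  have sq1: "sphere_sq (\<lambda>_ :: real^'d. 1) = ?m" by (simp add: sphere_inner_def)
  have CS: "(sphere_inner a b)\<^sup>2 \<le> sphere_sq a * sphere_sq b"
    if "continuous_on (sphere 0 1) a" "continuous_on (sphere 0 1) b" "sphere_sq b > 0" for a b :: "real^'d \<Rightarrow> real"
    using bessel_sphere[of "{()}" "\<lambda>_. b" a] that by (simp add: pos_divide_le_eq)
  have en: "norm e = 1" "e \<bullet> e = 1" using e by auto
  have lpos: "sphere_sq ?l > 0" by (rule sphere_sq_pos[OF cc(3) en(1)]) (simp add: en)
  have spos: "sphere_sq ?s > 0"
    by (rule sphere_sq_pos[OF cc(2) en(1)]) (use sin_gt_zero[OF t] in \<open>simp add: en\<close>)
  have llt: "sphere_sq ?l < ?m"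
  proof -
    have "2 \<le> DIM(real^'d)" using dim by simp
    then obtain y where y: "y \<noteq> 0" "orthogonal e y" using orthogonal_to_vector_exists[of e] by blast
    define g where "g = (\<lambda>\<omega>. sqrt (1 - (e \<bullet> \<omega>)\<^sup>2))"
    have le1: "(e \<bullet> \<omega>)\<^sup>2 \<le> 1" if "norm \<omega> = 1" for \<omega>
      using Cauchy_Schwarz_ineq2[of e \<omega>] that en by (simp add: abs_square_le_1)
    have cg: "continuous_on (sphere 0 1) g" unfolding g_def by (intro continuous_intros)
    have "sphere_sq g > 0"
      by (rule sphere_sq_pos[OF cg, of "y /\<^sub>R norm y"]) (use y in \<open>auto simp: g_def orthogonal_def\<close>)
    also have "sphere_sq g = (LINT \<omega>|sphere_measure. 1 - (e \<bullet> \<omega>) * (e \<bullet> \<omega>))"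
      unfolding sphere_inner_def g_def
      by (rule Bochner_Integration.integral_cong) (use le1 in \<open>auto simp: space_sphere_measure power2_eq_square\<close>)
    also have "\<dots> = ?m - sphere_sq ?l"
      unfolding sphere_inner_def
      by (subst Bochner_Integration.integral_diff) (auto intro!: integrable_continuous_on_sphere continuous_intros)
    finally show ?thesis by simp
  qed
  have tot: "sphere_sq ?c + sphere_sq ?s = ?m"
  proof -
    have "sphere_sq ?c + sphere_sq ?s = (LINT \<omega>|(sphere_measure :: (real^'d) measure). ?c \<omega> * ?c \<omega> + ?s \<omega> * ?s \<omega>)"
      unfolding sphere_inner_def
      by (rule Bochner_Integration.integral_add[symmetric])
        (intro integrable_continuous_on_sphere continuous_intros)+
    then show ?thesis by (simp flip: power2_eq_square)
  qed
  have "(sphere_inner ?c (\<lambda>_. 1))\<^sup>2 \<le> sphere_sq ?c * ?m"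
    using CS[OF cc(1), of "\<lambda>_. 1"] m by (simp add: sq1)
  moreover have "(sphere_inner ?s ?l)\<^sup>2 \<le> sphere_sq ?s * sphere_sq ?l"
    by (rule CS[OF cc(2,3) lpos])
  moreover have "sphere_sq ?s * sphere_sq ?l < sphere_sq ?s * ?m"
    using spos llt by simp
  ultimately have "(sphere_inner ?c (\<lambda>_. 1))\<^sup>2 + (sphere_inner ?s ?l)\<^sup>2 < (sphere_sq ?c + sphere_sq ?s) * ?m"
    by (simp add: distrib_right)
  also have "\<dots> = ?m\<^sup>2" unfolding tot by (simp add: power2_eq_square)
  finally have "((sphere_inner ?c (\<lambda>_. 1))\<^sup>2 + (sphere_inner ?s ?l)\<^sup>2) / ?m\<^sup>2 < 1" using m by simp
  moreover have "energy t = ((sphere_inner ?c (\<lambda>_. 1))\<^sup>2 + (sphere_inner ?s ?l)\<^sup>2) / ?m\<^sup>2"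
    by (simp add: energy_def profile_def profile_deriv_def sphere_average_def sphere_inner_def power_divide
        add_divide_distrib mult.commute)
  ultimately show ?thesis by simp
qed

text \<open>
  The energy dominates the square of the profile, does not increase, and is below \<open>1\<close> at \<open>\<delta>\<close>.
  Averaging the bound with \<open>1\<close> only makes \<open>\<rho>\<close> positive.
\<close>

lemma profile_bound_away:
  assumes "0 < \<delta>" "\<delta> < pi"
  obtains \<rho> where "0 < \<rho>" "\<rho> < 1" "\<And>t. t \<ge> \<delta> \<Longrightarrow> \<bar>profile t\<bar> \<le> \<rho>"
proof -
  define \<rho> where "\<rho> = sqrt ((1 + energy \<delta>) / 2)"
  have E: "0 \<le> energy \<delta>" "energy \<delta> < 1" using energy_less_1[OF assms] by (auto simp: energy_def)
  show ?thesis
  proof (rule that[of \<rho>])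
    show "0 < \<rho>" "\<rho> < 1" using E by (auto simp: \<rho>_def)
    fix t assume "t \<ge> \<delta>"
    then have "(profile t)\<^sup>2 \<le> energy \<delta>"
      using energy_decreasing[OF assms(1), of t] by (simp add: energy_def) (smt (verit) zero_le_power2)
    also have "\<dots> \<le> (1 + energy \<delta>) / 2" using E by simp
    finally show "\<bar>profile t\<bar> \<le> \<rho>" unfolding \<rho>_def by (metis real_sqrt_abs real_sqrt_le_mono)
  qed
qed

end

section \<open>Comparison of the moments of the transform\<close>

text \<open>
  A point with \<open>k \<le> norm x < k + 1\<close> lies in the ball of radius \<open>k + 1\<close>, and the contributions of
  these balls are summable like \<open>(k + 1)\<^sup>-\<^sup>2\<close>.
\<close>

lemma integrable_of_polynomial_decay:
  fixes f :: "real^'d \<Rightarrow> real"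
  assumes f: "f \<in> borel_measurable borel" and b: "\<And>x. \<bar>f x\<bar> \<le> K / (1 + norm x) ^ (CARD('d) + 2)"
  shows "integrable lborel f"
proof (rule integrableI_bounded)
  show "f \<in> borel_measurable lborel" using f by simp
  let ?d = "CARD('d)"
  let ?v = "unit_ball_vol (real ?d)"
  have K: "K \<ge> 0" using order_trans[OF abs_ge_zero b[of 0]] by simp
  let ?g = "\<lambda>k x. ennreal (K / real (Suc k) ^ (?d + 2)) * indicator (cball (0::real^'d) (real (Suc k))) x"
  have "(\<integral>\<^sup>+x. ennreal (norm (f x)) \<partial>lborel) \<le> (\<integral>\<^sup>+x. (\<Sum>k. ?g k x) \<partial>lborel)"
  proof (rule nn_integral_mono)
    fix x :: "real^'d"
    define k where "k = nat \<lfloor>norm x\<rfloor>"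
    have k: "real k \<le> norm x" "norm x \<le> real (Suc k)" unfolding k_def by (simp_all, linarith+)
    have "norm (f x) \<le> K / (1 + norm x) ^ (?d + 2)" using b[of x] by simp
    also have "\<dots> \<le> K / real (Suc k) ^ (?d + 2)"
      using k K by (intro divide_left_mono power_mono mult_pos_pos zero_less_power) auto
    finally have "ennreal (norm (f x)) \<le> ?g k x" using k by (simp add: ennreal_leI)
    also have "\<dots> \<le> (\<Sum>k. ?g k x)"
    proof -
      have "sum (\<lambda>k. ?g k x) {k} \<le> (\<Sum>k. ?g k x)" by (rule sum_le_suminf) auto
      then show ?thesis by (simp only: sum.insert finite.emptyI sum.empty empty_iff not_False_eq_True add_0_right)
    qed
    finally show "ennreal (norm (f x)) \<le> (\<Sum>k. ?g k x)" .
  qed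
  also have "\<dots> = (\<Sum>k. \<integral>\<^sup>+x. ?g k x \<partial>lborel)"
  proof (rule nn_integral_suminf)
    have [measurable]: "cball (0::real^'d) r \<in> sets borel" for r by simp
    show "?g k \<in> borel_measurable lborel" for k by measurable
  qed
  also have "\<dots> = (\<Sum>k. ennreal (K * ?v * inverse (real (Suc k) ^ 2)))"
  proof (rule suminf_cong)
    fix k
    have "(\<integral>\<^sup>+x. ?g k x \<partial>lborel) = ennreal (K / real (Suc k) ^ (?d + 2)) * ennreal (?v * real (Suc k) ^ ?d)"
      by (subst nn_integral_cmult_indicator) (simp_all add: emeasure_cball)
    also have "\<dots> = ennreal (K / real (Suc k) ^ (?d + 2) * (?v * real (Suc k) ^ ?d))"
      using K by (intro ennreal_mult[symmetric]) auto
    also have "K / real (Suc k) ^ (?d + 2) * (?v * real (Suc k) ^ ?d) = K * ?v * inverse (real (Suc k) ^ 2)"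
      by (simp only: power_add) (simp add: field_simps)
    finally show "(\<integral>\<^sup>+x. ?g k x \<partial>lborel) = ennreal (K * ?v * inverse (real (Suc k) ^ 2))" .
  qed
  also have "\<dots> < \<infinity>"
  proof -
    have "summable (\<lambda>k. inverse (real (Suc k) ^ 2))"
      using inverse_power_summable[of 2, where 'a = real] by (subst summable_Suc_iff) simp
    then have s: "summable (\<lambda>k. K * ?v * inverse (real (Suc k) ^ 2))" by (rule summable_mult)
    have nn: "0 \<le> K * ?v * inverse (real (Suc k) ^ 2)" for k using K by simp
    show ?thesis by (subst suminf_ennreal2[OF nn s]) simp
  qed
  finally show "(\<integral>\<^sup>+x. ennreal (norm (f x)) \<partial>lborel) < \<infinity>" .
qed

lemma continuous_sphere_transform: "continuous_on UNIV (sphere_transform :: real^'d \<Rightarrow> real)"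
proof -
  have eq: "sphere_transform x = Re (real_extension (\<lambda>_. 1) x) / sphere_mass TYPE('d)" for x :: "real^'d"
    using real_extension_eq[of "\<lambda>_. 1" x] by (simp add: sphere_inner_def sphere_transform_def sphere_average_def)
  have "continuous_on UNIV (real_extension (\<lambda>_ :: real^'d. 1))"
    by (intro continuous_extension continuous_intros)
  then show ?thesis unfolding eq[abs_def]
    using sphere_mass_pos[where 'd='d] by (intro continuous_intros) auto
qed

lemma measurable_sphere_transform[measurable]: "(sphere_transform :: real^'d \<Rightarrow> real) \<in> borel_measurable borel"
  by (intro borel_measurable_continuous_onI continuous_sphere_transform)

lemma norm_extension_one: "norm (real_extension (\<lambda>_. 1) x) = sphere_mass TYPE('d) * \<bar>sphere_transform x\<bar>"
  for x :: "real^'d"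
proof -
  have "sphere_inner (\<lambda>\<omega>. sin (x \<bullet> \<omega>)) (\<lambda>_. 1) = 0"
    by (rule sphere_inner_odd) (auto intro!: continuous_intros)
  moreover have "sphere_inner (\<lambda>\<omega>. cos (x \<bullet> \<omega>)) (\<lambda>_. 1) = sphere_mass TYPE('d) * sphere_transform x"
    using sphere_mass_pos[where 'd='d] by (simp add: sphere_inner_def sphere_transform_def sphere_average_def)
  ultimately show ?thesis
    using sphere_mass_pos[where 'd='d] real_extension_eq[of "\<lambda>_. 1" x]
    by (simp add: complex_norm abs_mult)
qed

lemma abs_sphere_transform_le_1: "\<bar>sphere_transform (x :: real^'d)\<bar> \<le> 1"
proof -
  have "sphere_transform x \<le> sphere_average (\<lambda>_ :: real^'d. 1)"
    unfolding sphere_transform_def by (rule sphere_average_mono) (auto intro!: continuous_intros)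
  moreover have "sphere_average (\<lambda>_ :: real^'d. - 1) \<le> sphere_transform x"
    unfolding sphere_transform_def by (rule sphere_average_mono) (auto intro!: continuous_intros)
  ultimately show ?thesis by (simp add: sphere_average_const abs_le_iff)
qed

text \<open>
  The decay \<open>m(x)\<^sup>4 \<le> C\<^sup>2 / norm x\<close> is raised to the power \<open>N = d + 2\<close>.
\<close>

lemma sphere_transform_integrable_powr:
  assumes dim: "CARD('d::finite) \<ge> 2"
  obtains q0 :: real where "q0 \<ge> 1" "\<And>q. q \<ge> q0 \<Longrightarrow> integrable lborel (\<lambda>x :: real^'d. \<bar>sphere_transform x\<bar> powr q)"
proof -
  define e :: "real^'d" where "e = axis undefined 1"
  have e: "e \<in> Basis" by (simp add: e_def axis_in_Basis_iff)
  obtain C T where C: "C \<ge> 0" "T > 0" "\<And>t. t \<ge> T \<Longrightarrow> (profile e t)\<^sup>2 \<le> C / sqrt t"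
    using profile_bound_decay[OF e dim refl] by blast
  define N where "N = CARD('d) + 2"
  define K where "K = (1 + T) ^ N + (C\<^sup>2 * ((1 + T) / T)) ^ N"
  have bound: "\<bar>sphere_transform x\<bar> ^ (4 * N) \<le> K / (1 + norm x) ^ N" for x :: "real^'d"
  proof (cases "norm x \<ge> T")
    case True
    then have x: "norm x > 0" using C by linarith
    have "((sphere_transform x)\<^sup>2)\<^sup>2 \<le> (C / sqrt (norm x))\<^sup>2"
      using C(3)[OF True] by (intro power_mono) (auto simp: sphere_transform_profile[OF e dim refl])
    also have "\<dots> = C\<^sup>2 / norm x" using x by (simp add: power_divide)
    also have "\<dots> \<le> C\<^sup>2 * ((1 + T) / T) / (1 + norm x)"
    proof -
      have "1 / norm x = (1 + T) / ((1 + T) * norm x)" using C(2) by simp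
      also have "\<dots> \<le> (1 + T) / (T * (1 + norm x))"
        using True x C(2) by (intro divide_left_mono mult_pos_pos) (auto simp: algebra_simps)
      finally have "1 / norm x \<le> ((1 + T) / T) / (1 + norm x)" by simp
      from mult_left_mono[OF this, of "C\<^sup>2"] show ?thesis by simp
    qed
    finally have "(((sphere_transform x)\<^sup>2)\<^sup>2) ^ N \<le> (C\<^sup>2 * ((1 + T) / T) / (1 + norm x)) ^ N"
      by (intro power_mono) auto
    moreover have "\<bar>sphere_transform x\<bar> ^ (4 * N) = (((sphere_transform x)\<^sup>2)\<^sup>2) ^ N"
      by (simp add: power_mult[symmetric] power_even_abs)
    ultimately have "\<bar>sphere_transform x\<bar> ^ (4 * N) \<le> (C\<^sup>2 * ((1 + T) / T)) ^ N / (1 + norm x) ^ N"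
      by (simp only: power_divide)
    also have "\<dots> \<le> K / (1 + norm x) ^ N"
      using C(2) by (intro divide_right_mono) (auto simp: K_def)
    finally show ?thesis .
  next
    case False
    have "\<bar>sphere_transform x\<bar> ^ (4 * N) \<le> 1" by (intro power_le_one abs_sphere_transform_le_1) simp
    also have "1 \<le> ((1 + T) / (1 + norm x)) ^ N"
    proof (rule one_le_power)
      have "1 + norm x > 0" using norm_ge_zero[of x] by linarith
      then show "1 \<le> (1 + T) / (1 + norm x)" using False by (simp add: pos_le_divide_eq)
    qed
    also have "\<dots> = (1 + T) ^ N / (1 + norm x) ^ N" by (rule power_divide)
    also have "\<dots> \<le> K / (1 + norm x) ^ N"
      using C by (intro divide_right_mono) (auto simp: K_def)
    finally show ?thesis .
  qed
  show ?thesis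
  proof (rule that[of "real (4 * N)"])
    show "1 \<le> real (4 * N)" by (simp add: N_def)
    fix q :: real assume q: "real (4 * N) \<le> q"
    show "integrable lborel (\<lambda>x :: real^'d. \<bar>sphere_transform x\<bar> powr q)"
    proof (rule integrable_of_polynomial_decay)
      show "(\<lambda>x :: real^'d. \<bar>sphere_transform x\<bar> powr q) \<in> borel_measurable borel" by measurable
      fix x :: "real^'d"
      have "\<bar>sphere_transform x\<bar> powr q \<le> \<bar>sphere_transform x\<bar> powr real (4 * N)"
        using q abs_sphere_transform_le_1[of x] by (intro powr_mono') auto
      also have "\<dots> = \<bar>sphere_transform x\<bar> ^ (4 * N)"
        by (rule powr_realpow') (auto simp: N_def)
      also have "\<dots> \<le> K / (1 + norm x) ^ N" by (rule bound)
      finally show "\<bar>\<bar>sphere_transform x\<bar> powr q\<bar> \<le> K / (1 + norm x) ^ (CARD('d) + 2)"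
        by (simp add: N_def)
    qed
  qed
qed

text \<open>
  The factor \<open>1/2\<close> makes this the quadratic term in the expansion of \<open>1 - sphere_transform x\<close>.
\<close>

definition sphere_second_moment :: "real^'d \<Rightarrow> real" where
  "sphere_second_moment x = sphere_average (\<lambda>\<omega>. (x \<bullet> \<omega>)\<^sup>2) / 2"

lemma sphere_second_moment_le: "sphere_second_moment x \<le> (norm x)\<^sup>2 / 2" for x :: "real^'d"
proof -
  have "sphere_average (\<lambda>\<omega>. (x \<bullet> \<omega>)\<^sup>2) \<le> sphere_average (\<lambda>_ :: real^'d. (norm x)\<^sup>2)"
  proof (rule sphere_average_mono)
    fix \<omega> :: "real^'d" assume "norm \<omega> = 1"
    then show "(x \<bullet> \<omega>)\<^sup>2 \<le> (norm x)\<^sup>2"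
      using Cauchy_Schwarz_ineq2[of x \<omega>] by (intro abs_le_square_iff[THEN iffD1]) simp
  qed (intro continuous_intros)+
  then show ?thesis by (simp add: sphere_second_moment_def sphere_average_const)
qed

lemma sphere_second_moment_nonneg: "sphere_second_moment x \<ge> 0"
  by (simp add: sphere_second_moment_def sphere_average_def)

lemma sphere_transform_ge: "1 - sphere_second_moment x \<le> sphere_transform x" for x :: "real^'d"
proof -
  have "sphere_average (\<lambda>\<omega>. 1 - (1/2) * (x \<bullet> \<omega>)\<^sup>2) \<le> sphere_transform x"
    unfolding sphere_transform_def
  proof (rule sphere_average_mono)
    fix \<omega> show "1 - (1/2) * (x \<bullet> \<omega>)\<^sup>2 \<le> cos (x \<bullet> \<omega>)" using one_minus_cos_le[of "x \<bullet> \<omega>"] by simp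
  qed (intro continuous_intros)+
  moreover have "sphere_average (\<lambda>\<omega>. 1 - (1/2) * (x \<bullet> \<omega>)\<^sup>2) = 1 - sphere_second_moment x"
  proof -
    have "sphere_average (\<lambda>\<omega>. 1 - (1/2) * (x \<bullet> \<omega>)\<^sup>2) = sphere_average (\<lambda>_ :: real^'d. 1) - sphere_average (\<lambda>\<omega>. (1/2) * (x \<bullet> \<omega>)\<^sup>2)"
      by (rule sphere_average_diff) (intro continuous_intros)+
    also have "sphere_average (\<lambda>\<omega>. (1/2) * (x \<bullet> \<omega>)\<^sup>2) = (1/2) * sphere_average (\<lambda>\<omega>. (x \<bullet> \<omega>)\<^sup>2)"
      by (rule sphere_average_cmult)
    finally show ?thesis by (simp add: sphere_average_const sphere_second_moment_def)
  qed
  ultimately show ?thesis by simp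
qed

text \<open>
  The function \<open>cos y + (1 - \<delta> / 2) y\<^sup>2 / 2\<close> decreases on \<open>[0, \<delta>]\<close>, as \<open>sin y \<ge> (1 - y / 2) y\<close>.
\<close>

lemma cos_dilation_gap:
  fixes a s \<delta> :: real
  assumes s: "s \<ge> 1" and d: "\<bar>s * a\<bar> \<le> \<delta>"
  shows "(1 - \<delta> / 2) * (s\<^sup>2 - 1) * (a\<^sup>2 / 2) \<le> cos a - cos (s * a)"
proof -
  define b where "b = \<bar>a\<bar>"
  have b: "b \<ge> 0" "b \<le> s * b" "s * b \<le> \<delta>"
    using s d mult_right_mono[OF s, of b] by (auto simp: b_def abs_mult)
  let ?h = "\<lambda>y. cos y + (1 - \<delta> / 2) * y\<^sup>2 / 2"
  have "?h (s * b) \<le> ?h b"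
  proof (rule DERIV_nonpos_imp_nonincreasing[OF b(2)])
    fix y assume y: "b \<le> y" "y \<le> s * b"
    have "(?h has_real_derivative - sin y + (1 - \<delta> / 2) * y) (at y)"
      by (auto intro!: derivative_eq_intros)
    moreover have "- sin y + (1 - \<delta> / 2) * y \<le> 0"
    proof -
      have "y * y \<le> \<delta> * y" using y b by (intro mult_right_mono) auto
      then show ?thesis using sin_ge_quadratic[of y] y b by (simp add: power2_eq_square algebra_simps)
    qed
    ultimately show "\<exists>z. DERIV ?h y :> z \<and> z \<le> 0" by blast
  qed
  then have "(1 - \<delta> / 2) * (s\<^sup>2 - 1) * (b\<^sup>2 / 2) \<le> cos b - cos (s * b)"
    by (simp add: power_mult_distrib algebra_simps diff_divide_distrib add_divide_distrib)
  moreover have "b\<^sup>2 = a\<^sup>2" "cos b = cos a" by (simp_all add: b_def)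
  moreover have "cos (s * b) = cos (s * a)" unfolding b_def by (cases "a \<ge> 0") auto
  ultimately show ?thesis by simp
qed

lemma sphere_transform_dilation_gap:
  fixes x :: "real^'d"
  assumes s: "s \<ge> 1" and d: "norm (s *\<^sub>R x) \<le> \<delta>"
  shows "(1 - \<delta> / 2) * (s\<^sup>2 - 1) * sphere_second_moment x \<le> sphere_transform x - sphere_transform (s *\<^sub>R x)"
proof -
  let ?c = "(1 - \<delta> / 2) * (s\<^sup>2 - 1) / 2"
  have "?c * sphere_average (\<lambda>\<omega>. (x \<bullet> \<omega>)\<^sup>2) = sphere_average (\<lambda>\<omega>. ?c * (x \<bullet> \<omega>)\<^sup>2)"
    by (rule sphere_average_cmult[symmetric])
  also have "\<dots> \<le> sphere_average (\<lambda>\<omega>. cos (x \<bullet> \<omega>) - cos (s *\<^sub>R x \<bullet> \<omega>))"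
  proof (rule sphere_average_mono)
    fix \<omega> :: "real^'d" assume "norm \<omega> = 1"
    then have "\<bar>s * (x \<bullet> \<omega>)\<bar> \<le> \<delta>" using Cauchy_Schwarz_ineq2[of "s *\<^sub>R x" \<omega>] d by simp
    from cos_dilation_gap[OF s this] show "?c * (x \<bullet> \<omega>)\<^sup>2 \<le> cos (x \<bullet> \<omega>) - cos (s *\<^sub>R x \<bullet> \<omega>)" by simp
  qed (intro continuous_intros)+
  also have "\<dots> = sphere_transform x - sphere_transform (s *\<^sub>R x)"
    unfolding sphere_transform_def by (rule sphere_average_diff) (intro continuous_intros)+
  finally show ?thesis by (simp add: sphere_second_moment_def)
qed

text \<open>
  For the Gaussian \<open>exp (- |x|\<^sup>2 / 2d)\<close> equality would hold with \<open>s\<^sup>2 = 1 + 2 / q\<close>.  The extra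
  \<open>1 / (D q)\<close> in \<open>s\<^sup>2\<close> pays for the deviation from the Gaussian in a ball of radius
  \<open>\<delta> = 1 / (2 D + 1)\<close>, which is chosen so that \<open>2 + 1 / D = 2 / (1 - \<delta>)\<close>.
\<close>

lemma sphere_transform_dilation_powr:
  fixes x :: "real^'d" and q D :: real
  assumes q: "q > 0" and D: "D \<ge> 1" and \<delta>: "\<delta> = 1 / (2 * D + 1)"
    and s: "s = sqrt (1 + (2 + 1 / D) / q)" and x: "norm (s *\<^sub>R x) \<le> \<delta>"
  shows "\<bar>sphere_transform (s *\<^sub>R x)\<bar> powr q \<le> \<bar>sphere_transform x\<bar> powr (q + 2)"
proof -
  have \<delta>01: "0 < \<delta>" "\<delta> \<le> 1/3" using D by (auto simp: \<delta> divide_le_eq)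
  have e0: "(2 + 1 / D) / q > 0" using q D by (simp add: add_pos_pos)
  have s1: "s \<ge> 1" unfolding s using e0 by simp
  have s2: "s\<^sup>2 = 1 + (2 + 1 / D) / q" unfolding s using e0 by (subst real_sqrt_pow2) auto
  define Q where "Q = sphere_second_moment x"
  have Q0: "Q \<ge> 0" unfolding Q_def by (rule sphere_second_moment_nonneg)
  have nx: "norm x \<le> \<delta>"
  proof -
    have "1 * norm x \<le> s * norm x" using s1 by (intro mult_right_mono) auto
    also have "\<dots> \<le> \<delta>" using x s1 by simp
    finally show ?thesis by simp
  qed
  have small: "(norm y)\<^sup>2 \<le> \<delta>\<^sup>2" if "norm y \<le> \<delta>" for y :: "real^'d" using that by (intro power_mono) auto
  have dd: "\<delta>\<^sup>2 \<le> \<delta>" using \<delta>01 by (simp add: power2_eq_square)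
  have Q1: "Q \<le> \<delta> / 2"
    using sphere_second_moment_le[of x] small[OF nx] dd unfolding Q_def by simp
  let ?m = "sphere_transform x" and ?ms = "sphere_transform (s *\<^sub>R x)"
  have m: "1 - Q \<le> ?m" "?m \<le> 1"
    using sphere_transform_ge[of x] abs_sphere_transform_le_1[of x] by (auto simp: Q_def)
  have mpos: "?m > 0" using m Q1 \<delta>01 by simp
  have mspos: "?ms > 0"
    using sphere_transform_ge[of "s *\<^sub>R x"] sphere_second_moment_le[of "s *\<^sub>R x"] small[OF x] dd \<delta>01 by linarith
  define c where "c = (1 - \<delta> / 2) * (s\<^sup>2 - 1) * Q"
  have c0: "c \<ge> 0" unfolding c_def using \<delta>01 s2 e0 Q0 by (intro mult_nonneg_nonneg) auto
  have "?ms \<le> ?m - c"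
    using sphere_transform_dilation_gap[OF s1 x] by (simp add: c_def Q_def)
  also have "\<dots> \<le> ?m * (1 - c)" using mult_right_mono[OF m(2) c0] by (simp add: algebra_simps)
  also have "\<dots> \<le> ?m * exp (- c)" using exp_ge_add_one_self[of "- c"] mpos by (intro mult_left_mono) auto
  finally have "?ms powr q \<le> (?m * exp (- c)) powr q" using mspos q by (intro powr_mono2) auto
  also have "\<dots> = ?m powr q * exp (- (q * c))" using mpos by (simp add: powr_mult exp_powr_real mult.commute)
  also have "\<dots> \<le> ?m powr q * ?m powr 2"
  proof (intro mult_left_mono)
    define y where "y = Q / (1 - Q)"
    have Q2: "1 - Q > 0" using Q1 \<delta>01 by simp
    have "exp (- y) \<le> 1 - Q"
    proof -
      have "1 / (1 - Q) = 1 + y" using Q2 by (simp add: y_def field_simps)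
      also have "\<dots> \<le> exp y" by (rule exp_ge_add_one_self)
      finally show ?thesis using Q2 by (simp add: exp_minus field_simps)
    qed
    then have "exp (- y) \<le> ?m" using m by linarith
    then have "exp (- y) powr 2 \<le> ?m powr 2" by (intro powr_mono2) auto
    moreover have "exp (- y) powr 2 = exp (- (2 * y))" by (simp add: exp_powr_real)
    moreover have "2 * y \<le> q * c"
    proof -
      have "2 * y = 2 / (1 - Q) * Q" by (simp add: y_def)
      also have "2 / (1 - Q) \<le> (1 - \<delta> / 2) * (2 + 1 / D)"
      proof -
        have D2: "2 + 1 / D = 2 / (1 - \<delta>)" using D by (simp add: \<delta> field_simps)
        have "1 - \<delta> \<le> (1 - \<delta> / 2) * (1 - \<delta> / 2)" by (simp add: algebra_simps)
        also have "\<dots> \<le> (1 - \<delta> / 2) * (1 - Q)" using Q1 \<delta>01 by (intro mult_left_mono) auto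
        finally show ?thesis unfolding D2 using Q2 \<delta>01 by (simp add: field_simps)
      qed
      then have "2 / (1 - Q) * Q \<le> (1 - \<delta> / 2) * (2 + 1 / D) * Q" using Q0 by (intro mult_right_mono)
      also have "\<dots> = q * c" using q by (simp add: c_def s2)
      finally show ?thesis .
    qed
    ultimately show "exp (- (q * c)) \<le> ?m powr 2" by (smt (verit) exp_le_cancel_iff)
  qed simp
  also have "\<dots> = ?m powr (q + 2)" by (simp add: powr_add)
  finally show ?thesis using mpos mspos by simp
qed

lemma lborel_integral_dilation:
  fixes f :: "real^'d \<Rightarrow> real" and s :: real
  assumes s: "s > 0" and [measurable]: "f \<in> borel_measurable borel"
  shows "(LINT x|lborel. f x) = s ^ CARD('d) * (LINT x|lborel. f (s *\<^sub>R x))"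
    "integrable lborel f \<longleftrightarrow> integrable lborel (\<lambda>x. f (s *\<^sub>R x))"
proof -
  have l: "lborel = density (distr lborel borel (\<lambda>x::real^'d. 0 + s *\<^sub>R x)) (\<lambda>_. \<bar>s\<bar> ^ DIM(real^'d))"
    using s by (intro lborel_affine) simp
  have [measurable]: "(\<lambda>x::real^'d. s *\<^sub>R x) \<in> borel_measurable borel" by measurable
  show "(LINT x|lborel. f x) = s ^ CARD('d) * (LINT x|lborel. f (s *\<^sub>R x))"
    using s by (subst l) (simp add: integral_density integral_distr)
  show "integrable lborel f \<longleftrightarrow> integrable lborel (\<lambda>x. f (s *\<^sub>R x))"
    using s by (subst l) (simp add: integrable_density integrable_distr_eq)
qed

definition transform_moment :: "'d::finite itself \<Rightarrow> real \<Rightarrow> real" where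
  "transform_moment _ q = (LINT x|lborel. \<bar>sphere_transform (x :: real^'d)\<bar> powr q)"

text \<open>
  On the ball of radius \<open>1 / q\<close> the integrand is at least \<open>(1 - 1 / (2 q))\<^sup>q \<ge> 1/2\<close>.  Any polynomial
  lower bound in \<open>q\<close> suffices, as it is only compared with an exponentially small tail.
\<close>

lemma transform_moment_lower:
  assumes q: "q \<ge> 1" and int: "integrable lborel (\<lambda>x :: real^'d::finite. \<bar>sphere_transform x\<bar> powr q)"
  shows "unit_ball_vol (real CARD('d)) / 2 * q powr (- real CARD('d)) \<le> transform_moment TYPE('d) q"
proof -
  let ?B = "cball (0::real^'d) (1 / q)"
  have "(LINT x|lborel. 1/2 * indicat_real ?B x) \<le> transform_moment TYPE('d) q"
    unfolding transform_moment_def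
  proof (rule integral_mono)
    show "integrable lborel (\<lambda>x. 1/2 * indicat_real ?B x)"
      by (intro integrable_mult_right integrable_real_indicator) (use emeasure_lborel_cball_finite[of "0::real^'d" "1 / q"] in \<open>auto simp: infinity_ennreal_def\<close>)
    fix x :: "real^'d"
    show "1/2 * indicat_real ?B x \<le> \<bar>sphere_transform x\<bar> powr q"
    proof (cases "x \<in> ?B")
      case True
      have "(norm x)\<^sup>2 \<le> (1 / q)\<^sup>2" using True by (intro power_mono) auto
      also have "\<dots> \<le> 1 / q" using q by (simp add: power2_eq_square field_simps)
      finally have "1 - 1 / (2 * q) \<le> sphere_transform x"
        using sphere_transform_ge[of x] sphere_second_moment_le[of x] by simp
      moreover have h: "1 - 1 / (2 * q) \<ge> 1/2" using q by (simp add: field_simps)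
      ultimately have "(1 - 1 / (2 * q)) powr q \<le> \<bar>sphere_transform x\<bar> powr q"
        using q by (intro powr_mono2) auto
      moreover have "1/2 \<le> (1 - 1 / (2 * q)) powr q"
        using powr_tangent[OF q, of 1 "1 - 1 / (2 * q)"] q h by simp
      ultimately show ?thesis using True by simp
    qed simp
  qed (rule int)
  moreover have "(LINT x|lborel. 1/2 * indicat_real ?B x) = 1/2 * (unit_ball_vol (real CARD('d)) * (1 / q) ^ CARD('d))"
    using q by (simp add: content_cball)
  moreover have "(1 / q) ^ CARD('d) = q powr (- real CARD('d))"
    using q by (simp add: powr_minus powr_realpow power_divide divide_inverse power_inverse)
  ultimately show ?thesis by simp
qed

text \<open>
  The part of \<open>I(q)\<close> over the ball of radius \<open>\<delta>\<close> is rescaled by \<open>s\<close> and compared with \<open>I(q + 2)\<close> by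
  \<open>sphere_transform_dilation_powr\<close>; this costs the factor \<open>s\<^sup>d \<le> exp ((d + 1/2) / q)\<close>.  The part outside
  is at most a constant times \<open>\<rho>\<^sup>q\<close>, hence negligible relative to \<open>I(q)\<close>.  The claim follows since
  \<open>d + 1/2 < d + 1\<close>.
\<close>

lemma transform_moment_ratio:
  assumes dim: "CARD('d::finite) \<ge> 2"
  obtains q1 :: real where "q1 \<ge> 1" "\<And>q. q \<ge> q1 \<Longrightarrow> integrable lborel (\<lambda>x :: real^'d. \<bar>sphere_transform x\<bar> powr q)"
    "\<And>q. q \<ge> q1 \<Longrightarrow> transform_moment TYPE('d) q < (1 + (real CARD('d) + 1) / (q + 1)) * transform_moment TYPE('d) (q + 2)"
proof -
  obtain q0 :: real where q0: "q0 \<ge> 1" "\<And>q. q \<ge> q0 \<Longrightarrow> integrable lborel (\<lambda>x :: real^'d. \<bar>sphere_transform x\<bar> powr q)"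
    using sphere_transform_integrable_powr[OF dim] by blast
  let ?I = "transform_moment TYPE('d)"
  let ?m = "\<lambda>x :: real^'d. \<bar>sphere_transform x\<bar>"
  define D where "D = real CARD('d)"
  have D: "D \<ge> 2" using dim by (simp add: D_def)
  define \<delta> where "\<delta> = 1 / (2 * D + 1)"
  have \<delta>: "0 < \<delta>" "\<delta> < pi" 
  proof -
    have "1 / (2 * D + 1) \<le> 1" using D by simp
    then show "0 < \<delta>" "\<delta> < pi" using D pi_gt3 unfolding \<delta>_def by (simp, linarith)
  qed
  define e :: "real^'d" where "e = axis undefined 1"
  have e: "e \<in> Basis" by (simp add: e_def axis_in_Basis_iff)
  obtain \<rho> where \<rho>: "0 < \<rho>" "\<rho> < 1" "\<And>t. t \<ge> \<delta> \<Longrightarrow> \<bar>profile e t\<bar> \<le> \<rho>"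
    using profile_bound_away[OF e dim refl \<delta>] by blast
  have away: "?m x \<le> \<rho>" if "norm x \<ge> \<delta>" for x
    using \<rho>(3)[OF that] by (simp add: sphere_transform_profile[OF e dim refl])
  define v where "v = unit_ball_vol (real CARD('d))"
  have v: "v > 0" by (simp add: v_def)
  have I0: "?I q \<ge> 0" for q by (simp add: transform_moment_def)
  \<comment> \<open>The tail is at most \<open>\<rho>\<^sup>q\<^sup>-\<^sup>q\<^sup>0 I(q0)\<close> and \<open>I(q)\<close> at least \<open>v/2 q\<^sup>-\<^sup>D\<close>; adding \<open>1\<close> to \<open>I(q0)\<close> keeps \<open>c\<close> positive.\<close>
  define c where "c = (?I q0 + 1) * \<rho> powr (- q0) / (v / 2)"
  have c: "c > 0" using I0[of q0] \<rho> v by (auto simp: c_def intro!: divide_pos_pos mult_pos_pos add_nonneg_pos)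
  have step: "?I q * (1 - c * \<rho> powr q * q powr (D + 1/2)) \<le> exp ((D + 1/2) / q) * ?I (q + 2)" if q: "q \<ge> q0" for q
  proof -
    have q1: "q \<ge> 1" using q q0 by linarith
    define s where "s = sqrt (1 + (2 + 1 / D) / q)"
    have s1: "s \<ge> 1" unfolding s_def using q1 D by simp
    let ?B = "cball (0::real^'d) \<delta>"
    let ?f = "\<lambda>x. indicat_real ?B x * ?m x powr q"
    have int: "integrable lborel (\<lambda>x. ?m x powr q)" "integrable lborel (\<lambda>x. ?m x powr (q + 2))" "integrable lborel (\<lambda>x. ?m x powr q0)"
      using q0 q by auto
    have [measurable]: "?B \<in> sets borel" by simp
    have [measurable]: "?f \<in> borel_measurable borel" by measurable
    have intf: "integrable lborel ?f"
      by (rule Bochner_Integration.integrable_bound[OF int(1)]) (auto simp: indicator_def)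
    have intg: "integrable lborel (\<lambda>x. (1 - indicat_real ?B x) * ?m x powr q)"
      by (rule Bochner_Integration.integrable_bound[OF int(1)]) (auto simp: indicator_def)
    have "?I q = (LINT x|lborel. ?f x + (1 - indicat_real ?B x) * ?m x powr q)"
      unfolding transform_moment_def by (rule Bochner_Integration.integral_cong) (auto simp: algebra_simps)
    also have "\<dots> = (LINT x|lborel. ?f x) + (LINT x|lborel. (1 - indicat_real ?B x) * ?m x powr q)"
      by (rule Bochner_Integration.integral_add[OF intf intg])
    also have "(LINT x|lborel. (1 - indicat_real ?B x) * ?m x powr q) \<le> (LINT x|lborel. \<rho> powr (q - q0) * ?m x powr q0)"
    proof (rule integral_mono[OF intg])
      show "integrable lborel (\<lambda>x. \<rho> powr (q - q0) * ?m x powr q0)" using int by simp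
      fix x :: "real^'d"
      show "(1 - indicat_real ?B x) * ?m x powr q \<le> \<rho> powr (q - q0) * ?m x powr q0"
      proof (cases "x \<in> ?B")
        case False
        then have "?m x \<le> \<rho>" by (intro away) simp
        then have "?m x powr (q - q0) * ?m x powr q0 \<le> \<rho> powr (q - q0) * ?m x powr q0"
          using q by (intro mult_right_mono powr_mono2) auto
        moreover have "?m x powr (q - q0) * ?m x powr q0 = ?m x powr q" by (simp add: powr_add[symmetric])
        ultimately show ?thesis using False by simp
      qed simp
    qed
    also have "(LINT x|lborel. \<rho> powr (q - q0) * ?m x powr q0) = \<rho> powr (q - q0) * ?I q0"
      by (simp add: transform_moment_def)
    also have "(LINT x|lborel. ?f x) = s ^ CARD('d) * (LINT x|lborel. ?f (s *\<^sub>R x))"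
      using s1 by (intro lborel_integral_dilation) auto
    also have "(LINT x|lborel. ?f (s *\<^sub>R x)) \<le> ?I (q + 2)"
      unfolding transform_moment_def
    proof (rule integral_mono[OF _ int(2)])
      show "integrable lborel (\<lambda>x. ?f (s *\<^sub>R x))"
        using lborel_integral_dilation(2)[of s ?f] intf s1 by simp
      fix x :: "real^'d"
      show "?f (s *\<^sub>R x) \<le> ?m x powr (q + 2)"
      proof (cases "s *\<^sub>R x \<in> ?B")
        case True
        then have "norm (s *\<^sub>R x) \<le> \<delta>" by simp
        from sphere_transform_dilation_powr[OF _ _ \<delta>_def s_def this] show ?thesis using q1 D True by simp
      qed simp
    qed
    finally have *: "?I q \<le> s ^ CARD('d) * ?I (q + 2) + \<rho> powr (q - q0) * ?I q0" using s1 by (simp add: mult_left_mono)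
    have "s ^ CARD('d) = (1 + (2 + 1 / D) / q) powr (D / 2)"
    proof -
      have p: "1 + (2 + 1 / D) / q > 0" using q1 D by (simp add: add_pos_nonneg)
      have "s = (1 + (2 + 1 / D) / q) powr (1/2)" using p by (simp add: s_def powr_half_sqrt)
      then have "s powr D = (1 + (2 + 1 / D) / q) powr (D / 2)" by (simp add: powr_powr)
      moreover have "s ^ CARD('d) = s powr D" using s1 by (simp add: D_def powr_realpow)
      ultimately show ?thesis by simp
    qed
    also have "\<dots> \<le> exp ((2 + 1 / D) / q) powr (D / 2)"
      using q1 D by (intro powr_mono2 exp_ge_add_one_self) (auto intro!: add_nonneg_nonneg)
    also have "\<dots> = exp ((D + 1/2) / q)"
      using D q1 by (simp add: exp_powr_real field_simps)
    finally have s_le: "s ^ CARD('d) \<le> exp ((D + 1/2) / q)" .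
    have tail: "\<rho> powr (q - q0) * ?I q0 \<le> ?I q * (c * \<rho> powr q * q powr (D + 1/2))"
    proof -
      have low: "v / 2 * q powr (- D) \<le> ?I q"
        using transform_moment_lower[OF q1 int(1)] by (simp add: v_def D_def)
      have "\<rho> powr (q - q0) * ?I q0 \<le> \<rho> powr (q - q0) * (?I q0 + 1)" by (intro mult_left_mono) auto
      also have "\<dots> = (v / 2 * q powr (- D)) * (c * \<rho> powr q * q powr D)"
      proof -
        have "q powr D \<noteq> 0" "\<rho> powr q0 \<noteq> 0" using q1 \<rho> by auto
        then show ?thesis using v by (simp add: c_def powr_diff powr_minus field_simps)
      qed
      also have "\<dots> \<le> ?I q * (c * \<rho> powr q * q powr (D + 1/2))"
      proof (rule mult_mono[OF low])
        show "c * \<rho> powr q * q powr D \<le> c * \<rho> powr q * q powr (D + 1/2)"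
          using c q1 by (intro mult_left_mono powr_mono) auto
      qed (use I0 c in auto)
      finally show ?thesis .
    qed
    have "s ^ CARD('d) * ?I (q + 2) \<le> exp ((D + 1/2) / q) * ?I (q + 2)"
      by (intro mult_right_mono s_le I0)
    with * tail show ?thesis by (simp add: right_diff_distrib)
  qed
  have "\<forall>\<^sub>F q in at_top. exp (a / q) < (1 + (a + 1/2) / (q + 1)) * (1 - c * \<rho> powr q * q powr a)" if "a \<ge> 2" for a
    using that c \<rho> by real_asymp
  from this[of "D + 1/2"] have "\<forall>\<^sub>F q in at_top. exp ((D + 1/2) / q) < (1 + (D + 1) / (q + 1)) * (1 - c * \<rho> powr q * q powr (D + 1/2))"
    using D by (simp add: add.assoc)
  then obtain q2 where q2: "\<And>q. q \<ge> q2 \<Longrightarrow> exp ((D + 1/2) / q) < (1 + (D + 1) / (q + 1)) * (1 - c * \<rho> powr q * q powr (D + 1/2))"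
    unfolding eventually_at_top_linorder by blast
  show ?thesis
  proof (rule that[of "max q0 q2"])
    fix q assume q: "max q0 q2 \<le> q"
    then have qq: "q \<ge> q0" "q \<ge> q2" "q \<ge> 1" using q0 by auto
    let ?\<theta> = "1 - c * \<rho> powr q * q powr (D + 1/2)" and ?b = "1 + (D + 1) / (q + 1)"
    have b: "?b > 0" using D qq by (intro add_pos_nonneg) auto
    have lt: "exp ((D + 1/2) / q) < ?b * ?\<theta>" using q2 qq by blast
    then have "?b * ?\<theta> > 0" using exp_gt_zero[of "(D + 1/2) / q"] by linarith
    then have \<theta>: "?\<theta> > 0" using b by (simp add: zero_less_mult_iff)
    have "v / 2 * (q + 2) powr (- D) > 0" using v qq by simp
    also have "v / 2 * (q + 2) powr (- D) \<le> ?I (q + 2)"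
      using transform_moment_lower[of "q + 2", where 'd = 'd] q0 qq by (simp add: v_def D_def)
    finally have pos: "?I (q + 2) > 0" .
    have "?I q * ?\<theta> \<le> exp ((D + 1/2) / q) * ?I (q + 2)" by (rule step[OF qq(1)])
    also have "\<dots> < (?b * ?\<theta>) * ?I (q + 2)" using lt pos by simp
    finally have "?I q * ?\<theta> < (?b * ?I (q + 2)) * ?\<theta>" by (simp only: mult_ac)
    then show "?I q < (1 + (real CARD('d) + 1) / (q + 1)) * ?I (q + 2)"
      using \<theta> unfolding D_def by simp
  qed (use q0 in auto)
qed

section \<open>From maximizers to critical points\<close>

lemma norm_powr_add_two: "norm z powr (q + 2) = norm z powr q * (norm z)\<^sup>2" for z :: complex
  by (cases "z = 0") (simp_all add: powr_add)

lemma extension_eq_0: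
  fixes g :: "real^'d \<Rightarrow> complex"
  assumes "\<And>\<omega>. norm \<omega> = 1 \<Longrightarrow> g \<omega> = 0"
  shows "extension g x = 0"
  using extension_cong[of g "\<lambda>_. 0" x] assms by (simp add: extension_def)

lemma integrable_extension_powr_add_two:
  fixes g :: "real^'d \<Rightarrow> complex"
  assumes "continuous_on (sphere 0 1) g" "q \<ge> 1" "integrable lborel (\<lambda>x. norm (extension g x) powr q)"
  shows "integrable lborel (\<lambda>x. norm (extension g x) powr (q + 2))"
  unfolding norm_powr_add_two by (rule integrable_powr_extension_square[OF assms assms(1)])

text \<open>
  The functional is compared along \<open>F + t g\<close>.  By the tangent inequality its left-hand side is at
  least the affine function \<open>J + (q + 2) t X\<close> of \<open>t\<close>, while the right-hand side is smooth in \<open>t\<close> and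
  agrees with it at \<open>t = 0\<close>.  Thus the two have the same derivative at \<open>0\<close>, and the \<open>L\<^sup>q\<^sup>+\<^sup>2\<close> norm
  never has to be differentiated.
\<close>

lemma maximal_imp_critical:
  fixes F :: "real^'d \<Rightarrow> real" and q \<Lambda> :: real
  assumes F: "continuous_on (sphere 0 1) F" and q: "q \<ge> 1" and nz: "\<exists>\<omega>. norm \<omega> = 1 \<and> F \<omega> \<noteq> 0"
    and int: "\<And>g :: real^'d \<Rightarrow> complex. continuous_on (sphere 0 1) g \<Longrightarrow> integrable lborel (\<lambda>x. norm (extension g x) powr q)"
    and max: "\<And>g :: real^'d \<Rightarrow> complex. continuous_on (sphere 0 1) g \<Longrightarrow>
      (LINT x|lborel. norm (extension g x) powr (q + 2)) \<le> \<Lambda> * (LINT \<omega>|sphere_measure. (norm (g \<omega>))\<^sup>2) powr ((q + 2) / 2)"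
    and eq: "(LINT x|lborel. norm (real_extension F x) powr (q + 2)) = \<Lambda> * sphere_sq F powr ((q + 2) / 2)"
    and \<Lambda>: "\<Lambda> > 0"
  shows "critical_point F q (\<Lambda> * sphere_sq F powr (q / 2))"
proof
  show "continuous_on (sphere 0 1) F" "q \<ge> 1" "\<exists>\<omega>. norm \<omega> = 1 \<and> F \<omega> \<noteq> 0" by fact+
  have cF: "continuous_on (sphere 0 1) (\<lambda>\<omega>. complex_of_real (F \<omega>))" by (intro continuous_intros F)
  show "integrable lborel (\<lambda>x. norm (real_extension F x) powr q)" by (rule int[OF cF])
  define N where "N = sphere_sq F"
  have N: "N > 0" using nz sphere_sq_pos[OF F] by (auto simp: N_def)
  show "0 < \<Lambda> * sphere_sq F powr (q / 2)" using \<Lambda> N by (simp add: N_def)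
  fix g :: "real^'d \<Rightarrow> complex" assume g: "continuous_on (sphere 0 1) g"
  let ?u = "real_extension F" and ?v = "extension g"
  let ?P = "q + 2"
  define X where "X = (LINT x|lborel. norm (?u x) powr q * Re (cnj (?u x) * ?v x))"
  define B where "B = (LINT \<omega>|sphere_measure. F \<omega> * Re (g \<omega>))"
  define G where "G = (LINT \<omega>|sphere_measure. (norm (g \<omega>))\<^sup>2)"
  define J where "J = (LINT x|lborel. norm (?u x) powr ?P)"
  have intP: "integrable lborel (\<lambda>x. norm (extension g x) powr ?P)" if "continuous_on (sphere 0 1) g" for g :: "real^'d \<Rightarrow> complex"
    by (rule integrable_extension_powr_add_two[OF that q int[OF that]])
  have intX: "integrable lborel (\<lambda>x. norm (?u x) powr q * Re (cnj (?u x) * ?v x))"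
    by (rule integrable_powr_extension_cross[OF cF q int[OF cF] cF g])
  let ?H = "\<lambda>t. \<Lambda> * (N + 2 * t * B + t\<^sup>2 * G) powr (?P / 2) - J - ?P * t * X"
  have nonneg: "?H t \<ge> 0" for t
  proof -
    let ?g = "\<lambda>\<omega>. complex_of_real (F \<omega>) + complex_of_real t * g \<omega>"
    have ctg: "continuous_on (sphere 0 1) (\<lambda>\<omega>. complex_of_real t * g \<omega>)" by (intro continuous_intros g)
    have cg: "continuous_on (sphere 0 1) ?g" by (intro continuous_intros F g)
    have ext: "extension ?g x = ?u x + t * ?v x" for x
      using extension_add[OF cF ctg] by (simp add: extension_cmult)
    have sq: "(LINT \<omega>|sphere_measure. (norm (?g \<omega>))\<^sup>2) = N + 2 * t * B + t\<^sup>2 * G"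
    proof -
      have i: "integrable sphere_measure (\<lambda>\<omega>. F \<omega> * F \<omega>)" "integrable sphere_measure (\<lambda>\<omega>. F \<omega> * Re (g \<omega>))" "integrable sphere_measure (\<lambda>\<omega>. (norm (g \<omega>))\<^sup>2)"
        by (intro integrable_continuous_on_sphere continuous_intros F g)+
      have "(norm (?g \<omega>))\<^sup>2 = F \<omega> * F \<omega> + (2 * t) * (F \<omega> * Re (g \<omega>)) + t\<^sup>2 * (norm (g \<omega>))\<^sup>2" for \<omega>
        unfolding cmod_power2 by (simp add: power2_eq_square algebra_simps)
      then show ?thesis using i by (simp add: N_def B_def G_def sphere_inner_def)
    qed
    have "J + ?P * t * X = (LINT x|lborel. norm (?u x) powr ?P + (?P * t) * (norm (?u x) powr q * Re (cnj (?u x) * ?v x)))"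
      using intP[OF cF] intX by (simp add: J_def X_def)
    also have "\<dots> \<le> (LINT x|lborel. norm (extension ?g x) powr ?P)"
    proof (rule integral_mono)
      show "integrable lborel (\<lambda>x. norm (extension ?g x) powr ?P)" by (rule intP[OF cg])
      fix x
      have "norm (?u x) powr ?P + ?P * (norm (?u x) powr (?P - 2) * Re (cnj (?u x) * (t * ?v x))) \<le> norm (?u x + t * ?v x) powr ?P"
        using q by (intro norm_powr_tangent) simp
      moreover have "Re (cnj (?u x) * (t * ?v x)) = t * Re (cnj (?u x) * ?v x)" by (simp add: algebra_simps)
      ultimately show "norm (?u x) powr ?P + (?P * t) * (norm (?u x) powr q * Re (cnj (?u x) * ?v x)) \<le> norm (extension ?g x) powr ?P"
        unfolding ext by (simp add: mult_ac)
    qed (use intP[OF cF] intX in auto)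
    also have "\<dots> \<le> \<Lambda> * (N + 2 * t * B + t\<^sup>2 * G) powr (?P / 2)"
      using max[OF cg] unfolding sq .
    finally show ?thesis by simp
  qed
  have H0: "?H 0 = 0" using eq by (simp add: J_def N_def)
  have der: "(?H has_real_derivative \<Lambda> * (?P / 2 * N powr (?P / 2 - 1) * (2 * B)) - ?P * X) (at 0)"
  proof -
    have d1: "((\<lambda>t. N + 2 * t * B + t\<^sup>2 * G) has_real_derivative 2 * B) (at 0)"
      by (auto intro!: derivative_eq_intros)
    have d2: "((\<lambda>y. y powr (?P / 2)) has_real_derivative ?P / 2 * N powr (?P / 2 - 1)) (at (N + 2 * 0 * B + 0\<^sup>2 * G))"
      using has_real_derivative_powr[OF N, of "?P / 2"] by simp
    show ?thesis
      by (rule derivative_eq_intros DERIV_chain2[OF d2 d1] refl | simp)+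
  qed
  have "\<Lambda> * (?P / 2 * N powr (?P / 2 - 1) * (2 * B)) - ?P * X = 0"
    by (rule DERIV_local_min[OF der, of 1]) (use nonneg H0 in auto)
  moreover have "?P / 2 - 1 = q / 2" by (simp add: add_divide_distrib)
  ultimately have "?P * X = ?P * (\<Lambda> * N powr (q / 2) * B)" by (simp add: field_simps)
  then have "X = \<Lambda> * N powr (q / 2) * B" using q by simp
  then show "(LINT x|lborel. norm (?u x) powr q * Re (cnj (?u x) * ?v x)) = \<Lambda> * sphere_sq F powr (q / 2) * (LINT \<omega>|sphere_measure. F \<omega> * Re (g \<omega>))"
    by (simp add: X_def B_def N_def)
qed

lemma Phi_cong:
  fixes g h :: "real^'d \<Rightarrow> complex"
  assumes "\<And>\<omega>. norm \<omega> = 1 \<Longrightarrow> g \<omega> = h \<omega>"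
  shows "Phi q g = Phi q h"
proof -
  have "extension g = extension h" by (rule ext, rule extension_cong[OF assms])
  moreover have "L2_sphere_norm g = L2_sphere_norm h"
    unfolding L2_sphere_norm_def
    by (intro arg_cong[of _ _ sqrt] Bochner_Integration.integral_cong refl) (use assms in \<open>auto simp: space_sphere_measure\<close>)
  ultimately show ?thesis by (simp add: Phi_def)
qed

lemma L2_sphere_norm_powr:
  fixes g :: "real^'d \<Rightarrow> complex"
  shows "L2_sphere_norm g powr q = (LINT \<omega>|sphere_measure. (norm (g \<omega>))\<^sup>2) powr (q / 2)"
proof -
  have "(LINT \<omega>|sphere_measure. (norm (g \<omega>))\<^sup>2) \<ge> 0" by simp
  then show ?thesis unfolding L2_sphere_norm_def by (simp add: powr_half_sqrt[symmetric] powr_powr)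
qed

lemma L2_sq_pos:
  fixes g :: "real^'d \<Rightarrow> complex"
  assumes "continuous_on (sphere 0 1) g" "norm w = 1" "g w \<noteq> 0"
  shows "(LINT \<omega>|sphere_measure. (norm (g \<omega>))\<^sup>2) > 0"
  by (rule integral_square_sphere_pos[of "\<lambda>\<omega>. norm (g \<omega>)" w]) (use assms in \<open>auto intro!: continuous_intros\<close>)

lemma continuous_in_L2_sphere_nonzero:
  fixes g :: "real^'d \<Rightarrow> complex"
  assumes g: "continuous_on (sphere 0 1) g" and w: "norm w = 1" "g w \<noteq> 0"
  shows "g \<in> L2_sphere_nonzero"
proof -
  have "\<not> (AE \<omega> in sphere_measure. g \<omega> = 0)"
  proof
    assume "AE \<omega> in sphere_measure. g \<omega> = 0"
    then have "AE \<omega> in sphere_measure. (norm (g \<omega>))\<^sup>2 = 0" by eventually_elim simp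
    then have "(LINT \<omega>|sphere_measure. (norm (g \<omega>))\<^sup>2) = 0" by (rule integral_eq_zero_AE)
    then show False using L2_sq_pos[OF g w] by simp
  qed
  moreover have "integrable sphere_measure (\<lambda>\<omega>. (norm (g \<omega>))\<^sup>2)"
    by (intro integrable_continuous_on_sphere continuous_intros g)
  then have "g \<in> L2_sphere"
    unfolding L2_sphere_def using borel_measurable_continuous_on_sphere[OF g] by simp
  ultimately show ?thesis by (simp add: L2_sphere_nonzero_def)
qed

lemma Phi_le_imp_integral_le:
  fixes g :: "real^'d \<Rightarrow> complex"
  assumes g: "continuous_on (sphere 0 1) g" and q: "q > 0" and w: "norm w = 1" "g w \<noteq> 0"
    and le: "Phi q g \<le> ennreal c" and c: "c \<ge> 0"
  shows "integrable lborel (\<lambda>x. norm (extension g x) powr q)"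
    "(LINT x|lborel. norm (extension g x) powr q) \<le> c * (LINT \<omega>|sphere_measure. (norm (g \<omega>))\<^sup>2) powr (q / 2)"
proof -
  let ?a = "\<integral>\<^sup>+ x. ennreal (norm (extension g x) powr q) \<partial>lborel"
  let ?S = "(LINT \<omega>|sphere_measure. (norm (g \<omega>))\<^sup>2) powr (q / 2)"
  have S: "?S > 0" using L2_sq_pos[OF g w] by simp
  have "?a = ?a / ennreal ?S * ennreal ?S"
    using S by (simp add: ennreal_divide_times divide_ennreal)
  also have "\<dots> \<le> ennreal c * ennreal ?S"
    using le unfolding Phi_def L2_sphere_norm_powr by (rule mult_right_mono) simp
  also have "\<dots> = ennreal (c * ?S)" using c S by (simp add: ennreal_mult)
  finally have a: "?a \<le> ennreal (c * ?S)" .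
  have "continuous_on UNIV (\<lambda>x. norm (extension g x) powr q)"
    by (rule continuous_norm_extension_powr[OF g q])
  then have m: "(\<lambda>x. norm (extension g x) powr q) \<in> borel_measurable lborel"
    using borel_measurable_continuous_onI by simp
  show int: "integrable lborel (\<lambda>x. norm (extension g x) powr q)"
  proof (rule integrableI_bounded[OF m])
    show "(\<integral>\<^sup>+ x. ennreal (norm (norm (extension g x) powr q)) \<partial>lborel) < \<infinity>"
      using a by (simp add: le_less_trans[OF _ ennreal_less_top])
  qed
  have "ennreal (LINT x|lborel. norm (extension g x) powr q) \<le> ennreal (c * ?S)"
    using a nn_integral_eq_integral[OF int] by simp
  then show "(LINT x|lborel. norm (extension g x) powr q) \<le> c * ?S"
    using c S by (subst (asm) ennreal_le_iff) auto
qed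

lemma Phi_eq_ennreal:
  fixes g :: "real^'d \<Rightarrow> complex"
  assumes g: "continuous_on (sphere 0 1) g" and w: "norm w = 1" "g w \<noteq> 0"
    and int: "integrable lborel (\<lambda>x. norm (extension g x) powr q)"
  shows "Phi q g = ennreal ((LINT x|lborel. norm (extension g x) powr q) / (LINT \<omega>|sphere_measure. (norm (g \<omega>))\<^sup>2) powr (q / 2))"
  unfolding Phi_def L2_sphere_norm_powr using L2_sq_pos[OF g w]
  by (subst nn_integral_eq_integral[OF int]) (auto intro!: divide_ennreal)

lemma C1_on_sphere_imp_continuous:
  fixes f :: "real^'d \<Rightarrow> complex"
  assumes "C1_on_sphere f"
  shows "continuous_on (sphere 0 1) f"
  unfolding continuous_on_eq_continuous_within
proof
  fix w :: "real^'d" assume w: "w \<in> sphere 0 1"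
  with assms obtain U g where U: "w \<in> U" "C1_on_open U g" "\<forall>x \<in> U \<inter> sphere 0 1. g x = f x"
    unfolding C1_on_sphere_def by blast
  then have "open U" and "\<exists>D. (g has_derivative D) (at w)" unfolding C1_on_open_def by blast+
  then have "continuous (at w within sphere 0 1) g"
    using has_derivative_continuous continuous_at_imp_continuous_within by blast
  moreover have "\<forall>\<^sub>F x in at w within sphere 0 1. g x = f x"
    using U(1,3) \<open>open U\<close> unfolding eventually_at_topological by blast
  moreover have "g w = f w" using U(1,3) w by blast
  ultimately show "continuous (at w within sphere 0 1) f"
    unfolding continuous_within using tendsto_cong[of g f "at w within sphere 0 1"] by simp
qed

theorem theorem1p5:
  assumes "CARD('d::finite) \<ge> 2"
  shows "\<exists>qstar::real. qstar \<ge> 2 * (real CARD('d) + 1) / (real CARD('d) - 1) \<and>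
    (\<forall>q \<ge> qstar.
       (\<forall>c::complex. c \<noteq> 0 \<longrightarrow> maximizer q (\<lambda>_ :: real ^ 'd. c)) \<longrightarrow>
       (\<forall>f :: real ^ 'd \<Rightarrow> complex.
          maximizer (q + 2) f \<and> (\<forall>\<omega> \<in> sphere 0 1. f \<omega> \<in> \<real>) \<and> C1_on_sphere f \<longrightarrow>
          f constant_on sphere 0 1))"
proof -
  obtain q1 :: real where q1: "q1 \<ge> 1" "\<And>q. q \<ge> q1 \<Longrightarrow> integrable lborel (\<lambda>x :: real^'d. \<bar>sphere_transform x\<bar> powr q)"
    "\<And>q. q \<ge> q1 \<Longrightarrow> transform_moment TYPE('d) q < (1 + (real CARD('d) + 1) / (q + 1)) * transform_moment TYPE('d) (q + 2)"
    using transform_moment_ratio[OF assms] by blast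
  define m where "m = sphere_mass TYPE('d)"
  have m: "m > 0" unfolding m_def by (rule sphere_mass_pos)
  let ?I = "transform_moment TYPE('d)"
  let ?one = "\<lambda>_ :: real^'d. 1 :: complex"
  obtain w0 :: "real^'d" where w0: "norm w0 = 1" using norm_axis_1 by blast
  have one_cont: "continuous_on (sphere 0 1) ?one" by simp
  have one_ext: "norm (extension ?one x) powr q = m powr q * \<bar>sphere_transform x\<bar> powr q" for x :: "real^'d" and q
    using norm_extension_one[of x] m by (simp add: powr_mult m_def)
  have one_sq: "(LINT \<omega>|(sphere_measure :: (real^'d) measure). (norm (?one \<omega>))\<^sup>2) = m" by (simp add: m_def)
  have one_int: "integrable lborel (\<lambda>x. norm (extension ?one x) powr q)" if "q \<ge> q1" for q
    unfolding one_ext using q1(2)[OF that] by simp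
  have one_Phi: "Phi q ?one = ennreal (m powr (q / 2) * ?I q)" if "q \<ge> q1" for q
  proof -
    have "m powr q / m powr (q / 2) = m powr (q / 2)" using powr_diff[of m q "q / 2"] by simp
    then have "m powr q * ?I q / m powr (q / 2) = m powr (q / 2) * ?I q" by (metis times_divide_eq_left)
    moreover have "(LINT x|lborel. norm (extension ?one x) powr q) = m powr q * ?I q"
      unfolding one_ext by (simp add: transform_moment_def)
    ultimately show ?thesis using Phi_eq_ennreal[OF one_cont w0 _ one_int[OF that]] unfolding one_sq by simp
  qed
  have I0: "?I q \<ge> 0" for q by (simp add: transform_moment_def)
  show ?thesis
  proof (intro exI conjI allI impI)
    \<comment> \<open>The condition \<open>q \<ge> d\<close> makes the factor \<open>1 + (d + 1) / (q + 1)\<close> at most \<open>2\<close>, as the parity argument requires.\<close>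
    let ?qs = "max (2 * (real CARD('d) + 1) / (real CARD('d) - 1)) (max q1 (real CARD('d)))"
    show "2 * (real CARD('d) + 1) / (real CARD('d) - 1) \<le> ?qs" by simp
    fix q :: real and f :: "real^'d \<Rightarrow> complex"
    assume q: "?qs \<le> q" and const: "\<forall>c::complex. c \<noteq> 0 \<longrightarrow> maximizer q (\<lambda>_ :: real ^ 'd. c)"
      and f: "maximizer (q + 2) f \<and> (\<forall>\<omega> \<in> sphere 0 1. f \<omega> \<in> \<real>) \<and> C1_on_sphere f"
    have qq: "q \<ge> q1" "q \<ge> 1" "q \<ge> real CARD('d)" using q q1 by auto
    have max1: "maximizer q ?one" using const by simp
    define F where "F = (\<lambda>\<omega>. Re (f \<omega>))"
    have fF: "f \<omega> = complex_of_real (F \<omega>)" if "norm \<omega> = 1" for \<omega>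
      using f that by (auto simp: F_def)
    have cf: "continuous_on (sphere 0 1) f" using f C1_on_sphere_imp_continuous by blast
    then have cF: "continuous_on (sphere 0 1) F" unfolding F_def by (intro continuous_intros)
    have ccF: "continuous_on (sphere 0 1) (\<lambda>\<omega>. complex_of_real (F \<omega>))" by (intro continuous_intros cF)
    have nz: "\<exists>\<omega>. norm \<omega> = 1 \<and> F \<omega> \<noteq> 0"
    proof (rule ccontr)
      assume "\<not> ?thesis"
      then have "\<And>\<omega>. norm \<omega> = 1 \<Longrightarrow> f \<omega> = 0" using fF by simp
      then have "AE \<omega> in sphere_measure. f \<omega> = 0" by (intro AE_I2) (simp add: space_sphere_measure)
      then show False using f by (simp add: maximizer_def L2_sphere_nonzero_def)
    qed
    then obtain w where w: "norm w = 1" "F w \<noteq> 0" by blast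
    have base: "integrable lborel (\<lambda>x. norm (extension g x) powr q) \<and>
        (LINT x|lborel. norm (extension g x) powr q) \<le> (m powr (q / 2) * ?I q) * (LINT \<omega>|sphere_measure. (norm (g \<omega>))\<^sup>2) powr (q / 2)"
      if g: "continuous_on (sphere 0 1) g" for g :: "real^'d \<Rightarrow> complex"
    proof (cases "\<exists>\<omega>. norm \<omega> = 1 \<and> g \<omega> \<noteq> 0")
      case True
      then obtain w' where w': "norm w' = 1" "g w' \<noteq> 0" by blast
      have "Phi q g \<le> Phi q ?one"
        using max1 continuous_in_L2_sphere_nonzero[OF g w'] unfolding maximizer_def by (simp add: SUP_upper)
      then have "Phi q g \<le> ennreal (m powr (q / 2) * ?I q)" using one_Phi[OF qq(1)] by simp
      from Phi_le_imp_integral_le[OF g _ w' this] show ?thesis using qq m I0 by simp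
    next
      case False
      then have "extension g x = 0" for x using extension_eq_0 by blast
      then show ?thesis using I0 m by simp
    qed
    define N where "N = sphere_sq F"
    have N: "N > 0" unfolding N_def by (rule sphere_sq_pos[OF cF w])
    have sqF: "(LINT \<omega>|sphere_measure. (norm (complex_of_real (F \<omega>)))\<^sup>2) = N"
      by (simp add: N_def sphere_inner_def power2_eq_square)
    define \<Lambda> where "\<Lambda> = (LINT x|lborel. norm (real_extension F x) powr (q + 2)) / N powr ((q + 2) / 2)"
    have intF: "integrable lborel (\<lambda>x. norm (real_extension F x) powr (q + 2))"
      using integrable_extension_powr_add_two[OF ccF qq(2)] base[OF ccF] by blast
    have PhiF: "Phi (q + 2) f = ennreal \<Lambda>"
    proof -
      have "Phi (q + 2) f = Phi (q + 2) (\<lambda>\<omega>. complex_of_real (F \<omega>))" by (rule Phi_cong) (rule fF)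
      also have "\<dots> = ennreal \<Lambda>"
        using Phi_eq_ennreal[OF ccF w(1) _ intF] w(2) unfolding sqF \<Lambda>_def by simp
      finally show ?thesis .
    qed
    have \<Lambda>0: "\<Lambda> \<ge> 0" by (simp add: \<Lambda>_def)
    have Phi_le: "Phi (q + 2) g \<le> ennreal \<Lambda>" if "g \<in> L2_sphere_nonzero" for g :: "real^'d \<Rightarrow> complex"
    proof -
      have "Phi (q + 2) g \<le> (SUP g \<in> (L2_sphere_nonzero :: (real ^ 'd \<Rightarrow> complex) set). Phi (q + 2) g)"
        by (rule SUP_upper[OF that])
      also have "\<dots> = Phi (q + 2) f" using f unfolding maximizer_def by simp
      finally show ?thesis unfolding PhiF .
    qed
    have max_p: "(LINT x|lborel. norm (extension g x) powr (q + 2)) \<le> \<Lambda> * (LINT \<omega>|sphere_measure. (norm (g \<omega>))\<^sup>2) powr ((q + 2) / 2)"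
      if g: "continuous_on (sphere 0 1) g" for g :: "real^'d \<Rightarrow> complex"
    proof (cases "\<exists>\<omega>. norm \<omega> = 1 \<and> g \<omega> \<noteq> 0")
      case True
      then obtain w' where w': "norm w' = 1" "g w' \<noteq> 0" by blast
      show ?thesis
        by (rule Phi_le_imp_integral_le(2)[OF g _ w' Phi_le[OF continuous_in_L2_sphere_nonzero[OF g w']] \<Lambda>0])
          (use qq in simp)
    next
      case False
      then have "extension g x = 0" for x using extension_eq_0 by blast
      then show ?thesis using \<Lambda>0 by simp
    qed
    have \<Lambda>_lower: "m powr ((q + 2) / 2) * ?I (q + 2) \<le> \<Lambda>"
    proof -
      have "Phi (q + 2) ?one \<le> ennreal \<Lambda>"
        by (rule Phi_le) (rule continuous_in_L2_sphere_nonzero[OF one_cont w0], simp)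
      then have "ennreal (m powr ((q + 2) / 2) * ?I (q + 2)) \<le> ennreal \<Lambda>"
        using one_Phi[of "q + 2"] qq by simp
      then show ?thesis using \<Lambda>0 by simp
    qed
    define b where "b = 1 + (real CARD('d) + 1) / (q + 1)"
    have ratio: "?I q < b * ?I (q + 2)" using q1(3)[OF qq(1)] by (simp add: b_def)
    have b: "0 < b" "b \<le> 2" using qq by (auto simp: b_def add_pos_nonneg divide_le_eq)
    have "?I (q + 2) > 0" using ratio I0[of q] b by (metis le_less_trans zero_less_mult_pos)
    then have "\<Lambda> > 0" using \<Lambda>_lower m by (smt (verit) mult_pos_pos powr_gt_zero)
    interpret critical_point F q "\<Lambda> * sphere_sq F powr (q / 2)"
    proof (rule maximal_imp_critical[OF cF qq(2) nz _ max_p _ \<open>\<Lambda> > 0\<close>])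
      show "integrable lborel (\<lambda>x. norm (extension g x) powr q)" if "continuous_on (sphere 0 1) g" for g :: "real^'d \<Rightarrow> complex"
        using base[OF that] by blast
      show "(LINT x|lborel. norm (real_extension F x) powr (q + 2)) = \<Lambda> * sphere_sq F powr ((q + 2) / 2)"
        using N by (simp add: \<Lambda>_def flip: N_def)
    qed
    let ?\<mu> = "\<Lambda> * sphere_sq F powr (q / 2)"
    have "trace_bound \<le> m * ((m powr (q / 2) * ?I q) * N powr (q / 2))"
      using base[OF ccF] m unfolding sqF m_def by (intro mult_left_mono) auto
    also have "\<dots> = (m powr ((q + 2) / 2) * N powr (q / 2)) * ?I q"
    proof -
      have "m powr ((q + 2) / 2) = m * m powr (q / 2)" using m by (simp add: add_divide_distrib powr_add)
      then show ?thesis by simp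
    qed
    also have "\<dots> < (m powr ((q + 2) / 2) * N powr (q / 2)) * (b * ?I (q + 2))"
      using ratio m N by (intro mult_strict_left_mono) auto
    also have "\<dots> = b * N powr (q / 2) * (m powr ((q + 2) / 2) * ?I (q + 2))" by simp
    also have "\<dots> \<le> b * N powr (q / 2) * \<Lambda>"
      using b by (intro mult_left_mono \<Lambda>_lower) auto
    finally have lt: "trace_bound < ?\<mu> * b" by (simp add: N_def mult_ac)
    also have "\<dots> \<le> ?\<mu> * 2" using b mu_pos by (intro mult_left_mono) auto
    finally have "trace_bound < 2 * ?\<mu>" by simp
    then have "F constant_on sphere 0 1"
      using nonconstant_trace_bound[OF assms] lt unfolding b_def by fastforce
    then obtain c where "\<And>\<omega>. norm \<omega> = 1 \<Longrightarrow> F \<omega> = c" by (auto simp: constant_on_def)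
    then show "f constant_on sphere 0 1"
      unfolding constant_on_def using fF by (intro exI[of _ "complex_of_real c"]) simp
  qed
qed

end
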